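(* Let $\Omega\subset\mathbb C^n$ be a bounded domain, let $u_0,u_1\in\mathcal{PSH}(\Omega)\cap L^\infty(\Omega)$, and let $u_t$, $0<t<1$, be the geodesic joining them. For $C\in\mathbb R$ put $P^C:=P(u_0,u_1-C)$. Then $$u_t(z)=\sup_{C\in\mathbb R}\{P^C(z)+Ct\},\qquad 0<t<1,\ z\in\Omega. \qquad (1)$$ Conversely, $$P^C(z)=\inf_{t\in(0,1)}\{u_t(z)-Ct\},\qquad C\in\mathbb R,\ z\in\Omega. \qquad (2)$$ In particular, $P(u_0,u_1)=\inf_{t\in(0,1)}u_t$. Moreover, if $\Omega$ is $B$-regular and $u_0,u_1\in\mathcal{PSH}(\Omega)\cap C(\overline\Omega)$, then (1) and (2) hold for $z\in\partial\Omega$ as well.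
   Context: $\mathcal{PSH}(G)$ denotes the plurisubharmonic (psh) functions on a domain $G$. For $u,v\in\mathcal{PSH}(\Omega)$ the rooftop envelope $P(u,v)=\sup\{w\in\mathcal{PSH}(\Omega): w\le\min(u,v)\}$ is the largest psh minorant of $\min\{u,v\}$ in $\Omega$. $\mathcal A=\{\zeta\in\mathbb C: 0<\log|\zeta|<1\}$, $\mathcal A_j=\{\log|\zeta|=j\}$, $j=0,1$. $W(u_0,u_1)$ is the class of $v\in\mathcal{PSH}(\Omega\times\mathcal A)$ such that $\limsup v(z,\zeta)\le u_j(z)$ as $\zeta\to\mathcal A_j$, for every $z\in\Omega$, $j=0,1$. The envelope $\widehat u(z,\zeta)=\sup\{v(z,\zeta):v\in W(u_0,u_1)\}$ is psh and depends on $\zeta$ only through $|\zeta|$; the geodesic joining $u_0$ and $u_1$ is the family $u_t(z)$, $0<t<1$, defined by $u_{\log|\zeta|}(z)=\widehat u(z,\zeta)$. A bounded domain $\Omega$ is $B$-regular if every $p\in\partial\Omega$ has a strong psh barrier, i.e. a function $\rho_p\in\mathcal{PSH}(\Omega)$ with $\sup_\Omega\rho_p=0$ and $\sup_{\Omega\setminus U}\rho_p<0$ for every neighborhood $U$ of $p$ (such a function can be chosen in $\mathcal{PSH}(\Omega)\cap C(\overline\Omega)$); equivalently (Sibony), every $f\in C(\partial\Omega)$ is the boundary value of some $u\in\mathcal{PSH}(\Omega)\cap C(\overline\Omega)$. For $B$-regular $\Omega$ and $u_0,u_1\in\mathcal{PSH}(\Omega)\cap C(\overline\Omega)$, both $u_t$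 and $P^C$ extend continuously to $\overline\Omega$, and their values on $\partial\Omega$ are those of the extensions. *)

theory Defs
  imports "HOL-Analysis.Analysis" "HOL-Library.Going_To_Filter"
begin

definition usc_on :: "'a::topological_space set \<Rightarrow> ('a \<Rightarrow> ereal) \<Rightarrow> bool" where
  "usc_on G u \<longleftrightarrow> (\<forall>c. openin (top_of_set G) {x \<in> G. u x < c})"

(* Integral mean over the circle of centre a and radius r. On a circle, an upper semicontinuous
   function with values below \<infinity> is bounded above, so the first integral is finite and the
   difference is never \<infinity> - \<infinity>; the mean may be -\<infinity>. Note that e2ennreal truncates
   negative values to 0, so the two integrands are the positive and the negative part. *)
definition circle_mean :: "(complex \<Rightarrow> ereal) \<Rightarrow> complex \<Rightarrow> real \<Rightarrow> ereal" where
  "circle_mean f a r =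
     (enn2ereal (\<integral>\<^sup>+ \<theta>\<in>{0..2*pi}. e2ennreal (f (a + of_real r * cis \<theta>)) \<partial>lborel)
      - enn2ereal (\<integral>\<^sup>+ \<theta>\<in>{0..2*pi}. e2ennreal (- f (a + of_real r * cis \<theta>)) \<partial>lborel))
     / ereal (2 * pi)"

(* The function that is identically -\<infinity> counts as subharmonic, and hence as psh below. *)
definition subharmonic_on :: "complex set \<Rightarrow> (complex \<Rightarrow> ereal) \<Rightarrow> bool" where
  "subharmonic_on D f \<longleftrightarrow>
     usc_on D f \<and> (\<forall>a\<in>D. f a < \<infinity>) \<and>
     (\<forall>a r. 0 < r \<and> cball a r \<subseteq> D \<longrightarrow> f a \<le> circle_mean f a r)"

(* The first argument is the multiplication of vectors by complex scalars, so that the same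
   definition applies to C^n and to C^n x C. *)
definition psh_wrt ::
  "(complex \<Rightarrow> 'a \<Rightarrow> 'a) \<Rightarrow> 'a::real_normed_vector set \<Rightarrow> ('a \<Rightarrow> ereal) \<Rightarrow> bool" where
  "psh_wrt sm G u \<longleftrightarrow>
     usc_on G u \<and> (\<forall>x\<in>G. u x < \<infinity>) \<and>
     (\<forall>a\<in>G. \<forall>b. subharmonic_on {k. a + sm k b \<in> G} (\<lambda>k. u (a + sm k b)))"

definition psh_on :: "(complex ^ 'n) set \<Rightarrow> (complex ^ 'n \<Rightarrow> ereal) \<Rightarrow> bool" where
  "psh_on = psh_wrt (\<lambda>c x. c *s x)"

definition psh_on_prod ::
  "((complex ^ 'n) \<times> complex) set \<Rightarrow> ((complex ^ 'n) \<times> complex \<Rightarrow> ereal) \<Rightarrow> bool" where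
  "psh_on_prod = psh_wrt (\<lambda>c (x, y). (c *s x, c * y))"

definition rooftop ::
  "(complex ^ 'n) set \<Rightarrow> (complex ^ 'n \<Rightarrow> ereal) \<Rightarrow> (complex ^ 'n \<Rightarrow> ereal) \<Rightarrow>
   complex ^ 'n \<Rightarrow> ereal" where
  "rooftop \<Omega> u v z = (SUP w \<in> {w. psh_on \<Omega> w \<and> (\<forall>x\<in>\<Omega>. w x \<le> min (u x) (v x))}. w z)"

definition annulus :: "complex set" where
  "annulus = {\<zeta>. 0 < ln (norm \<zeta>) \<and> ln (norm \<zeta>) < 1}"

definition W_class ::
  "(complex ^ 'n) set \<Rightarrow> (complex ^ 'n \<Rightarrow> ereal) \<Rightarrow> (complex ^ 'n \<Rightarrow> ereal) \<Rightarrow>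
   ((complex ^ 'n) \<times> complex \<Rightarrow> ereal) set" where
  "W_class \<Omega> u0 u1 = {v. psh_on_prod (\<Omega> \<times> annulus) v \<and>
     (\<forall>z\<in>\<Omega>.
        Limsup ((\<lambda>\<zeta>. ln (norm \<zeta>)) going_to nhds 0 within annulus) (\<lambda>\<zeta>. v (z, \<zeta>)) \<le> u0 z \<and>
        Limsup ((\<lambda>\<zeta>. ln (norm \<zeta>)) going_to nhds 1 within annulus) (\<lambda>\<zeta>. v (z, \<zeta>)) \<le> u1 z)}"

definition envelope ::
  "(complex ^ 'n) set \<Rightarrow> (complex ^ 'n \<Rightarrow> ereal) \<Rightarrow> (complex ^ 'n \<Rightarrow> ereal) \<Rightarrow>
   (complex ^ 'n) \<times> complex \<Rightarrow> ereal" where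
  "envelope \<Omega> u0 u1 p = (SUP v \<in> W_class \<Omega> u0 u1. v p)"

(* By envelope_eq_geodesic below, any point of the circle of radius exp t may be used here. *)
definition geodesic ::
  "(complex ^ 'n) set \<Rightarrow> (complex ^ 'n \<Rightarrow> ereal) \<Rightarrow> (complex ^ 'n \<Rightarrow> ereal) \<Rightarrow>
   real \<Rightarrow> complex ^ 'n \<Rightarrow> ereal" where
  "geodesic \<Omega> u0 u1 t z = envelope \<Omega> u0 u1 (z, of_real (exp t))"

(* The barriers are required to be continuous up to the boundary. Without a requirement on the
   behaviour of the barrier at p beyond sup = 0, the condition would not imply solvability of the
   Dirichlet problem for continuous boundary data: already for n = 1 it holds at some
   irregular boundary points. Suprema are taken in ereal, so the second one is -\<infinity> when U
   contains \<Omega>. *)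
definition B_regular :: "(complex ^ 'n) set \<Rightarrow> bool" where
  "B_regular \<Omega> \<longleftrightarrow>
     (\<forall>p\<in>frontier \<Omega>. \<exists>\<rho> :: complex ^ 'n \<Rightarrow> real.
        psh_on \<Omega> (\<lambda>z. ereal (\<rho> z)) \<and> continuous_on (closure \<Omega>) \<rho> \<and>
        (SUP z\<in>\<Omega>. ereal (\<rho> z)) = 0 \<and>
        (\<forall>U. open U \<and> p \<in> U \<longrightarrow> (SUP z\<in>\<Omega> - U. ereal (\<rho> z)) < 0))"

lemma W_class_rotate:
  assumes v: "v \<in> W_class \<Omega> u0 u1" and c: "norm c = 1"
  shows "(\<lambda>(z, \<zeta>). v (z, c * \<zeta>)) \<in> W_class \<Omega> u0 u1"
proof -
  define T :: "(complex ^ 'a) \<times> complex \<Rightarrow> (complex ^ 'a) \<times> complex"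
    where "T = (\<lambda>p. (fst p, c * snd p))"
  define sc :: "complex \<Rightarrow> (complex ^ 'a) \<times> complex \<Rightarrow> (complex ^ 'a) \<times> complex"
    where "sc = (\<lambda>k (x, y). (k *s x, k * y))"
  let ?G = "\<Omega> \<times> annulus"
  have Ann: "c * \<zeta> \<in> annulus \<longleftrightarrow> \<zeta> \<in> annulus" for \<zeta>
    by (simp add: annulus_def norm_mult c)
  have TG: "T p \<in> ?G \<longleftrightarrow> p \<in> ?G" for p
    by (cases p) (simp add: T_def Ann)
  have Tlin: "T (a + sc k b) = T a + sc k (T b)" for a k b
    by (cases a; cases b) (simp add: T_def sc_def algebra_simps)
  have cT: "continuous_on S T" for S
    unfolding T_def by (intro continuous_intros)
  have eq: "(\<lambda>(z, \<zeta>). v (z, c * \<zeta>)) = (\<lambda>p. v (T p))"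
    by (auto simp: T_def)
  have psh: "psh_wrt sc ?G v"
    using v by (simp add: W_class_def psh_on_prod_def sc_def)
  have usc: "usc_on ?G (\<lambda>p. v (T p))"
    unfolding usc_on_def
  proof
    fix b
    have "openin (top_of_set ?G) {x \<in> ?G. v x < b}"
      using psh by (simp add: psh_wrt_def usc_on_def)
    moreover have "T \<in> ?G \<rightarrow> ?G"
      by (rule Pi_I) (simp only: TG)
    ultimately have "openin (top_of_set ?G) (?G \<inter> T -` {x \<in> ?G. v x < b})"
      by (intro continuous_openin_preimage[OF cT])
    moreover have "?G \<inter> T -` {x \<in> ?G. v x < b} = {p \<in> ?G. v (T p) < b}"
      by (rule set_eqI) (simp only: Int_iff vimage_eq mem_Collect_eq TG conj_left_absorb)
    ultimately show "openin (top_of_set ?G) {p \<in> ?G. v (T p) < b}" by simp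
  qed
  have fin: "\<forall>p\<in>?G. v (T p) < \<infinity>"
  proof
    fix p assume "p \<in> ?G"
    then have "T p \<in> ?G" by (simp only: TG)
    then show "v (T p) < \<infinity>"
      using psh by (simp only: psh_wrt_def)
  qed
  have sub: "subharmonic_on {k. a + sc k b \<in> ?G} (\<lambda>k. v (T (a + sc k b)))"
    if "a \<in> ?G" for a b
  proof -
    have "subharmonic_on {k. T a + sc k (T b) \<in> ?G} (\<lambda>k. v (T a + sc k (T b)))"
      using psh that unfolding psh_wrt_def by (simp only: TG)
    moreover have "{k. T a + sc k (T b) \<in> ?G} = {k. a + sc k b \<in> ?G}"
      unfolding Tlin[symmetric] TG ..
    ultimately show ?thesis unfolding Tlin by (simp only:)
  qed
  have P: "psh_wrt sc ?G (\<lambda>p. v (T p))"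
    unfolding psh_wrt_def by (intro conjI usc fin ballI allI sub)
  have L: "Limsup ((\<lambda>\<zeta>. ln (norm \<zeta>)) going_to nhds j within annulus) (\<lambda>\<zeta>. v (z, c * \<zeta>))
      \<le> Limsup ((\<lambda>\<zeta>. ln (norm \<zeta>)) going_to nhds j within annulus) (\<lambda>\<zeta>. v (z, \<zeta>))" for j z
    unfolding Limsup_def
  proof (rule INF_greatest)
    fix Q :: "complex \<Rightarrow> bool"
    let ?F = "(\<lambda>\<zeta>::complex. ln (norm \<zeta>)) going_to nhds j within annulus"
    assume "Q \<in> {Q. eventually Q ?F}"
    then have Q': "eventually (\<lambda>\<zeta>. Q (c * \<zeta>)) ?F"
    proof -
      from \<open>Q \<in> _\<close> obtain R where R: "eventually R (nhds j)"
        "\<And>x. R (ln (norm x)) \<Longrightarrow> x \<in> annulus \<Longrightarrow> Q x"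
        by (auto simp: going_to_within_def eventually_inf_principal eventually_filtercomap)
      have "Q (c * x)" if "R (ln (norm x))" "x \<in> annulus" for x
        using R(2)[of "c * x"] that by (simp add: Ann norm_mult c)
      with R(1) show ?thesis
        by (auto simp: going_to_within_def eventually_inf_principal eventually_filtercomap)
    qed
    have "(INF P\<in>{P. eventually P ?F}. SUP x\<in>Collect P. v (z, c * x))
        \<le> (SUP x\<in>Collect (\<lambda>\<zeta>. Q (c * \<zeta>)). v (z, c * x))"
      using Q' by (intro INF_lower) simp
    also have "\<dots> \<le> (SUP x\<in>Collect Q. v (z, x))"
      by (rule SUP_mono) auto
    finally show "(INF P\<in>{P. eventually P ?F}. SUP x\<in>Collect P. v (z, c * x))
        \<le> (SUP x\<in>Collect Q. v (z, x))" .
  qed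
  have "psh_on_prod ?G (\<lambda>(z, \<zeta>). v (z, c * \<zeta>))"
    using P by (simp add: eq psh_on_prod_def sc_def)
  with v show ?thesis
    unfolding W_class_def using order_trans[OF L] by auto
qed

lemma envelope_eq_geodesic:
  assumes "\<zeta> \<in> annulus"
  shows "envelope \<Omega> u0 u1 (z, \<zeta>) = geodesic \<Omega> u0 u1 (ln (norm \<zeta>)) z"
proof -
  have le: "envelope \<Omega> u0 u1 (z, x) \<le> envelope \<Omega> u0 u1 (z, y)"
    if "norm x = norm y" "y \<noteq> 0" for x y
    unfolding envelope_def
  proof (rule SUP_mono)
    fix v assume "v \<in> W_class \<Omega> u0 u1"
    then have "(\<lambda>(z, \<zeta>). v (z, (x / y) * \<zeta>)) \<in> W_class \<Omega> u0 u1"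
      by (rule W_class_rotate) (use that in \<open>simp add: norm_divide\<close>)
    then show "\<exists>w\<in>W_class \<Omega> u0 u1. v (z, x) \<le> w (z, y)"
      using that by (intro bexI[of _ "\<lambda>(z, \<zeta>). v (z, (x / y) * \<zeta>)"]) auto
  qed
  have "\<zeta> \<noteq> 0" using assms by (auto simp: annulus_def)
  then show ?thesis
    unfolding geodesic_def by (intro antisym le) auto
qed

end

theory Submission
  imports Defs "HOL-Complex_Analysis.Complex_Analysis"
begin

text \<open>For a fixed point \<open>z\<close> the two formulas say that the convex function \<open>t \<mapsto> u_t(z)\<close> and the concave
function \<open>C \<mapsto> P^C(z)\<close> are Legendre transforms of each other, where \<open>t = log |\<zeta>|\<close>.

If \<open>w\<close> is psh with \<open>w \<le> min(u_0, u_1 - C)\<close>, then \<open>w(z) + C log |\<zeta>|\<close> belongs to \<open>W(u_0, u_1)\<close>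
(\<open>affine_mem_W\<close>); hence \<open>P^C + Ct \<le> u_t\<close>. For the converse take \<open>v\<close> in the class \<open>W\<close>. It may be replaced by
its supremum over all rotations of \<open>\<zeta>\<close> (\<open>rotation_sup_mem_W\<close>), and then \<open>v_t(z)\<close> is convex in \<open>t\<close>
(\<open>psh_on_prod_radially_convex\<close>), hence is the supremum of its affine minorants. The largest minorant of slope \<open>C\<close>
is \<open>Ct + inf_s (v_s(z) - Cs)\<close>. By Kiselman's minimum principle (\<open>psh_on_partial_infimum\<close>) this infimum
is psh in \<open>z\<close>, and the boundary condition of \<open>W\<close> on the two circles puts it below \<open>u_0\<close> and
\<open>u_1 - C\<close>. So it is at most \<open>P^C\<close>, and \<open>v_t \<le> sup_C (P^C + Ct)\<close>. This is the first formula.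

The second formula is the inversion of a one-dimensional Legendre transform
(\<open>rooftop_profile_conjugate\<close>), once \<open>C \<mapsto> P^C(z)\<close> is known to be concave. Concavity again comes
from the minimum principle, applied to the maximum of \<open>w + Dt\<close> and \<open>w' + Et\<close>
(\<open>rooftop_concave\<close>).

The minimum principle rests on two ideas. An upper semicontinuous function \<open>u < \<infinity>\<close> is psh
as soon as, for every disc in a complex line and every entire \<open>H\<close>, the inequality \<open>u < Re H\<close> on the circle implies
\<open>u \<le> Re H\<close> at the centre (\<open>psh_wrtI\<close>); this is how psh functions are handled throughout. Let now
\<open>inf_t (v_t - Ct) < Re H\<close> on the circle of such a disc. Since \<open>v_t\<close> is convex in \<open>t\<close>, the
parameters \<open>t\<close> that realise the inequality form an interval at each point of the circle, and depend on the point
in a lower semicontinuous way, so they admit a continuous selection \<open>\<tau>\<close>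
(\<open>robust_convex_selection\<close>). Approximating \<open>\<tau>\<close> by the real part of an entire function
\<open>f\<close>, one compares \<open>v\<close> and \<open>Re (H + Cf)\<close> on the holomorphic disc \<open>k \<mapsto> (a + kb, exp f(k))\<close>. That psh
functions, defined through complex lines, obey the comparison on such a curved disc as well is proved by doubling
the variable \<open>\<zeta>\<close> (\<open>psh_on_prod_le_on_graph\<close>).

At the boundary of a B-regular domain, barriers produce psh functions below \<open>min(u_0, u_1 - C)\<close> that are close
to it near the boundary, with a distance that does not depend on \<open>C\<close>
(\<open>near_boundary_minorants\<close>). Gluing them with small translates of competitors of \<open>P^C\<close>, following Walsh,
shows that the functions \<open>P^C\<close>, extended by \<open>min(u_0, u_1 - C)\<close>, have a common modulus of continuity
(\<open>rooftop_equicontinuous\<close>). The supremum over \<open>C\<close> inherits this modulus, and the inversion of the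
Legendre transform applies on the boundary as it does inside (\<open>boundary_extension\<close>).\<close>

section \<open>Upper semicontinuous functions and circle means\<close>

text \<open>Otherwise the sets where \<open>f\<close> is below one of its values cover \<open>S\<close>; a point realising the largest value
among a finite subcover lies in none of its members.\<close>

lemma usc_on_attains_max:
  fixes f :: "'a::metric_space \<Rightarrow> ereal"
  assumes S: "compact S" "S \<noteq> {}" and f: "usc_on S f"
  obtains x where "x \<in> S" "\<And>y. y \<in> S \<Longrightarrow> f y \<le> f x"
proof -
  have "\<exists>x\<in>S. \<forall>y\<in>S. f y \<le> f x"
  proof (rule ccontr)
    assume "\<not> ?thesis"
    then have no: "\<forall>x\<in>S. \<exists>y\<in>S. f x < f y" by (meson not_le)
    define \<C> where "\<C> = (\<lambda>y. {x \<in> S. f x < f y}) ` S"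
    have "S \<subseteq> \<Union>\<C>" using no by (auto simp: \<C>_def)
    moreover have "\<forall>c\<in>\<C>. openin (top_of_set S) c"
      using f by (auto simp: \<C>_def usc_on_def)
    ultimately obtain D where D: "D \<subseteq> \<C>" "finite D" "S \<subseteq> \<Union>D"
      using S(1) unfolding compact_eq_openin_cover by meson
    then obtain Y where Y: "Y \<subseteq> S" "finite Y" "D = (\<lambda>y. {x \<in> S. f x < f y}) ` Y"
      unfolding \<C>_def by (meson finite_subset_image)
    have "Y \<noteq> {}" using D(3) S(2) Y(3) by auto
    then have "Max (f ` Y) \<in> f ` Y" using Y(2) by simp
    then obtain m where m: "m \<in> Y" "f m = Max (f ` Y)" by force
    then have "m \<in> S" using Y(1) by auto
    then obtain y where "y \<in> Y" "f m < f y" using D(3) Y(3) by auto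
    moreover have "f y \<le> f m" unfolding m(2) using Y(2) \<open>y \<in> Y\<close> by simp
    ultimately show False by simp
  qed
  then show ?thesis using that by blast
qed

lemma usc_on_subset: "usc_on S f \<Longrightarrow> T \<subseteq> S \<Longrightarrow> usc_on T f"
  unfolding usc_on_def
proof
  fix c assume f: "\<forall>c. openin (top_of_set S) {x \<in> S. f x < c}" and T: "T \<subseteq> S"
  then obtain U where U: "open U" "{x \<in> S. f x < c} = S \<inter> U" by (metis openin_open)
  then have "{x \<in> T. f x < c} = T \<inter> U" using T by blast
  then show "openin (top_of_set T) {x \<in> T. f x < c}"
    using U(1) by (metis openin_open)
qed

text \<open>The approximants are the sup-convolutions \<open>x \<mapsto> sup_y (max (f y) (-n) - n d(x, y))\<close>. They are
\<open>n\<close>-Lipschitz and decrease with \<open>n\<close>; the truncation at \<open>-n\<close> keeps them finite where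
\<open>f\<close> is \<open>-\<infinity>\<close>. The summand \<open>1/(n+1)\<close> makes the majorisation strict.\<close>

lemma usc_on_approx:
  fixes f :: "'a::metric_space \<Rightarrow> ereal"
  assumes S: "compact S" and f: "usc_on S f" and fin: "\<And>x. x \<in> S \<Longrightarrow> f x < \<infinity>"
  obtains h :: "nat \<Rightarrow> 'a \<Rightarrow> real" where
    "\<And>n. continuous_on S (h n)" "\<And>n x. x \<in> S \<Longrightarrow> f x < ereal (h n x)"
    "\<And>x. x \<in> S \<Longrightarrow> decseq (\<lambda>n. h n x)" "\<And>x. x \<in> S \<Longrightarrow> (\<lambda>n. ereal (h n x)) \<longlonglongrightarrow> f x"
proof (cases "S = {}")
  case True
  then show ?thesis using that[of "\<lambda>_ _. 0"] by auto
next
  case False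
  obtain x0 where x0: "x0 \<in> S" "\<And>y. y \<in> S \<Longrightarrow> f y \<le> f x0"
    using usc_on_attains_max[OF S False f] by metis
  define M where "M = \<bar>real_of_ereal (f x0)\<bar>"
  have fM: "f y \<le> ereal M" if "y \<in> S" for y
  proof -
    have "f y \<le> f x0" using x0 that by blast
    also have "\<dots> \<le> ereal M" using fin[OF x0(1)] by (cases "f x0") (auto simp: M_def)
    finally show ?thesis .
  qed
  have M0: "M \<ge> 0" unfolding M_def by (rule abs_ge_zero)
  define m where "m n y = real_of_ereal (max (f y) (- ereal (real n)))" for n :: nat and y
  have mer: "ereal (m n y) = max (f y) (- ereal (real n))" if "y \<in> S" for n y
    using fin[OF that] unfolding m_def by (cases "f y") (auto simp: max_def)
  have mM: "m n y \<le> M" if "y \<in> S" for n y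
  proof -
    have "ereal (m n y) \<le> ereal M" unfolding mer[OF that] using fM[OF that] M0 by (simp add: max_def)
    then show ?thesis by simp
  qed
  have mdec: "m (Suc n) y \<le> m n y" if "y \<in> S" for n y
  proof -
    have "ereal (m (Suc n) y) \<le> ereal (m n y)" unfolding mer[OF that] by (intro max.mono) auto
    then show ?thesis by simp
  qed
  define g where "g n x = (SUP y\<in>S. m n y - real n * dist x y)" for n x
  have bdd: "bdd_above ((\<lambda>y. m n y - real n * dist x y) ` S)" for n x
    by (rule bdd_aboveI2[of _ _ M]) (use mM in \<open>smt (verit) mult_nonneg_nonneg of_nat_0_le_iff zero_le_dist\<close>)
  have g_lower: "m n x \<le> g n x" if "x \<in> S" for n x
    unfolding g_def using cSUP_upper[OF that bdd, of n x] by simp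
  have g_lip: "g n x \<le> g n x' + real n * dist x x'" for n x x'
    unfolding g_def
  proof (rule cSUP_least[OF False])
    fix y assume y: "y \<in> S"
    have "m n y - real n * dist x' y \<le> (SUP y\<in>S. m n y - real n * dist x' y)"
      by (rule cSUP_upper[OF y bdd])
    moreover have "real n * dist x' y \<le> real n * (dist x x' + dist x y)"
      by (intro mult_left_mono dist_triangle3) auto
    ultimately show "m n y - real n * dist x y \<le> (SUP y\<in>S. m n y - real n * dist x' y) + real n * dist x x'"
      by (simp add: algebra_simps)
  qed
  have g_cont: "continuous_on S (g n)" for n
  proof -
    have "n-lipschitz_on S (g n)"
    proof (rule lipschitz_onI)
      fix x y assume "x \<in> S" "y \<in> S"
      show "dist (g n x) (g n y) \<le> real n * dist x y"
        using g_lip[of n x y] g_lip[of n y x] by (simp add: dist_real_def dist_commute)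
    qed simp
    then show ?thesis by (rule lipschitz_on_continuous_on)
  qed
  have g_dec: "g (Suc n) x \<le> g n x" for n x
    unfolding g_def
  proof (rule cSUP_mono[OF False bdd])
    fix y assume y: "y \<in> S"
    show "\<exists>y'\<in>S. m (Suc n) y - real (Suc n) * dist x y \<le> m n y' - real n * dist x y'"
    proof (rule bexI[OF _ y])
      have "real n * dist x y \<le> real (Suc n) * dist x y" by (intro mult_right_mono) auto
      then show "m (Suc n) y - real (Suc n) * dist x y \<le> m n y - real n * dist x y"
        using mdec[OF y, of n] by linarith
    qed
  qed
  define h where "h n x = g n x + inverse (real (Suc n))" for n x
  show ?thesis
  proof (rule that[of h])
    show "continuous_on S (h n)" for n unfolding h_def by (intro continuous_intros g_cont)
    show lower: "f x < ereal (h n x)" if "x \<in> S" for n x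
    proof -
      have "f x \<le> ereal (m n x)" using mer[OF that, of n] by simp
      also have "\<dots> < ereal (h n x)" using g_lower[OF that, of n] by (simp add: h_def)
                  (smt (verit) inverse_positive_iff_positive of_nat_0_le_iff)
      finally show ?thesis .
    qed
    show "decseq (\<lambda>n. h n x)" if "x \<in> S" for x
      unfolding decseq_Suc_iff h_def by (intro allI add_mono g_dec) (simp add: field_simps)
    show "(\<lambda>n. ereal (h n x)) \<longlonglongrightarrow> f x" if x: "x \<in> S" for x
    proof (rule order_tendstoI)
      fix a assume "a < f x"
      then show "\<forall>\<^sub>F n in sequentially. a < ereal (h n x)"
        using lower[OF x] by (meson always_eventually less_trans)
    next
      fix a assume "f x < a"
      then obtain B where B: "f x < ereal B" "ereal B < a" using ereal_dense2 by blast
      obtain A where A: "f x < ereal A" "ereal A < ereal B" using ereal_dense2[OF B(1)] by blast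
      have "openin (top_of_set S) {y \<in> S. f y < ereal A}" using f by (simp add: usc_on_def)
      then obtain d where d: "d > 0" "\<And>y. y \<in> S \<Longrightarrow> dist y x < d \<Longrightarrow> f y < ereal A"
        using x A(1) unfolding openin_euclidean_subtopology_iff by blast
      \<comment> \<open>from index \<open>N\<close> on, the truncation is below \<open>A\<close>, points outside the ball lose at least \<open>M + |A|\<close>, and the strictness summand is below \<open>B - A\<close>\<close>
      obtain N :: nat where N: "real N \<ge> \<bar>A\<bar>" "real N * d \<ge> M + \<bar>A\<bar>" "inverse (real (Suc N)) < B - A"
      proof -
        obtain n1 :: nat where "real n1 \<ge> \<bar>A\<bar>" using real_arch_simple by blast
        moreover obtain n2 :: nat where "real n2 * d \<ge> M + \<bar>A\<bar>"
          using reals_Archimedean3[OF d(1)] by (meson less_imp_le)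
        moreover obtain n3 :: nat where "inverse (real (Suc n3)) < B - A"
          using reals_Archimedean[of "B - A"] A by auto
        ultimately show ?thesis
        proof (intro that[of "max n1 (max n2 n3)"])
          assume *: "\<bar>A\<bar> \<le> real n1" "M + \<bar>A\<bar> \<le> real n2 * d" "inverse (real (Suc n3)) < B - A"
          show "\<bar>A\<bar> \<le> real (max n1 (max n2 n3))" using * by linarith
          have "real n2 * d \<le> real (max n1 (max n2 n3)) * d" using d by (intro mult_right_mono) auto
          then show "M + \<bar>A\<bar> \<le> real (max n1 (max n2 n3)) * d" using * by linarith
          have "inverse (real (Suc (max n1 (max n2 n3)))) \<le> inverse (real (Suc n3))"
            by (intro le_imp_inverse_le) auto
          then show "inverse (real (Suc (max n1 (max n2 n3)))) < B - A" using * by linarith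
        qed
      qed
      have "ereal (h n x) < a" if n: "n \<ge> N" for n
      proof -
        have nA: "real n \<ge> \<bar>A\<bar>" using N(1) n by linarith
        have "real N * d \<le> real n * d" using n d by (intro mult_right_mono) auto
        then have nM: "real n * d \<ge> M + \<bar>A\<bar>" using N(2) by linarith
        have "inverse (real (Suc n)) \<le> inverse (real (Suc N))" using n by (intro le_imp_inverse_le) auto
        then have nB: "inverse (real (Suc n)) < B - A" using N(3) by linarith
        have "g n x \<le> A" unfolding g_def
        proof (rule cSUP_least[OF False])
          fix y assume y: "y \<in> S"
          show "m n y - real n * dist x y \<le> A"
          proof (cases "dist y x < d")
            case True
            have "ereal (m n y) \<le> ereal A"
              unfolding mer[OF y] using d(2)[OF y True] nA by (auto simp: max_def)
            then have "m n y \<le> A" by simp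
            moreover have "0 \<le> real n * dist x y" by (intro mult_nonneg_nonneg) auto
            ultimately show ?thesis by linarith
          next
            case False
            have "real n * d \<le> real n * dist x y" using False by (intro mult_left_mono) (auto simp: dist_commute)
            then show ?thesis using nM mM[OF y, of n] by linarith
          qed
        qed
        then have "h n x < B" using nB by (simp add: h_def)
        then show ?thesis using B(2) by (metis ereal_less_eq(3) less_le_trans less_imp_le not_less)
      qed
      then show "\<forall>\<^sub>F n in sequentially. ereal (h n x) < a"
        unfolding eventually_sequentially by blast
    qed
  qed
qed

lemma circle_mean_mono:
  assumes "r \<ge> 0" "\<And>k. k \<in> sphere a r \<Longrightarrow> f k \<le> g k"
  shows "circle_mean f a r \<le> circle_mean g a r"
proof -
  have "f (a + of_real r * cis \<theta>) \<le> g (a + of_real r * cis \<theta>)" for \<theta>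
    using assms by (intro assms) (simp add: dist_norm norm_mult)
  then show ?thesis
    unfolding circle_mean_def
    by (intro ereal_divide_right_mono ereal_minus_mono less_eq_ennreal.rep_eq[THEN iffD1] nn_integral_mono
        mult_right_mono e2ennreal_mono) auto
qed

text \<open>The mean is defined by two integrals of nonnegative functions; for a continuous function it is the usual one.\<close>

lemma circle_mean_continuous:
  assumes r: "r \<ge> 0" and g: "continuous_on (sphere a r) g"
  shows "circle_mean (\<lambda>k. ereal (g k)) a r
    = ereal (integral {0..2*pi} (\<lambda>\<theta>. g (a + of_real r * cis \<theta>)) / (2*pi))"
proof -
  define G where "G \<theta> = g (a + of_real r * cis \<theta>)" for \<theta>
  have cG: "continuous_on {0..2*pi} G"
    unfolding G_def
    by (rule continuous_on_compose2[OF g]) (use r in \<open>auto intro!: continuous_intros simp: dist_norm norm_mult\<close>)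
  define F where "F = (\<lambda>\<theta>. indicat_real {0..2*pi} \<theta> *\<^sub>R G \<theta>)"
  have int: "integrable lborel F"
    using borel_integrable_atLeastAtMost'[OF cG] by (simp add: set_integrable_def F_def)
  have eq: "(\<integral>\<^sup>+ \<theta>\<in>{0..2*pi}. e2ennreal (ereal (G \<theta>)) \<partial>lborel) = (\<integral>\<^sup>+ \<theta>. ennreal (F \<theta>) \<partial>lborel)"
    "(\<integral>\<^sup>+ \<theta>\<in>{0..2*pi}. e2ennreal (- ereal (G \<theta>)) \<partial>lborel) = (\<integral>\<^sup>+ \<theta>. ennreal (- F \<theta>) \<partial>lborel)"
    by (auto intro!: nn_integral_cong simp: F_def indicator_def)
  have fin: "(\<integral>\<^sup>+ \<theta>. ennreal (F \<theta>) \<partial>lborel) < \<infinity>" "(\<integral>\<^sup>+ \<theta>. ennreal (- F \<theta>) \<partial>lborel) < \<infinity>"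
    using int unfolding real_integrable_def by (auto simp: top.not_eq_extremum)
  have "integral {0..2*pi} G = integral\<^sup>L lborel F"
    using set_borel_integral_eq_integral(2)[OF borel_integrable_atLeastAtMost'[OF cG]]
    by (simp add: set_lebesgue_integral_def F_def)
  also have "\<dots> = enn2real (\<integral>\<^sup>+ \<theta>. ennreal (F \<theta>) \<partial>lborel) - enn2real (\<integral>\<^sup>+ \<theta>. ennreal (- F \<theta>) \<partial>lborel)"
    by (rule real_lebesgue_integral_def[OF int])
  finally have *: "ereal (integral {0..2*pi} G) = enn2ereal (\<integral>\<^sup>+ \<theta>. ennreal (F \<theta>) \<partial>lborel)
      - enn2ereal (\<integral>\<^sup>+ \<theta>. ennreal (- F \<theta>) \<partial>lborel)"
    using fin by (cases "\<integral>\<^sup>+ \<theta>. ennreal (F \<theta>) \<partial>lborel"; cases "\<integral>\<^sup>+ \<theta>. ennreal (- F \<theta>) \<partial>lborel")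
       (auto simp: enn2ereal_ennreal)
  show ?thesis
    unfolding circle_mean_def G_def[symmetric] eq *[symmetric] by simp
qed

text \<open>Continuous majorants determine the mean of an upper semicontinuous function. Along a decreasing sequence of them,
monotone convergence applies to the positive parts, whose integrals are finite and decrease, and to the negative parts,
which increase. As the first limit is finite, the difference of the limits is the limit of the differences.\<close>

lemma le_circle_mean:
  assumes r: "r > 0" and f: "usc_on (sphere a r) f" and fin: "\<And>k. k \<in> sphere a r \<Longrightarrow> f k < \<infinity>"
    and le: "\<And>h. continuous_on (sphere a r) h \<Longrightarrow> (\<And>k. k \<in> sphere a r \<Longrightarrow> f k < ereal (h k)) \<Longrightarrow>
      c \<le> circle_mean (\<lambda>k. ereal (h k)) a r"
  shows "c \<le> circle_mean f a r"
proof -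
  obtain h where h: "\<And>n. continuous_on (sphere a r) (h n)"
      "\<And>n x. x \<in> sphere a r \<Longrightarrow> f x < ereal (h n x)"
      "\<And>x. x \<in> sphere a r \<Longrightarrow> decseq (\<lambda>n. h n x)"
      "\<And>x. x \<in> sphere a r \<Longrightarrow> (\<lambda>n. ereal (h n x)) \<longlonglongrightarrow> f x"
    using usc_on_approx[OF compact_sphere f fin] by metis
  define p where "p \<theta> = a + of_real r * cis \<theta>" for \<theta>
  have p: "p \<theta> \<in> sphere a r" for \<theta> using r by (simp add: p_def dist_norm norm_mult)
  have ch: "continuous_on {0..2*pi} (\<lambda>\<theta>. h n (p \<theta>))" for n
    by (rule continuous_on_compose2[OF h(1)]) (use p in \<open>auto intro!: continuous_intros simp: p_def\<close>)
  let ?I = "indicator {0..2*pi} :: real \<Rightarrow> ennreal"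
  have meas: "(\<lambda>\<theta>. ennreal (h n (p \<theta>)) * ?I \<theta>) \<in> borel_measurable lborel"
     "(\<lambda>\<theta>. ennreal (- h n (p \<theta>)) * ?I \<theta>) \<in> borel_measurable lborel" for n
  proof -
    have "(\<lambda>\<theta>. indicator {0..2*pi} \<theta> *\<^sub>R h n (p \<theta>)) \<in> borel_measurable borel"
      by (rule borel_measurable_continuous_on_indicator[OF _ ch]) auto
    then have m: "(\<lambda>\<theta>. ennreal (indicator {0..2*pi} \<theta> *\<^sub>R h n (p \<theta>))) \<in> borel_measurable lborel"
      "(\<lambda>\<theta>. ennreal (- (indicator {0..2*pi} \<theta> *\<^sub>R h n (p \<theta>)))) \<in> borel_measurable lborel"
      by simp_all
    have "(\<lambda>\<theta>. ennreal (h n (p \<theta>)) * ?I \<theta>) = (\<lambda>\<theta>. ennreal (indicator {0..2*pi} \<theta> *\<^sub>R h n (p \<theta>)))"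
      "(\<lambda>\<theta>. ennreal (- h n (p \<theta>)) * ?I \<theta>) = (\<lambda>\<theta>. ennreal (- (indicator {0..2*pi} \<theta> *\<^sub>R h n (p \<theta>))))"
      by (auto simp: fun_eq_iff indicator_def)
    then show "(\<lambda>\<theta>. ennreal (h n (p \<theta>)) * ?I \<theta>) \<in> borel_measurable lborel"
     "(\<lambda>\<theta>. ennreal (- h n (p \<theta>)) * ?I \<theta>) \<in> borel_measurable lborel"
      using m by simp_all
  qed
  define A where "A n = (\<integral>\<^sup>+ \<theta>. ennreal (h n (p \<theta>)) * ?I \<theta> \<partial>lborel)" for n
  define B where "B n = (\<integral>\<^sup>+ \<theta>. ennreal (- h n (p \<theta>)) * ?I \<theta> \<partial>lborel)" for n
  define A' where "A' = (\<integral>\<^sup>+ \<theta>. e2ennreal (f (p \<theta>)) * ?I \<theta> \<partial>lborel)"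
  define B' where "B' = (\<integral>\<^sup>+ \<theta>. e2ennreal (- f (p \<theta>)) * ?I \<theta> \<partial>lborel)"
  have dec: "decseq (\<lambda>n. ennreal (h n (p \<theta>)) * ?I \<theta>)" for \<theta>
    using h(3)[OF p] by (auto simp: decseq_def intro!: mult_right_mono ennreal_leI)
  have inc: "incseq (\<lambda>n. ennreal (- h n (p \<theta>)) * ?I \<theta>)" for \<theta>
    using h(3)[OF p] by (auto simp: decseq_def incseq_def intro!: mult_right_mono ennreal_leI)
  have "((\<lambda>n. e2ennreal (ereal (h n (p \<theta>)))) \<longlonglongrightarrow> e2ennreal (f (p \<theta>)))" for \<theta>
    by (intro tendsto_e2ennrealI h(4) p)
  then have "(\<lambda>n. ennreal (h n (p \<theta>)) * ?I \<theta>) \<longlonglongrightarrow> e2ennreal (f (p \<theta>)) * ?I \<theta>" for \<theta>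
    by (auto simp: indicator_def)
  then have infA: "(INF n. ennreal (h n (p \<theta>)) * ?I \<theta>) = e2ennreal (f (p \<theta>)) * ?I \<theta>" for \<theta>
    using LIMSEQ_INF[OF dec] LIMSEQ_unique by blast
  have "((\<lambda>n. - ereal (h n (p \<theta>))) \<longlonglongrightarrow> - f (p \<theta>))" for \<theta>
    using h(4)[OF p] by (rule tendsto_uminus_ereal)
  then have "((\<lambda>n. e2ennreal (- ereal (h n (p \<theta>)))) \<longlonglongrightarrow> e2ennreal (- f (p \<theta>)))" for \<theta>
    by (intro tendsto_e2ennrealI)
  then have "(\<lambda>n. ennreal (- h n (p \<theta>)) * ?I \<theta>) \<longlonglongrightarrow> e2ennreal (- f (p \<theta>)) * ?I \<theta>" for \<theta>
    by (auto simp: indicator_def)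
  then have supB: "(SUP n. ennreal (- h n (p \<theta>)) * ?I \<theta>) = e2ennreal (- f (p \<theta>)) * ?I \<theta>" for \<theta>
    using LIMSEQ_SUP[OF inc] LIMSEQ_unique by blast
  have A0: "A 0 < \<infinity>"
  proof -
    have "set_integrable lborel {0..2*pi} (\<lambda>\<theta>. h 0 (p \<theta>))"
      by (rule borel_integrable_atLeastAtMost'[OF ch])
    then have "(\<integral>\<^sup>+ \<theta>. ennreal (indicator {0..2*pi} \<theta> *\<^sub>R h 0 (p \<theta>)) \<partial>lborel) < \<infinity>"
      unfolding set_integrable_def real_integrable_def by (auto simp: top.not_eq_extremum)
    moreover have "A 0 = (\<integral>\<^sup>+ \<theta>. ennreal (indicator {0..2*pi} \<theta> *\<^sub>R h 0 (p \<theta>)) \<partial>lborel)"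
      unfolding A_def by (intro nn_integral_cong) (auto simp: indicator_def)
    ultimately show ?thesis by simp
  qed
  have "A' = (INF n. A n)"
    unfolding A_def A'_def infA[symmetric]
    by (rule nn_integral_monotone_convergence_INF_decseq[where i=0])
      (use dec meas(1) A0 in \<open>simp_all add: decseq_def le_fun_def A_def monotone_def\<close>)
  moreover have "decseq A" unfolding A_def decseq_def
    using dec by (auto intro!: nn_integral_mono simp: decseq_def)
  ultimately have limA: "A \<longlonglongrightarrow> A'" using LIMSEQ_INF[of A] by simp
  have "B' = (SUP n. B n)"
    unfolding B_def B'_def supB[symmetric]
    by (rule nn_integral_monotone_convergence_SUP)
      (use inc meas(2) in \<open>simp_all add: incseq_def le_fun_def monotone_def\<close>)
  moreover have "incseq B" unfolding B_def incseq_def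
    using inc by (auto intro!: nn_integral_mono simp: incseq_def)
  ultimately have limB: "B \<longlonglongrightarrow> B'" using LIMSEQ_SUP[of B] by simp
  have A'fin: "A' < \<infinity>" using A0 \<open>A' = (INF n. A n)\<close> by (metis INF_lower UNIV_I le_less_trans)
  have "(\<lambda>n. enn2ereal (A n)) \<longlonglongrightarrow> enn2ereal A'" "(\<lambda>n. enn2ereal (B n)) \<longlonglongrightarrow> enn2ereal B'"
    using limA limB by (auto intro: tendsto_enn2erealI)
  then have "(\<lambda>n. enn2ereal (A n) - enn2ereal (B n)) \<longlonglongrightarrow> enn2ereal A' - enn2ereal B'"
    unfolding minus_ereal_def
    by (intro tendsto_add_ereal_general tendsto_uminus_ereal) (use A'fin in \<open>auto simp: enn2ereal_eq_top_iff\<close>)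
  then have "(\<lambda>n. (enn2ereal (A n) - enn2ereal (B n)) / ereal (2*pi)) \<longlonglongrightarrow> (enn2ereal A' - enn2ereal B') / ereal (2*pi)"
    by (intro tendsto_divide_ereal) auto
  moreover have "circle_mean (\<lambda>k. ereal (h n k)) a r = (enn2ereal (A n) - enn2ereal (B n)) / ereal (2*pi)" for n
    by (simp add: circle_mean_def A_def B_def p_def)
  moreover have "circle_mean f a r = (enn2ereal A' - enn2ereal B') / ereal (2*pi)"
    by (simp add: circle_mean_def A'_def B'_def p_def)
  ultimately have "(\<lambda>n. circle_mean (\<lambda>k. ereal (h n k)) a r) \<longlonglongrightarrow> circle_mean f a r" by simp
  moreover have "c \<le> circle_mean (\<lambda>k. ereal (h n k)) a r" for n
    by (intro le h)
  ultimately show ?thesis by (meson LIMSEQ_le_const)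
qed

lemma circle_mean_Re_holomorphic:
  assumes r: "r > 0" and H: "continuous_on (cball a r) H" "H holomorphic_on ball a r"
  shows "circle_mean (\<lambda>k. ereal (Re (H k))) a r = ereal (Re (H a))"
proof -
  have "((\<lambda>u. H u / (u - a)) has_contour_integral (2 * of_real pi * \<i> * H a)) (circlepath a r)"
    by (rule Cauchy_integral_circlepath[OF H]) (use r in auto)
  then have "((\<lambda>t. H (a + of_real r * cis t) / (a + of_real r * cis t - a) * of_real r * \<i> * cis t)
      has_integral (2 * of_real pi * \<i> * H a)) {0..2*pi}"
    unfolding circlepath_def by (subst (asm) has_contour_integral_part_circlepath_iff) auto
  then have "((\<lambda>t. - \<i> * (H (a + of_real r * cis t) / (a + of_real r * cis t - a) * of_real r * \<i> * cis t))
      has_integral (- \<i> * (2 * of_real pi * \<i> * H a))) {0..2*pi}"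
    by (rule has_integral_mult_right)
  moreover have e1: "- \<i> * (H (a + of_real r * cis t) / (a + of_real r * cis t - a) * of_real r * \<i> * cis t)
      = H (a + of_real r * cis t)" for t
    using r by (simp add: field_simps)
  moreover have e2: "- \<i> * (2 * of_real pi * \<i> * H a) = 2 * of_real pi * H a"
    by (simp add: algebra_simps)
  ultimately have "((\<lambda>t. H (a + of_real r * cis t)) has_integral (2 * of_real pi * H a)) {0..2*pi}"
    unfolding e1 e2 by blast
  then have "((\<lambda>t. Re (H (a + of_real r * cis t))) has_integral Re (2 * of_real pi * H a)) {0..2*pi}"
    by (rule has_integral_Re)
  then have "integral {0..2*pi} (\<lambda>t. Re (H (a + of_real r * cis t))) = 2 * pi * Re (H a)"
    by (simp add: integral_unique)
  moreover have "continuous_on (sphere a r) (\<lambda>k. Re (H k))"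
    by (intro continuous_intros continuous_on_subset[OF H(1)]) auto
  ultimately show ?thesis
    using r by (subst circle_mean_continuous) auto
qed

text \<open>On the circle the normalised variable \<open>u\<close> satisfies \<open>cnj u = 1/u\<close>. Hence the real functions
that are Laurent polynomials in \<open>u\<close> form an algebra, which contains \<open>Re u\<close> and \<open>Im u\<close>, and the
Stone-Weierstrass theorem applies. Such a function is the real part of a polynomial in \<open>u\<close>, because
\<open>Re (c u^(-m)) = Re (cnj c u^m)\<close>.\<close>

lemma Re_entire_approx_on_sphere:
  assumes r: "r > 0" and g: "continuous_on (sphere a r) g" and e: "e > 0"
  obtains f where "f holomorphic_on UNIV" "\<And>k. k \<in> sphere a r \<Longrightarrow> \<bar>Re (f k) - g k\<bar> < e"
proof -
  define u where "u k = (k - a) / of_real r" for k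
  have nu: "norm (u k) = 1" if "k \<in> sphere a r" for k
    using that r by (simp add: u_def norm_divide dist_norm norm_minus_commute)
  have uc: "cnj (u k) * u k = 1" if "k \<in> sphere a r" for k
    using nu[OF that] by (metis complex_norm_square mult.commute of_real_1 power_one)
  have cu: "continuous_on S u" for S unfolding u_def using r by (intro continuous_intros) auto
  define R where "R = {g. continuous_on (sphere a r) g \<and>
     (\<exists>n p. \<forall>k\<in>sphere a r. complex_of_real (g k) * u k ^ n = poly p (u k))}"
  interpret function_ring_on R "sphere a r"
  proof
    show "compact (sphere a r)" by simp
    show "continuous_on (sphere a r) f" if "f \<in> R" for f using that by (simp add: R_def)
    show "(\<lambda>x. f x + g x) \<in> R" if fg: "f \<in> R" "g \<in> R" for f g
    proof -
      obtain n p m q where *: "\<forall>k\<in>sphere a r. complex_of_real (f k) * u k ^ n = poly p (u k)"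
         "\<forall>k\<in>sphere a r. complex_of_real (g k) * u k ^ m = poly q (u k)"
        using fg unfolding R_def by blast
      have "complex_of_real (f k + g k) * u k ^ (n + m) = poly (p * monom 1 m + q * monom 1 n) (u k)"
        if "k \<in> sphere a r" for k
      proof -
        have "complex_of_real (f k + g k) * u k ^ (n + m)
          = (complex_of_real (f k) * u k ^ n) * u k ^ m + (complex_of_real (g k) * u k ^ m) * u k ^ n"
          by (simp add: algebra_simps power_add)
        also have "\<dots> = poly p (u k) * u k ^ m + poly q (u k) * u k ^ n" using * that by simp
        finally show ?thesis by (simp add: poly_monom)
      qed
      moreover have "continuous_on (sphere a r) (\<lambda>x. f x + g x)"
        using that by (auto simp: R_def intro: continuous_intros)
      ultimately show ?thesis unfolding R_def by blast
    qed
    show "(\<lambda>x. f x * g x) \<in> R" if fg: "f \<in> R" "g \<in> R" for f g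
    proof -
      obtain n p m q where *: "\<forall>k\<in>sphere a r. complex_of_real (f k) * u k ^ n = poly p (u k)"
         "\<forall>k\<in>sphere a r. complex_of_real (g k) * u k ^ m = poly q (u k)"
        using fg unfolding R_def by blast
      have "complex_of_real (f k * g k) * u k ^ (n + m) = poly (p * q) (u k)"
        if "k \<in> sphere a r" for k
      proof -
        have "complex_of_real (f k * g k) * u k ^ (n + m)
          = (complex_of_real (f k) * u k ^ n) * (complex_of_real (g k) * u k ^ m)"
          by (simp add: algebra_simps power_add)
        also have "\<dots> = poly p (u k) * poly q (u k)" using * that by simp
        finally show ?thesis by simp
      qed
      moreover have "continuous_on (sphere a r) (\<lambda>x. f x * g x)"
        using that by (auto simp: R_def intro: continuous_intros)
      ultimately show ?thesis unfolding R_def by blast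
    qed
    show "(\<lambda>_. c) \<in> R" for c
      unfolding R_def by (auto intro!: exI[of _ 0] exI[of _ "[:complex_of_real c:]"])
    show "\<exists>f\<in>R. f x \<noteq> f y" if "x \<in> sphere a r" "y \<in> sphere a r" "x \<noteq> y" for x y
    proof -
      have ReR: "(\<lambda>k. Re (u k)) \<in> R"
      proof -
        have "complex_of_real (Re (u k)) * u k ^ 1 = poly [:1/2, 0, 1/2:] (u k)" if "k \<in> sphere a r" for k
        proof -
          have "complex_of_real (Re (u k)) * u k = (u k + cnj (u k)) / 2 * u k"
            by (simp add: complex_add_cnj)
          also have "\<dots> = u k * u k / 2 + (cnj (u k) * u k) / 2" by (simp add: field_simps)
          finally show ?thesis using uc[OF that] by (simp add: field_simps)
        qed
        then show ?thesis unfolding R_def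
          by (intro CollectI conjI continuous_intros cu) blast
      qed
      have ImR: "(\<lambda>k. Im (u k)) \<in> R"
      proof -
        have "complex_of_real (Im (u k)) * u k ^ 1 = poly [:\<i>/2, 0, -\<i>/2:] (u k)" if "k \<in> sphere a r" for k
        proof -
          have Im: "complex_of_real (Im (u k)) = - \<i> * (u k - cnj (u k)) / 2"
            by (simp add: complex_eq_iff)
          have "complex_of_real (Im (u k)) * u k = - \<i> * (u k * u k - cnj (u k) * u k) / 2"
            unfolding Im by (simp add: algebra_simps)
          then show ?thesis using uc[OF that] by (simp add: field_simps)
        qed
        then show ?thesis unfolding R_def
          by (intro CollectI conjI continuous_intros cu) blast
      qed
      have "u x \<noteq> u y" using that r by (simp add: u_def)
      then consider "Re (u x) \<noteq> Re (u y)" | "Im (u x) \<noteq> Im (u y)" using complex_eqI by blast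
      then show ?thesis by cases (rule bexI[OF _ ReR] bexI[OF _ ImR], assumption)+
    qed
  qed
  obtain g' where g': "g' \<in> R" "\<forall>k\<in>sphere a r. \<bar>g k - g' k\<bar> < e"
    using Stone_Weierstrass_basic[OF g e] by blast
  then obtain n p where np: "\<forall>k\<in>sphere a r. complex_of_real (g' k) * u k ^ n = poly p (u k)"
    unfolding R_def by blast
  define f where "f k = (\<Sum>i\<le>degree p. if n \<le> i then coeff p i * u k ^ (i - n) else cnj (coeff p i) * u k ^ (n - i))" for k
  show ?thesis
  proof (rule that[of f])
    have "(\<lambda>k. if n \<le> i then coeff p i * u k ^ (i - n) else cnj (coeff p i) * u k ^ (n - i)) holomorphic_on UNIV" for i
      unfolding u_def using r by (cases "n \<le> i") (auto intro!: holomorphic_intros)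
    then show "f holomorphic_on UNIV"
      unfolding f_def by (intro holomorphic_on_sum)
    fix k assume k: "k \<in> sphere a r"
    define w where "w = u k"
    have uw: "cnj w ^ m * w ^ m = 1" for m
      using uc[OF k] by (simp add: w_def flip: power_mult_distrib)
    have "complex_of_real (g' k) = complex_of_real (g' k) * (cnj w ^ n * w ^ n)" by (simp only: uw mult_1_right)
    also have "\<dots> = cnj w ^ n * (complex_of_real (g' k) * w ^ n)" by (simp only: mult_ac)
    also have "\<dots> = cnj w ^ n * poly p w" using np k by (simp only: w_def)
    also have "\<dots> = (\<Sum>i\<le>degree p. coeff p i * (w ^ i * cnj w ^ n))"
      unfolding poly_altdef sum_distrib_left by (simp only: mult_ac)
    finally have "g' k = Re (\<Sum>i\<le>degree p. coeff p i * (w ^ i * cnj w ^ n))"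
      by (metis Re_complex_of_real)
    also have "\<dots> = (\<Sum>i\<le>degree p. Re (coeff p i * (w ^ i * cnj w ^ n)))" by (rule Re_sum)
    also have "\<dots> = Re (f k)"
      unfolding f_def Re_sum w_def[symmetric]
    proof (rule sum.cong[OF refl])
      fix i
      show "Re (coeff p i * (w ^ i * cnj w ^ n)) =
        Re (if n \<le> i then coeff p i * w ^ (i - n) else cnj (coeff p i) * w ^ (n - i))"
      proof (cases "n \<le> i")
        case True
        have "w ^ i = w ^ (i - n) * w ^ n" using True by (simp flip: power_add)
        then have "w ^ i * cnj w ^ n = w ^ (i - n) * (cnj w ^ n * w ^ n)" by (simp only: mult_ac)
        then show ?thesis using True by (simp add: uw)
      next
        case False
        have "cnj w ^ n = cnj w ^ (n - i) * cnj w ^ i" using False by (simp flip: power_add)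
        then have "w ^ i * cnj w ^ n = cnj w ^ (n - i) * (cnj w ^ i * w ^ i)" by (simp only: mult_ac)
        then have "w ^ i * cnj w ^ n = cnj w ^ (n - i)" by (simp only: uw mult_1_right)
        then have "coeff p i * (w ^ i * cnj w ^ n) = cnj (cnj (coeff p i) * w ^ (n - i))"
          by (simp only: complex_cnj_mult complex_cnj_cnj complex_cnj_power)
        then have "Re (coeff p i * (w ^ i * cnj w ^ n)) = Re (cnj (coeff p i) * w ^ (n - i))"
          by (simp only: cnj.simps)
        then show ?thesis using False by simp
      qed
    qed
    finally show "\<bar>Re (f k) - g k\<bar> < e" using g'(2) k by (metis abs_minus_commute)
  qed
qed

section \<open>Plurisubharmonic functions tested against real parts of holomorphic functions\<close>

lemma usc_on_iff:
  fixes f :: "'a::metric_space \<Rightarrow> ereal"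
  shows "usc_on S f \<longleftrightarrow> (\<forall>x\<in>S. \<forall>c. f x < c \<longrightarrow> (\<exists>d>0. \<forall>y\<in>S. dist y x < d \<longrightarrow> f y < c))"
  unfolding usc_on_def openin_euclidean_subtopology_iff by auto

lemma usc_on_compose:
  assumes f: "usc_on T f" and g: "continuous_on S g" "g \<in> S \<rightarrow> T"
  shows "usc_on S (\<lambda>x. f (g x))"
  unfolding usc_on_def
proof
  fix c
  have "openin (top_of_set S) (S \<inter> g -` {y \<in> T. f y < c})"
    using f by (intro continuous_openin_preimage[OF g]) (simp add: usc_on_def)
  moreover have "S \<inter> g -` {y \<in> T. f y < c} = {x \<in> S. f (g x) < c}" using g(2) by auto
  ultimately show "openin (top_of_set S) {x \<in> S. f (g x) < c}" by simp
qed

lemma usc_on_cong: "(\<And>x. x \<in> S \<Longrightarrow> f x = g x) \<Longrightarrow> usc_on S f \<longleftrightarrow> usc_on S g"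
  unfolding usc_on_def by (metis (mono_tags, lifting) Collect_cong)

lemma usc_on_max:
  assumes "usc_on S f" "usc_on S g"
  shows "usc_on S (\<lambda>x. max (f x) (g x))"
  unfolding usc_on_def
proof
  fix c
  have "{x \<in> S. max (f x) (g x) < c} = {x \<in> S. f x < c} \<inter> {x \<in> S. g x < c}" by auto
  then show "openin (top_of_set S) {x \<in> S. max (f x) (g x) < c}"
    using assms by (simp add: usc_on_def openin_Int)
qed

lemma usc_on_add_continuous:
  fixes f :: "'a::metric_space \<Rightarrow> ereal"
  assumes f: "usc_on S f" and g: "continuous_on S g"
  shows "usc_on S (\<lambda>x. f x + ereal (g x))"
  unfolding usc_on_iff
proof (intro ballI allI impI)
  fix x c assume x: "x \<in> S" and c: "f x + ereal (g x) < c"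
  then have "f x < c - ereal (g x)" by (simp add: ereal_less_minus)
  then obtain B where B: "f x < ereal B" "ereal B < c - ereal (g x)" using ereal_dense2 by blast
  obtain A where A: "f x < ereal A" "ereal A < ereal B" using ereal_dense2[OF B(1)] by blast
  obtain d where d: "d > 0" "\<And>y. y \<in> S \<Longrightarrow> dist y x < d \<Longrightarrow> f y < ereal A"
    using f x A(1) unfolding usc_on_iff by blast
  obtain d' where d': "d' > 0" "\<And>y. y \<in> S \<Longrightarrow> dist y x < d' \<Longrightarrow> dist (g y) (g x) < B - A"
    using g x A(2) unfolding continuous_on_iff by (metis diff_gt_0_iff_gt ereal_less(2) less_ereal.simps(1))
  show "\<exists>d>0. \<forall>y\<in>S. dist y x < d \<longrightarrow> f y + ereal (g y) < c"
  proof (intro exI conjI ballI impI)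
    show "min d d' > 0" using d d' by simp
    fix y assume y: "y \<in> S" "dist y x < min d d'"
    have "f y < ereal A" using d y by simp
    moreover have "g y < g x + (B - A)" using d'(2)[OF y(1)] y(2) by (simp add: dist_real_def)
    ultimately have "f y + ereal (g y) < ereal (B + g x)" by (cases "f y") auto
    also have "\<dots> < c" using B(2) by (cases c) auto
    finally show "f y + ereal (g y) < c" .
  qed
qed

lemma usc_on_scale:
  assumes f: "usc_on S f" and N: "N > 0"
  shows "usc_on S (\<lambda>x. ereal N * f x)"
  using f N unfolding usc_on_def
  by (simp flip: ereal_less_divide_pos)

lemma subharmonic_on_le:
  assumes f: "subharmonic_on D f" and r: "r > 0" "cball a r \<subseteq> D"
    and H: "continuous_on (cball a r) H" "H holomorphic_on ball a r"
    and le: "\<And>k. k \<in> sphere a r \<Longrightarrow> f k \<le> ereal (Re (H k))"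
  shows "f a \<le> ereal (Re (H a))"
proof -
  have "f a \<le> circle_mean f a r" using f r by (simp add: subharmonic_on_def subset_eq)
  also have "\<dots> \<le> circle_mean (\<lambda>k. ereal (Re (H k))) a r"
    using r le by (intro circle_mean_mono) auto
  also have "\<dots> = ereal (Re (H a))" by (rule circle_mean_Re_holomorphic[OF r(1) H])
  finally show ?thesis .
qed

text \<open>A continuous majorant of \<open>f\<close> on a circle is, up to \<open>\<epsilon>\<close>, the real part of an entire
function, whose mean is its value at the centre. Therefore the sub-mean value inequality needs to be checked against
such real parts only. With the converse \<open>subharmonic_on_le\<close> this characterises subharmonic functions by
comparisons in which integrals no longer occur.\<close>

lemma subharmonic_onI:
  assumes usc: "usc_on D f" and fin: "\<And>a. a \<in> D \<Longrightarrow> f a < \<infinity>"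
    and test: "\<And>a r H. r > 0 \<Longrightarrow> cball a r \<subseteq> D \<Longrightarrow> H holomorphic_on UNIV \<Longrightarrow>
      (\<And>k. k \<in> sphere a r \<Longrightarrow> f k < ereal (Re (H k))) \<Longrightarrow> f a \<le> ereal (Re (H a))"
  shows "subharmonic_on D f"
  unfolding subharmonic_on_def
proof (intro conjI ballI allI impI)
  show "usc_on D f" by (rule usc)
  show "f a < \<infinity>" if "a \<in> D" for a using that by (rule fin)
  fix a r assume ar: "0 < r \<and> cball a r \<subseteq> D"
  then have r: "r > 0" "sphere a r \<subseteq> D" by auto
  show "f a \<le> circle_mean f a r"
  proof (rule le_circle_mean[OF r(1) usc_on_subset[OF usc r(2)]])
    show "f k < \<infinity>" if "k \<in> sphere a r" for k using that r fin by auto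
    fix h assume h: "continuous_on (sphere a r) h" "\<And>k. k \<in> sphere a r \<Longrightarrow> f k < ereal (h k)"
    show "f a \<le> circle_mean (\<lambda>k. ereal (h k)) a r"
    proof (rule ereal_le_epsilon2)
      fix e :: real assume e: "e > 0"
      have ch: "continuous_on (sphere a r) (\<lambda>k. h k + c)" for c by (intro continuous_intros h)
      obtain F where F: "F holomorphic_on UNIV"
        "\<And>k. k \<in> sphere a r \<Longrightarrow> \<bar>Re (F k) - (h k + e/2)\<bar> < e/2"
        using Re_entire_approx_on_sphere[OF r(1) ch[of "e/2"], of "e/2"] e by auto
      have "f a \<le> ereal (Re (F a))"
      proof (rule test[OF r(1) _ F(1)])
        fix k assume k: "k \<in> sphere a r"
        have "h k < Re (F k)" using F(2)[OF k] by (auto simp: abs_if split: if_splits)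
        then show "f k < ereal (Re (F k))" using h(2)[OF k] by (meson less_ereal.simps(1) less_trans)
      qed (use ar in auto)
      also have "\<dots> = circle_mean (\<lambda>k. ereal (Re (F k))) a r"
        using F(1) by (intro circle_mean_Re_holomorphic[symmetric] r)
          (auto intro: holomorphic_on_subset holomorphic_on_imp_continuous_on)
      also have "\<dots> \<le> circle_mean (\<lambda>k. ereal (h k + e)) a r"
      proof (rule circle_mean_mono)
        fix k assume k: "k \<in> sphere a r"
        have "Re (F k) \<le> h k + e" using F(2)[OF k] by linarith
          then show "ereal (Re (F k)) \<le> ereal (h k + e)" by simp
      qed (use r in auto)
      also have "\<dots> = circle_mean (\<lambda>k. ereal (h k)) a r + ereal e"
      proof -
        have "continuous_on {0..2*pi} (\<lambda>\<theta>. h (a + of_real r * cis \<theta>))"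
          by (rule continuous_on_compose2[OF h(1)])
            (use r in \<open>auto intro!: continuous_intros simp: dist_norm norm_mult\<close>)
        then have "integral {0..2*pi} (\<lambda>\<theta>. h (a + of_real r * cis \<theta>) + e)
          = integral {0..2*pi} (\<lambda>\<theta>. h (a + of_real r * cis \<theta>)) + 2 * pi * e"
          by (subst integral_add) (auto intro: integrable_continuous_real)
        then show ?thesis using r h(1) ch[of e]
          by (simp add: circle_mean_continuous add_divide_distrib)
      qed
      finally show "f a \<le> circle_mean (\<lambda>k. ereal (h k)) a r + ereal e" .
    qed
  qed
qed

lemma psh_wrtI:
  assumes usc: "usc_on G u" and fin: "\<And>x. x \<in> G \<Longrightarrow> u x < \<infinity>"
    and cont: "\<And>a b. continuous_on UNIV (\<lambda>k. a + sm k b)"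
    and test: "\<And>a b c r H. a \<in> G \<Longrightarrow> r > 0 \<Longrightarrow> (\<And>k. k \<in> cball c r \<Longrightarrow> a + sm k b \<in> G) \<Longrightarrow>
      H holomorphic_on UNIV \<Longrightarrow> (\<And>k. k \<in> sphere c r \<Longrightarrow> u (a + sm k b) < ereal (Re (H k))) \<Longrightarrow>
      u (a + sm c b) \<le> ereal (Re (H c))"
  shows "psh_wrt sm G u"
  unfolding psh_wrt_def
proof (intro conjI ballI allI)
  show "usc_on G u" by (rule usc)
  show "u x < \<infinity>" if "x \<in> G" for x using that by (rule fin)
  fix a b assume a: "a \<in> G"
  let ?D = "{k. a + sm k b \<in> G}"
  show "subharmonic_on ?D (\<lambda>k. u (a + sm k b))"
  proof (rule subharmonic_onI)
    show "usc_on ?D (\<lambda>k. u (a + sm k b))"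
      by (rule usc_on_compose[OF usc continuous_on_subset[OF cont]]) auto
    show "u (a + sm k b) < \<infinity>" if "k \<in> ?D" for k using that fin by auto
    show "u (a + sm c b) \<le> ereal (Re (H c))"
      if "r > 0" "cball c r \<subseteq> ?D" "H holomorphic_on UNIV"
        "\<And>k. k \<in> sphere c r \<Longrightarrow> u (a + sm k b) < ereal (Re (H k))" for c r H
      using that by (intro test[OF a]) auto
  qed
qed

text \<open>Here \<open>H\<close> is only required to be holomorphic inside the disc. This is what allows the logarithm of an affine
function without zeros in the disc to be part of \<open>H\<close>.\<close>

lemma psh_wrt_le:
  assumes u: "psh_wrt sm G u" and a: "a \<in> G" and r: "r > 0"
    and G: "\<And>k. k \<in> cball c r \<Longrightarrow> a + sm k b \<in> G"
    and H: "continuous_on (cball c r) H" "H holomorphic_on ball c r"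
    and le: "\<And>k. k \<in> sphere c r \<Longrightarrow> u (a + sm k b) \<le> ereal (Re (H k))"
  shows "u (a + sm c b) \<le> ereal (Re (H c))"
proof -
  have "subharmonic_on {k. a + sm k b \<in> G} (\<lambda>k. u (a + sm k b))"
    using u a by (simp add: psh_wrt_def)
  then show ?thesis by (rule subharmonic_on_le[OF _ r _ H le]) (use G in auto)
qed

lemma entire_imp_disc:
  assumes "H holomorphic_on UNIV"
  shows "continuous_on (cball c r) H" "H holomorphic_on ball c r"
  using assms by (auto intro: holomorphic_on_subset holomorphic_on_imp_continuous_on)

lemma psh_wrt_max:
  assumes f: "psh_wrt sm G f" and g: "psh_wrt sm G g"
    and cont: "\<And>a b. continuous_on UNIV (\<lambda>k. a + sm k b)"
  shows "psh_wrt sm G (\<lambda>x. max (f x) (g x))"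
proof (rule psh_wrtI[OF _ _ cont])
  show "usc_on G (\<lambda>x. max (f x) (g x))" using f g by (simp add: psh_wrt_def usc_on_max)
  show "max (f x) (g x) < \<infinity>" if "x \<in> G" for x using f g that unfolding psh_wrt_def max_def by auto
  fix a b c r H
  assume *: "a \<in> G" "r > 0" "\<And>k. k \<in> cball c r \<Longrightarrow> a + sm k b \<in> G" "H holomorphic_on UNIV"
    and less: "\<And>k. k \<in> sphere c r \<Longrightarrow> max (f (a + sm k b)) (g (a + sm k b)) < ereal (Re (H k))"
  have le: "f (a + sm k b) \<le> ereal (Re (H k))" "g (a + sm k b) \<le> ereal (Re (H k))"
    if "k \<in> sphere c r" for k using less[OF that] by (auto intro: less_imp_le)
  have "f (a + sm c b) \<le> ereal (Re (H c))"
    by (rule psh_wrt_le[OF f *(1,2,3) entire_imp_disc[OF *(4)] le(1)])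
  moreover have "g (a + sm c b) \<le> ereal (Re (H c))"
    by (rule psh_wrt_le[OF g *(1,2,3) entire_imp_disc[OF *(4)] le(2)])
  ultimately show "max (f (a + sm c b)) (g (a + sm c b)) \<le> ereal (Re (H c))" by simp
qed

lemma psh_wrt_affine:
  fixes f :: "'a::real_normed_vector \<Rightarrow> ereal"
  assumes f: "psh_wrt sm G f" and N: "N > 0"
    and cont: "\<And>a b. continuous_on UNIV (\<lambda>k. a + sm k b)"
  shows "psh_wrt sm G (\<lambda>x. ereal N * f x + ereal C)"
proof (rule psh_wrtI[OF _ _ cont])
  show "usc_on G (\<lambda>x. ereal N * f x + ereal C)"
    using f N by (intro usc_on_add_continuous usc_on_scale) (auto simp: psh_wrt_def)
  show "ereal N * f x + ereal C < \<infinity>" if "x \<in> G" for x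
    using f that N by (cases "f x") (auto simp: psh_wrt_def)
  have iff: "ereal N * y + ereal C \<le> ereal t \<longleftrightarrow> y \<le> ereal ((t - C) / N)"
    "ereal N * y + ereal C < ereal t \<longleftrightarrow> y < ereal ((t - C) / N)" for y t
    using N by (cases y; simp add: field_simps)+
  fix a b c r H
  assume *: "a \<in> G" "r > 0" "\<And>k. k \<in> cball c r \<Longrightarrow> a + sm k b \<in> G" "H holomorphic_on UNIV"
    and less: "\<And>k. k \<in> sphere c r \<Longrightarrow> ereal N * f (a + sm k b) + ereal C < ereal (Re (H k))"
  have hol: "(\<lambda>k. (H k - of_real C) / of_real N) holomorphic_on UNIV"
    using N by (intro holomorphic_intros *) auto
  have Re: "Re ((H k - of_real C) / of_real N) = (Re (H k) - C) / N" for k by simp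
  have le: "f (a + sm k b) \<le> ereal (Re ((H k - of_real C) / of_real N))" if "k \<in> sphere c r" for k
    using less_imp_le[OF less[OF that]] unfolding iff Re .
  have "f (a + sm c b) \<le> ereal (Re ((H c - of_real C) / of_real N))"
    by (rule psh_wrt_le[OF f *(1,2,3) entire_imp_disc[OF hol] le])
  then show "ereal N * f (a + sm c b) + ereal C \<le> ereal (Re (H c))" unfolding iff Re .
qed

lemma psh_wrt_const:
  assumes cont: "\<And>a b. continuous_on UNIV (\<lambda>k. a + sm k b)"
  shows "psh_wrt sm G (\<lambda>x. ereal C)"
proof (rule psh_wrtI[OF _ _ cont])
  have "openin (top_of_set G) {x \<in> G. ereal C < c}" for c by (cases "ereal C < c") auto
  then show "usc_on G (\<lambda>x. ereal C)" unfolding usc_on_def by blast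
  fix c :: complex and r H
  assume *: "r > (0::real)" "H holomorphic_on UNIV"
    and less: "\<And>k. k \<in> sphere c r \<Longrightarrow> ereal C < ereal (Re (H k))"
  have "ereal C = circle_mean (\<lambda>k. ereal (Re (of_real C))) c r"
    using * by (subst circle_mean_Re_holomorphic) auto
  also have "\<dots> \<le> circle_mean (\<lambda>k. ereal (Re (H k))) c r"
    using * less by (intro circle_mean_mono) (auto intro: less_imp_le)
  also have "\<dots> = ereal (Re (H c))"
    by (rule circle_mean_Re_holomorphic[OF *(1) entire_imp_disc[OF *(2)]])
  finally show "ereal C \<le> ereal (Re (H c))" .
qed auto

text \<open>If \<open>f - g\<close> had a positive value, then \<open>f - g + \<delta>|x|\<^sup>2\<close> with a small \<open>\<delta>\<close> would
attain its maximum at some \<open>x0\<close> outside \<open>B\<close>. On a small circle about \<open>x0\<close> the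
quadratic term is the constant \<open>s\<^sup>2\<close> plus a harmonic function, so maximality bounds \<open>f\<close> there by a
harmonic function whose value at \<open>x0\<close> is smaller than \<open>f x0\<close> by \<open>\<delta> s\<^sup>2\<close>.\<close>

lemma max_principle:
  fixes K :: "complex set"
  assumes K: "compact K" and usc: "usc_on K f" and fin: "\<And>k. k \<in> K \<Longrightarrow> f k < \<infinity>"
    and g: "continuous_on K g" and B: "\<And>k. k \<in> B \<Longrightarrow> f k \<le> ereal (g k)"
    and int: "\<And>k. k \<in> K - B \<Longrightarrow> \<exists>s>0. cball k s \<subseteq> K \<and> f k \<le> circle_mean f k s \<and>
       (\<exists>L. continuous_on (cball k s) L \<and> L holomorphic_on ball k s \<and> (\<forall>x\<in>cball k s. g x = Re (L x)))"
    and k: "k \<in> K"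
  shows "f k \<le> ereal (g k)"
proof (rule ccontr)
  assume "\<not> ?thesis"
  then have "ereal (g k) < f k" by simp
  then obtain c1 where c1: "f k = ereal c1" "g k < c1" using fin[OF k] by (cases "f k") auto
  obtain R where R: "\<And>x. x \<in> K \<Longrightarrow> norm x \<le> R" "R > 0"
    using compact_imp_bounded[OF K] bounded_pos by metis
  define \<delta> where "\<delta> = (c1 - g k) / (2 * R\<^sup>2)"
  have \<delta>: "\<delta> > 0" "\<delta> * R\<^sup>2 < c1 - g k" using c1(2) R(2) by (auto simp: \<delta>_def field_simps)
  have "usc_on K (\<lambda>x. f x + ereal (\<delta> * (norm x)\<^sup>2 - g x))"
    by (intro usc_on_add_continuous usc continuous_intros g)
  then obtain x0 where x0: "x0 \<in> K"
    "\<And>x. x \<in> K \<Longrightarrow> f x + ereal (\<delta> * (norm x)\<^sup>2 - g x) \<le> f x0 + ereal (\<delta> * (norm x0)\<^sup>2 - g x0)"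
    using usc_on_attains_max[OF K, of "\<lambda>x. f x + ereal (\<delta> * (norm x)\<^sup>2 - g x)"] k by blast
  have "ereal (c1 - g k) \<le> ereal (c1 + (\<delta> * (norm k)\<^sup>2 - g k))" using \<delta> by simp
  also have "\<dots> \<le> f x0 + ereal (\<delta> * (norm x0)\<^sup>2 - g x0)" using x0(2)[OF k] c1 by simp
  finally have big: "ereal (c1 - g k) \<le> f x0 + ereal (\<delta> * (norm x0)\<^sup>2 - g x0)" .
  then obtain c0 where c0: "f x0 = ereal c0" using fin[OF x0(1)] by (cases "f x0") auto
  have n0: "\<delta> * (norm x0)\<^sup>2 \<le> \<delta> * R\<^sup>2" using R(1)[OF x0(1)] \<delta> by (intro mult_left_mono power_mono) auto
  have "x0 \<notin> B"
  proof
    assume "x0 \<in> B"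
    then have "c0 \<le> g x0" using B c0 by fastforce
    then show False using big n0 \<delta>(2) by (simp add: c0)
  qed
  then obtain s L where s: "s > 0" "cball x0 s \<subseteq> K" "f x0 \<le> circle_mean f x0 s"
    and L: "continuous_on (cball x0 s) L" "L holomorphic_on ball x0 s" "\<And>x. x \<in> cball x0 s \<Longrightarrow> g x = Re (L x)"
    using int[of x0] x0(1) by blast
  define E where "E x = of_real (c0 - g x0 - \<delta> * s\<^sup>2) - 2 * of_real \<delta> * cnj x0 * (x - x0) + L x" for x
  have E: "continuous_on (cball x0 s) E" "E holomorphic_on ball x0 s"
    unfolding E_def by (intro continuous_intros holomorphic_intros L)+
  have "f x \<le> ereal (Re (E x))" if x: "x \<in> sphere x0 s" for x
  proof -
    have xK: "x \<in> K" using x s by auto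
    have nx: "(norm x)\<^sup>2 = (norm x0)\<^sup>2 + Re (2 * cnj x0 * (x - x0)) + s\<^sup>2"
    proof -
      have "s\<^sup>2 = (norm (x - x0))\<^sup>2" using x by (simp add: dist_norm norm_minus_commute)
      then show ?thesis by (simp only: cmod_power2) (simp add: power2_eq_square algebra_simps)
    qed
    have "f x + ereal (\<delta> * (norm x)\<^sup>2 - g x) \<le> ereal (c0 + \<delta> * (norm x0)\<^sup>2 - g x0)"
      using x0(2)[OF xK] c0 by (simp add: algebra_simps)
    then have "f x \<le> ereal (c0 + \<delta> * (norm x0)\<^sup>2 - g x0 - \<delta> * (norm x)\<^sup>2 + g x)"
      by (cases "f x") auto
    moreover have "c0 + \<delta> * (norm x0)\<^sup>2 - g x0 - \<delta> * (norm x)\<^sup>2 + g x = Re (E x)"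
      using L(3)[of x] x unfolding E_def nx by (simp add: algebra_simps)
    ultimately show ?thesis by simp
  qed
  then have "circle_mean f x0 s \<le> circle_mean (\<lambda>x. ereal (Re (E x))) x0 s"
    using s by (intro circle_mean_mono) auto
  also have "\<dots> = ereal (Re (E x0))" by (rule circle_mean_Re_holomorphic[OF s(1) E])
  also have "\<dots> = ereal (c0 - \<delta> * s\<^sup>2)" using L(3)[of x0] s by (simp add: E_def)
  finally have "c0 \<le> c0 - \<delta> * s\<^sup>2" using s(3) unfolding c0 by (metis ereal_less_eq(3) order_trans)
  moreover have "\<delta> * s\<^sup>2 > 0" using \<delta>(1) s(1) by simp
  ultimately show False by linarith
qed

lemma circle_mean_shift:
  "circle_mean (\<lambda>k. f (c + k)) 0 r = circle_mean f c r"
  by (simp add: circle_mean_def)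

text \<open>Small circles suffice: they give the maximum principle, which is the comparison on arbitrary discs.\<close>

lemma psh_wrt_local:
  fixes u :: "'a::real_normed_vector \<Rightarrow> ereal"
  assumes cont: "\<And>a b. continuous_on UNIV (\<lambda>k. a + sm k b)"
    and add: "\<And>j k b. sm (j + k) b = sm j b + sm k b"
    and local: "\<And>x. x \<in> G \<Longrightarrow> \<exists>N. open N \<and> x \<in> N \<and> psh_wrt sm (G \<inter> N) u"
    and G: "open G"
  shows "psh_wrt sm G u"
proof -
  have usc: "usc_on G u"
    unfolding usc_on_iff
  proof (intro ballI allI impI)
    fix x c assume x: "x \<in> G" and c: "u x < c"
    obtain N where N: "open N" "x \<in> N" "psh_wrt sm (G \<inter> N) u" using local[OF x] by blast
    then obtain d where d: "d > 0" "\<And>y. y \<in> G \<inter> N \<Longrightarrow> dist y x < d \<Longrightarrow> u y < c"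
      using x c unfolding psh_wrt_def usc_on_iff by (metis IntI)
    obtain d' where d': "d' > 0" "ball x d' \<subseteq> N" using N openE by blast
    show "\<exists>d>0. \<forall>y\<in>G. dist y x < d \<longrightarrow> u y < c"
    proof (intro exI[of _ "min d d'"] conjI ballI impI)
      fix y assume "y \<in> G" "dist y x < min d d'"
      then show "u y < c" using d'(2) by (intro d(2)) (auto simp: dist_commute)
    qed (use d d' in auto)
  qed
  have fin: "u x < \<infinity>" if "x \<in> G" for x
    using local[OF that] that unfolding psh_wrt_def by blast
  show ?thesis
  proof (rule psh_wrtI[OF usc fin cont]; assumption?)
    fix a b c r H
    assume *: "a \<in> G" "r > 0" "\<And>k. k \<in> cball c r \<Longrightarrow> a + sm k b \<in> G" "H holomorphic_on UNIV"
      and less: "\<And>k. k \<in> sphere c r \<Longrightarrow> u (a + sm k b) < ereal (Re (H k))"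
    show "u (a + sm c b) \<le> ereal (Re (H c))"
    proof (rule max_principle[where K = "cball c r" and B = "sphere c r" and f = "\<lambda>k. u (a + sm k b)" and g = "\<lambda>k. Re (H k)"])
      show "usc_on (cball c r) (\<lambda>k. u (a + sm k b))"
        by (rule usc_on_compose[OF usc continuous_on_subset[OF cont]]) (use * in auto)
      show "u (a + sm k b) < \<infinity>" if "k \<in> cball c r" for k using fin *(3) that by blast
      show "continuous_on (cball c r) (\<lambda>k. Re (H k))"
        using entire_imp_disc[OF *(4)] by (intro continuous_intros)
      show "u (a + sm k b) \<le> ereal (Re (H k))" if "k \<in> sphere c r" for k using less[OF that] by simp
      show "c \<in> cball c r" using * by simp
      fix k assume k: "k \<in> cball c r - sphere c r"
      then have kG: "a + sm k b \<in> G" using * by auto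
      obtain N where N: "open N" "a + sm k b \<in> N" "psh_wrt sm (G \<inter> N) u" using local[OF kG] by blast
      have "open ((\<lambda>j. a + sm k b + sm j b) -` (G \<inter> N))"
        by (intro open_vimage cont open_Int G N(1))
      moreover have "0 \<in> (\<lambda>j. a + sm k b + sm j b) -` (G \<inter> N)"
        using kG N(2) add[of 0 0 b] by simp
      ultimately obtain e where e: "e > 0" "cball 0 e \<subseteq> (\<lambda>j. a + sm k b + sm j b) -` (G \<inter> N)"
        using open_contains_cball by blast
      define s where "s = min e (r - dist c k)"
      have s: "s > 0" "s \<le> e" "s \<le> r - dist c k" using e k by (auto simp: s_def)
      have sub: "cball k s \<subseteq> cball c r"
      proof
        fix x assume "x \<in> cball k s"
        then show "x \<in> cball c r" using s(3) dist_triangle[of c x k] by auto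
      qed
      have "subharmonic_on {j. a + sm k b + sm j b \<in> G \<inter> N} (\<lambda>j. u (a + sm k b + sm j b))"
        using N kG unfolding psh_wrt_def by blast
      moreover have "cball 0 s \<subseteq> {j. a + sm k b + sm j b \<in> G \<inter> N}"
      proof
        fix j :: complex assume "j \<in> cball 0 s"
        then have "j \<in> cball 0 e" using s by auto
        then show "j \<in> {j. a + sm k b + sm j b \<in> G \<inter> N}" using e(2) by auto
      qed
      moreover have "0 \<in> {j. a + sm k b + sm j b \<in> G \<inter> N}" using kG N(2) add[of 0 0 b] by simp
      ultimately have "u (a + sm k b + sm 0 b) \<le> circle_mean (\<lambda>j. u (a + sm k b + sm j b)) 0 s"
        using s(1) unfolding subharmonic_on_def by blast
      also have "\<dots> = circle_mean (\<lambda>j. u (a + sm (k + j) b)) 0 s" by (simp add: add add.assoc)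
      also have "\<dots> = circle_mean (\<lambda>j. u (a + sm j b)) k s" by (rule circle_mean_shift)
      finally have "u (a + sm k b) \<le> circle_mean (\<lambda>j. u (a + sm j b)) k s" using add[of 0 0 b] by simp
      then show "\<exists>s>0. cball k s \<subseteq> cball c r \<and> u (a + sm k b) \<le> circle_mean (\<lambda>k. u (a + sm k b)) k s \<and>
          (\<exists>L. continuous_on (cball k s) L \<and> L holomorphic_on ball k s \<and> (\<forall>x\<in>cball k s. Re (H x) = Re (L x)))"
        using s(1) sub entire_imp_disc[OF *(4)] by blast
    qed simp
  qed
qed

text \<open>Dividing by the value at the centre gives a function without values on the negative half-axis: a value
\<open>-s\<close> with \<open>s \<ge> 0\<close> at \<open>k\<close> would put a zero of \<open>A + kB\<close> on the segment from
\<open>c\<close> to \<open>k\<close>. So the principal branch of the logarithm can be used.\<close>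

lemma Re_log_linear_on_cball:
  fixes A B c :: complex
  assumes r: "r > 0" and nz: "\<And>k. k \<in> cball c r \<Longrightarrow> A + k * B \<noteq> 0"
  obtains L where "continuous_on (cball c r) L" "L holomorphic_on ball c r"
    "\<And>k. k \<in> cball c r \<Longrightarrow> ln (norm (A + k * B)) = Re (L k)"
proof -
  define q where "q k = (A + k * B) / (A + c * B)" for k
  have c0: "A + c * B \<noteq> 0" using nz[of c] r by simp
  have q: "q k \<notin> \<real>\<^sub>\<le>\<^sub>0" if k: "k \<in> cball c r" for k
  proof
    assume "q k \<in> \<real>\<^sub>\<le>\<^sub>0"
    then obtain s where s: "s \<ge> 0" "q k = - of_real s"
      by (auto elim!: nonpos_Reals_cases) (metis neg_0_le_iff_le of_real_minus minus_minus)
    then have "A + k * B = - of_real s * (A + c * B)" using c0 by (simp add: q_def field_simps)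
    moreover have "(1 + of_real s) * A + (k + of_real s * c) * B = (A + k * B) + of_real s * (A + c * B)"
      by (simp add: algebra_simps)
    ultimately have e: "(1 + of_real s) * A + (k + of_real s * c) * B = 0" by simp
    have s1: "1 + complex_of_real s \<noteq> 0" using s by (metis add_pos_nonneg less_irrefl of_real_1 of_real_add of_real_eq_0_iff zero_less_one)
    have "(1 / (1 + s)) *\<^sub>R k + (s / (1 + s)) *\<^sub>R c \<in> cball c r"
      using k r s by (intro convexD[OF convex_cball]) (auto simp: field_simps)
    moreover have "(1 / (1 + s)) *\<^sub>R k + (s / (1 + s)) *\<^sub>R c = (k + of_real s * c) / (1 + of_real s)"
      by (simp add: scaleR_conv_of_real add_divide_distrib)
    ultimately have "A + (k + of_real s * c) / (1 + of_real s) * B \<noteq> 0" using nz by metis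
    moreover have "A + (k + of_real s * c) / (1 + of_real s) * B
      = ((1 + of_real s) * A + (k + of_real s * c) * B) / (1 + of_real s)"
      using s1 by (simp add: field_simps)
    ultimately show False using e by simp
  qed
  define L where "L k = of_real (ln (norm (A + c * B))) + Ln (q k)" for k
  have holq: "q holomorphic_on S" for S unfolding q_def using c0 by (intro holomorphic_intros) auto
  show ?thesis
  proof (rule that[of L])
    have "continuous_on (cball c r) q" by (intro holomorphic_on_imp_continuous_on holq)
    then show "continuous_on (cball c r) L"
      unfolding L_def using q by (intro continuous_intros) auto
    have "(\<lambda>k. Ln (q k)) holomorphic_on ball c r"
      by (intro holomorphic_on_Ln' holq) (use q in auto)
    then show "L holomorphic_on ball c r" unfolding L_def
      by (intro holomorphic_on_add holomorphic_on_const)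
    fix k assume k: "k \<in> cball c r"
    have "q k \<noteq> 0" using q[OF k] by auto
    then have "Re (Ln (q k)) = ln (norm (q k))" by (rule Re_Ln)
    also have "\<dots> = ln (norm (A + k * B)) - ln (norm (A + c * B))"
      using nz[OF k] c0 by (simp add: q_def norm_divide ln_div)
    finally show "ln (norm (A + k * B)) = Re (L k)" by (simp add: L_def)
  qed
qed

section \<open>Functions on the product with the annulus\<close>

lemma continuous_on_complex_line:
  "continuous_on UNIV (\<lambda>k. a + k *s b)" for a b :: "complex ^ 'n"
  unfolding vector_scalar_mult_def by (intro continuous_intros)

lemma continuous_on_complex_line_prod:
  "continuous_on UNIV (\<lambda>k. a + (\<lambda>c (x, y). (c *s x, c * y)) k b)" for a b :: "(complex ^ 'n) \<times> complex"
proof -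
  have "continuous_on UNIV (\<lambda>k. a + ((\<chi> i. k * fst b $ i), k * snd b))"
    by (intro continuous_intros)
  then show ?thesis by (simp add: case_prod_unfold vector_scalar_mult_def)
qed

lemma open_annulus: "open annulus"
proof -
  have "annulus = {\<zeta>. 1 < norm \<zeta>} \<inter> {\<zeta>. norm \<zeta> < exp 1}"
  proof (intro set_eqI iffI)
    fix \<zeta> :: complex assume "\<zeta> \<in> annulus"
    then have *: "0 < ln (norm \<zeta>)" "ln (norm \<zeta>) < 1" by (auto simp: annulus_def)
    then have "\<zeta> \<noteq> 0" by auto
    then show "\<zeta> \<in> {\<zeta>. 1 < norm \<zeta>} \<inter> {\<zeta>. norm \<zeta> < exp 1}"
      using * ln_less_cancel_iff[of "norm \<zeta>" "exp 1"] by (auto simp: ln_gt_zero_iff)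
  next
    fix \<zeta> :: complex assume *: "\<zeta> \<in> {\<zeta>. 1 < norm \<zeta>} \<inter> {\<zeta>. norm \<zeta> < exp 1}"
    then have "norm \<zeta> > 0" by (auto intro: less_trans[OF zero_less_one])
    then show "\<zeta> \<in> annulus" using * ln_less_cancel_iff[of "norm \<zeta>" "exp 1"] by (auto simp: annulus_def)
  qed
  moreover have "open {\<zeta>::complex. 1 < norm \<zeta>}" "open {\<zeta>::complex. norm \<zeta> < exp 1}"
    by (intro open_Collect_less continuous_intros)+
  ultimately show ?thesis by (metis open_Int)
qed

lemma exp_in_annulus [simp]: "of_real (exp t) \<in> annulus \<longleftrightarrow> 0 < t \<and> t < 1"
  by (simp add: annulus_def)

lemma annulus_nonzero: "\<zeta> \<in> annulus \<Longrightarrow> \<zeta> \<noteq> 0"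
  by (auto simp: annulus_def)

text \<open>On a disc in a complex line \<open>log |\<zeta>|\<close> is the real part of a holomorphic function, which can be moved into the
comparison function.\<close>

lemma psh_on_prod_add_log:
  fixes w :: "complex ^ 'n \<Rightarrow> ereal"
  assumes w: "psh_on \<Omega> w"
  shows "psh_on_prod (\<Omega> \<times> annulus) (\<lambda>(z, \<zeta>). w z + ereal (C * ln (norm \<zeta>)))"
  unfolding psh_on_prod_def
proof (rule psh_wrtI[OF _ _ continuous_on_complex_line_prod])
  let ?G = "\<Omega> \<times> annulus"
  have w': "psh_wrt (*s) \<Omega> w" using w by (simp add: psh_on_def)
  have "usc_on ?G (\<lambda>p. w (fst p) + ereal (C * ln (norm (snd p))))"
  proof (rule usc_on_add_continuous)
    show "usc_on ?G (\<lambda>p. w (fst p))"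
      by (rule usc_on_compose[of \<Omega>]) (use w' in \<open>auto simp: psh_wrt_def intro: continuous_intros\<close>)
    show "continuous_on ?G (\<lambda>p. C * ln (norm (snd p)))"
      by (intro continuous_intros) (auto dest: annulus_nonzero)
  qed
  then show "usc_on ?G (\<lambda>(z, \<zeta>). w z + ereal (C * ln (norm \<zeta>)))" by (simp add: case_prod_unfold)
  show "(case x of (z, \<zeta>) \<Rightarrow> w z + ereal (C * ln (norm \<zeta>))) < \<infinity>" if "x \<in> ?G" for x
    using that w' by (cases x) (auto simp: psh_wrt_def)
  fix a b :: "(complex ^ 'n) \<times> complex" and c r H
  obtain a1 a2 b1 b2 where ab: "a = (a1, a2)" "b = (b1, b2)" by fastforce
  assume *: "a \<in> ?G" "r > 0"
    "\<And>k. k \<in> cball c r \<Longrightarrow> a + (case b of (x, y) \<Rightarrow> (k *s x, k * y)) \<in> ?G" "H holomorphic_on UNIV"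
    and less: "\<And>k. k \<in> sphere c r \<Longrightarrow> (case a + (case b of (x, y) \<Rightarrow> (k *s x, k * y)) of
        (z, \<zeta>) \<Rightarrow> w z + ereal (C * ln (norm \<zeta>))) < ereal (Re (H k))"
  have in_G: "a1 + k *s b1 \<in> \<Omega>" "a2 + k * b2 \<in> annulus" if "k \<in> cball c r" for k
    using *(3)[OF that] by (auto simp: ab)
  obtain L where L: "continuous_on (cball c r) L" "L holomorphic_on ball c r"
    "\<And>k. k \<in> cball c r \<Longrightarrow> ln (norm (a2 + k * b2)) = Re (L k)"
    using Re_log_linear_on_cball[OF *(2), of c a2 b2] in_G(2) annulus_nonzero by metis
  have iff: "x + ereal (C * s) \<le> ereal t \<longleftrightarrow> x \<le> ereal (t - C * s)" 
    "x + ereal (C * s) < ereal t \<longleftrightarrow> x < ereal (t - C * s)" for x s t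
    by (cases x; auto)+
  have "w (a1 + c *s b1) \<le> ereal (Re (H c - of_real C * L c))"
  proof (rule psh_wrt_le[OF w'])
    show "a1 \<in> \<Omega>" using *(1) by (simp add: ab)
    show "continuous_on (cball c r) (\<lambda>k. H k - of_real C * L k)"
      "(\<lambda>k. H k - of_real C * L k) holomorphic_on ball c r"
      by (intro continuous_intros holomorphic_intros L entire_imp_disc[OF *(4)])+
    fix k assume k: "k \<in> sphere c r"
    then show "w (a1 + k *s b1) \<le> ereal (Re (H k - of_real C * L k))"
      using less[OF k] L(3)[of k] by (simp add: ab iff less_imp_le)
  qed (use * in_G in auto)
  then show "(case a + (case b of (x, y) \<Rightarrow> (c *s x, c * y)) of
        (z, \<zeta>) \<Rightarrow> w z + ereal (C * ln (norm \<zeta>))) \<le> ereal (Re (H c))"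
    using L(3)[of c] * by (simp add: ab iff)
qed

text \<open>As the circle is compact, the supremum is attained and the set where it is at least \<open>A\<close> is the projection
of a closed set along a compact factor. This gives upper semicontinuity; the comparison on discs passes to suprema.\<close>

lemma psh_on_prod_rotation_sup:
  fixes v :: "(complex ^ 'n) \<times> complex \<Rightarrow> ereal"
  assumes v: "psh_on_prod (\<Omega> \<times> annulus) v" 
  shows "psh_on_prod (\<Omega> \<times> annulus) (\<lambda>(z, \<zeta>). SUP c\<in>sphere 0 1. v (z, c * \<zeta>))" (is "psh_on_prod ?G ?V")
  unfolding psh_on_prod_def
proof (rule psh_wrtI[OF _ _ continuous_on_complex_line_prod])
  have v': "psh_wrt (\<lambda>c (x, y). (c *s x, c * y)) ?G v" using v by (simp add: psh_on_prod_def)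
  have rot: "c * \<zeta> \<in> annulus \<longleftrightarrow> \<zeta> \<in> annulus" if "c \<in> sphere 0 1" for c \<zeta>
    using that by (simp add: annulus_def norm_mult)
  have usc2: "usc_on (sphere 0 1 \<times> ?G) (\<lambda>(c, p). v (fst p, c * snd p))"
  proof -
    have "usc_on (sphere 0 1 \<times> ?G) (\<lambda>q. v (fst (snd q), fst q * snd (snd q)))"
      by (rule usc_on_compose[of ?G v]) (use v' in \<open>auto simp: psh_wrt_def rot intro!: continuous_intros\<close>)
    then show ?thesis by (simp add: case_prod_unfold)
  qed
  have attained: "\<exists>c\<in>sphere 0 1. ?V p = v (fst p, c * snd p)" if p: "p \<in> ?G" for p
  proof -
    have "usc_on (sphere 0 1) (\<lambda>c. v (fst p, c * snd p))"
      by (rule usc_on_compose[of ?G v]) (use v' p in \<open>auto simp: psh_wrt_def rot intro!: continuous_intros\<close>)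
    then obtain c where "c \<in> sphere 0 1" "\<And>c'. c' \<in> sphere 0 1 \<Longrightarrow> v (fst p, c' * snd p) \<le> v (fst p, c * snd p)"
      using usc_on_attains_max[of "sphere (0::complex) 1"] by (metis compact_sphere sphere_eq_empty not_one_less_zero)
    then show ?thesis by (intro bexI[of _ c]) (auto simp: case_prod_unfold intro!: antisym SUP_least SUP_upper)
  qed
  show "usc_on ?G ?V"
    unfolding usc_on_def
  proof
    fix A
    let ?U = "sphere 0 1 \<times> ?G - {q \<in> sphere 0 1 \<times> ?G. (\<lambda>(c, p). v (fst p, c * snd p)) q < A}"
    have "closedin (top_of_set (sphere 0 1 \<times> ?G)) ?U"
      using usc2 unfolding usc_on_def by (intro closedin_diff) auto
    then have "closedin (top_of_set ?G) {p. \<exists>c. c \<in> sphere 0 1 \<and> (c, p) \<in> ?U}" (is "closedin _ ?E")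
      by (intro closedin_compact_projection) auto
    then have "openin (top_of_set ?G) (?G - ?E)" by (intro openin_diff) auto
    moreover have "?G - ?E = {p \<in> ?G. ?V p < A}"
    proof (intro set_eqI iffI)
      fix p assume p: "p \<in> ?G - ?E"
      then obtain c where c: "c \<in> sphere 0 1" "?V p = v (fst p, c * snd p)" using attained by blast
      then show "p \<in> {p \<in> ?G. ?V p < A}" using p by auto
    next
      fix p assume p: "p \<in> {p \<in> ?G. ?V p < A}"
      have "v (fst p, c * snd p) \<le> ?V p" if "c \<in> sphere 0 1" for c
        unfolding case_prod_unfold using that by (rule SUP_upper)
      then show "p \<in> ?G - ?E" using p by fastforce
    qed
    ultimately show "openin (top_of_set ?G) {p \<in> ?G. ?V p < A}" by simp
  qed
  show "?V p < \<infinity>" if "p \<in> ?G" for p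
    using attained[OF that] that v' rot unfolding psh_wrt_def by force
  fix a b :: "(complex ^ 'n) \<times> complex" and c r H
  obtain a1 a2 b1 b2 where ab: "a = (a1, a2)" "b = (b1, b2)" by fastforce
  assume *: "a \<in> ?G" "r > 0"
    "\<And>k. k \<in> cball c r \<Longrightarrow> a + (case b of (x, y) \<Rightarrow> (k *s x, k * y)) \<in> ?G" "H holomorphic_on UNIV"
    and less: "\<And>k. k \<in> sphere c r \<Longrightarrow> ?V (a + (case b of (x, y) \<Rightarrow> (k *s x, k * y))) < ereal (Re (H k))"
  have "v (a1 + c *s b1, e * (a2 + c * b2)) \<le> ereal (Re (H c))" if e: "e \<in> sphere 0 1" for e
  proof -
    have "v ((a1, e * a2) + (\<lambda>c (x, y). (c *s x, c * y)) c (b1, e * b2)) \<le> ereal (Re (H c))"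
    proof (rule psh_wrt_le[OF v' _ *(2)])
      show "(a1, e * a2) \<in> ?G" using *(1) by (simp add: ab rot[OF e])
      show "(a1, e * a2) + (\<lambda>c (x, y). (c *s x, c * y)) k (b1, e * b2) \<in> ?G" if "k \<in> cball c r" for k
        using *(3)[OF that] rot[OF e, of "a2 + k * b2"] by (simp add: ab algebra_simps)
      fix k assume k: "k \<in> sphere c r"
      have "v (a1 + k *s b1, e * (a2 + k * b2)) \<le> (SUP c\<in>sphere 0 1. v (a1 + k *s b1, c * (a2 + k * b2)))"
        using e by (rule SUP_upper)
      also have "\<dots> \<le> ereal (Re (H k))" using less[OF k] by (simp add: ab less_imp_le)
      finally show "v ((a1, e * a2) + (\<lambda>c (x, y). (c *s x, c * y)) k (b1, e * b2)) \<le> ereal (Re (H k))"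
        by (simp add: algebra_simps)
    qed (rule entire_imp_disc[OF *(4)])+
    then show ?thesis by (simp add: algebra_simps)
  qed
  then show "?V (a + (case b of (x, y) \<Rightarrow> (c *s x, c * y))) \<le> ereal (Re (H c))"
    by (auto simp: ab intro!: SUP_least)
qed

text \<open>Comparison on the graph of a holomorphic function \<open>F\<close>, obtained from comparison on complex lines by doubling
the second variable. If the conclusion fails, consider, with a small \<open>\<delta>\<close> and a large \<open>N\<close>,
\<open>v(a + kb, F(k) + s) - Re H(k) + \<delta>|k - c|\<^sup>2 - N|s|\<^sup>2\<close>
for \<open>k\<close> in the disc and \<open>|s| \<le> \<eta>\<close>. The penalty \<open>N|s|\<^sup>2\<close> keeps the maximum points away
from \<open>|s| = \<eta>\<close>, the hypothesis keeps them away from the circle. At a maximum \<open>(k0, s0)\<close> move along the complex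
line that is tangent to the graph, in the direction \<open>(b, F'(k0))\<close>. There \<open>s = s0 - R(j)\<close> with
\<open>R(j) = o(|j|)\<close> holomorphic, so \<open>|s|\<^sup>2\<close> is the real part of a holomorphic function up to
\<open>|R(j)|\<^sup>2 = o(|j|\<^sup>2)\<close>, and the term \<open>\<delta>|k - c|\<^sup>2\<close> contradicts the sub-mean value inequality.\<close>

lemma psh_on_prod_le_on_graph:
  fixes v :: "(complex ^ 'n) \<times> complex \<Rightarrow> ereal"
  assumes v: "psh_on_prod (\<Omega> \<times> D) v" and op: "open \<Omega>" "open D"
    and r: "r > 0" and \<Omega>: "\<And>k. k \<in> cball c r \<Longrightarrow> a + k *s b \<in> \<Omega>"
    and F: "F holomorphic_on UNIV" "\<And>k. k \<in> cball c r \<Longrightarrow> F k \<in> D"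
    and H: "H holomorphic_on UNIV"
    and less: "\<And>k. k \<in> sphere c r \<Longrightarrow> v (a + k *s b, F k) < ereal (Re (H k))"
  shows "v (a + c *s b, F c) \<le> ereal (Re (H c))"
proof (rule ccontr)
  let ?G = "\<Omega> \<times> D"
  let ?sm = "\<lambda>c (x, y). (c *s x, c * y)"
  assume "\<not> ?thesis"
  then have gt: "ereal (Re (H c)) < v (a + c *s b, F c)" by simp
  have v': "psh_wrt ?sm ?G v" using v by (simp add: psh_on_prod_def)
  have usc: "usc_on ?G v" and fin: "\<And>x. x \<in> ?G \<Longrightarrow> v x < \<infinity>" using v' by (auto simp: psh_wrt_def)
  have cG: "(a + c *s b, F c) \<in> ?G" using \<Omega> F(2) r by simp
  obtain c1 where c1: "v (a + c *s b, F c) = ereal c1" "Re (H c) < c1"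
    using gt fin[OF cG] by (cases "v (a + c *s b, F c)") auto
  define \<delta> where "\<delta> = (c1 - Re (H c)) / (2 * r\<^sup>2)"
  have \<delta>: "\<delta> > 0" "\<delta> * r\<^sup>2 < c1 - Re (H c)" using c1(2) r by (auto simp: \<delta>_def field_simps)
  have cF: "continuous_on S F" and cH: "continuous_on S H" for S
    using F(1) H by (auto intro: holomorphic_on_imp_continuous_on holomorphic_on_subset)
  define \<gamma> where "\<gamma> = (\<lambda>p. (a + fst p *s b, F (fst p) + snd p))"
  have c\<gamma>: "continuous_on S \<gamma>" for S
    unfolding \<gamma>_def vector_scalar_mult_def
    by (intro continuous_intros continuous_on_compose2[OF cF]) auto
  define Q where "Q = \<gamma> -` ?G"
  have opQ: "open Q" unfolding Q_def by (intro open_vimage open_Times op c\<gamma>)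
  \<comment> \<open>the quantity to be maximised, before the penalty\<close>
  define \<phi> where "\<phi> p = v (\<gamma> p) + ereal (\<delta> * (norm (fst p - c))\<^sup>2 - Re (H (fst p)))" for p
  have usc\<phi>: "usc_on S \<phi>" if "S \<subseteq> Q" for S
    unfolding \<phi>_def
    by (intro usc_on_add_continuous usc_on_compose[OF usc c\<gamma>] continuous_intros continuous_on_compose2[OF cH])
       (use that in \<open>auto simp: Q_def\<close>)
  \<comment> \<open>contains the circle at \<open>s = 0\<close>; on it \<open>\<phi>\<close> stays below its value at \<open>(c, 0)\<close>, which exceeds \<open>\<delta> r\<^sup>2\<close>\<close>
  define V0 where "V0 = {p \<in> Q. \<phi> p < ereal (\<delta> * r\<^sup>2)}"
  have opV0: "open V0"
    using usc\<phi>[of Q] opQ unfolding usc_on_def V0_def by (simp add: openin_open_eq)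
  have "compact (cball c r \<times> {0::complex})" "cball c r \<times> {0} \<subseteq> Q"
    using \<Omega> F(2) by (auto intro: compact_Times simp: Q_def \<gamma>_def)
  then obtain e1 where e1: "e1 > 0" "(\<Union>x\<in>cball c r \<times> {0}. ball x e1) \<subseteq> Q"
    using compact_subset_open_imp_ball_epsilon_subset[OF _ opQ] by metis
  have "sphere c r \<times> {0} \<subseteq> V0"
  proof
    fix p assume p: "p \<in> sphere c r \<times> {0::complex}"
    then have "p \<in> Q" using \<open>cball c r \<times> {0} \<subseteq> Q\<close> by auto
    moreover have "\<phi> p < ereal (\<delta> * r\<^sup>2)"
    proof -
      have "v (\<gamma> p) < ereal (Re (H (fst p)))" using less p by (auto simp: \<gamma>_def)
      moreover have "norm (fst p - c) = r" using p by (auto simp: dist_norm norm_minus_commute)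
      ultimately show ?thesis unfolding \<phi>_def by (cases "v (\<gamma> p)") auto
    qed
    ultimately show "p \<in> V0" by (simp add: V0_def)
  qed
  moreover have "compact (sphere c r \<times> {0::complex})" by (intro compact_Times) auto
  ultimately obtain e2 where e2: "e2 > 0" "(\<Union>x\<in>sphere c r \<times> {0}. ball x e2) \<subseteq> V0"
    using compact_subset_open_imp_ball_epsilon_subset[OF _ opV0] by metis
  define \<eta> where "\<eta> = min e1 e2 / 2"
  have \<eta>: "\<eta> > 0" "\<eta> < e1" "\<eta> < e2" using e1 e2 by (auto simp: \<eta>_def)
  define K where "K = cball c r \<times> cball (0::complex) \<eta>"
  have KQ: "K \<subseteq> Q"
  proof
    fix p assume "p \<in> K"
    then have "(fst p, 0) \<in> cball c r \<times> {0}" "p \<in> ball (fst p, 0) e1"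
      using \<eta> by (auto simp: K_def dist_Pair_Pair)
    then show "p \<in> Q" using e1(2) by blast
  qed
  have KV0: "p \<in> V0" if "p \<in> K" "fst p \<in> sphere c r" for p
  proof -
    have "(fst p, 0) \<in> sphere c r \<times> {0}" "p \<in> ball (fst p, 0) e2"
      using \<eta> that by (cases p; simp add: K_def dist_Pair_Pair)+
    then show ?thesis using e2(2) by blast
  qed
  have cK: "compact K" "K \<noteq> {}" using r \<eta> by (auto simp: K_def intro: compact_Times)
  have c0K: "(c, 0) \<in> K" using r \<eta> by (simp add: K_def)
  have \<phi>c: "\<phi> (c, 0) = ereal (c1 - Re (H c))" using c1 by (simp add: \<phi>_def \<gamma>_def)
  obtain m where m: "m \<in> K" "\<And>p. p \<in> K \<Longrightarrow> \<phi> p \<le> \<phi> m"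
    using usc_on_attains_max[OF cK usc\<phi>[OF KQ]] by blast
  have "\<gamma> m \<in> ?G" using m(1) KQ by (auto simp: Q_def)
  then have "\<phi> m < \<infinity>" using fin[of "\<gamma> m"] by (simp add: \<phi>_def)
  then obtain M where M: "\<phi> m = ereal M" using m(2)[OF c0K] \<phi>c by (cases "\<phi> m") auto
  \<comment> \<open>the penalty alone rules out \<open>|s| = \<eta>\<close> as soon as it exceeds the gap between the maximum of \<open>\<phi>\<close> and its value at \<open>(c, 0)\<close>\<close>
  obtain N where N: "N > 0" "M - N * \<eta>\<^sup>2 < c1 - Re (H c)"
  proof (rule that)
    define N where "N = (\<bar>M - (c1 - Re (H c))\<bar> + 1) / \<eta>\<^sup>2"
    show "N > 0" using \<eta> by (simp add: N_def)
    have "N * \<eta>\<^sup>2 = \<bar>M - (c1 - Re (H c))\<bar> + 1" using \<eta> by (simp add: N_def)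
    then show "M - N * \<eta>\<^sup>2 < c1 - Re (H c)" by linarith
  qed
  define \<psi> where "\<psi> p = \<phi> p + ereal (- N * (norm (snd p))\<^sup>2)" for p
  have "usc_on K \<psi>" unfolding \<psi>_def by (intro usc_on_add_continuous usc\<phi> KQ continuous_intros)
  then obtain p0 where p0: "p0 \<in> K" "\<And>p. p \<in> K \<Longrightarrow> \<psi> p \<le> \<psi> p0"
    using usc_on_attains_max[OF cK] by blast
  obtain k0 s0 where ks: "p0 = (k0, s0)" by fastforce
  have big: "ereal (c1 - Re (H c)) \<le> \<psi> p0" using p0(2)[OF c0K] \<phi>c by (simp add: \<psi>_def)
  have "\<psi> p0 \<le> \<phi> p0" using N(1) by (cases "\<phi> p0") (auto simp: \<psi>_def)
  have k0: "dist c k0 < r"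
  proof (rule ccontr)
    assume "\<not> dist c k0 < r"
    then have "fst p0 \<in> sphere c r" using p0(1) by (auto simp: K_def ks)
    then have "\<phi> p0 < ereal (\<delta> * r\<^sup>2)" using KV0[OF p0(1)] by (simp add: V0_def)
    then have "ereal (c1 - Re (H c)) < ereal (\<delta> * r\<^sup>2)" using big \<open>\<psi> p0 \<le> \<phi> p0\<close> by (meson le_less_trans order_trans)
    then show False using \<delta>(2) by simp
  qed
  have s0: "norm s0 < \<eta>"
  proof (rule ccontr)
    assume "\<not> norm s0 < \<eta>"
    then have "norm s0 = \<eta>" using p0(1) by (auto simp: K_def ks)
    moreover have "\<phi> p0 \<le> ereal M" using m(2)[OF p0(1)] M by simp
    ultimately have "\<psi> p0 \<le> ereal (M - N * \<eta>\<^sup>2)" by (cases "\<phi> p0") (auto simp: \<psi>_def ks)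
    then have "ereal (c1 - Re (H c)) \<le> ereal (M - N * \<eta>\<^sup>2)" using big by (rule order_trans[rotated])
    then show False using N(2) by simp
  qed
  define x0 where "x0 = \<gamma> p0"
  have x0G: "x0 \<in> ?G" using p0(1) KQ by (auto simp: Q_def x0_def)
  obtain v0 where v0: "v x0 = ereal v0"
    using big fin[OF x0G] by (cases "v x0") (auto simp: \<psi>_def \<phi>_def x0_def)
  define F' where "F' = deriv F k0"
  define R where "R j = F (k0 + j) - F k0 - F' * j" for j
  have "(F has_field_derivative F') (at k0)"
    using F(1) by (simp add: F'_def holomorphic_derivI)
  then have alt: "\<forall>e>0. \<exists>d>0. \<forall>y. norm (y - k0) < d \<longrightarrow> norm (F y - F k0 - F' * (y - k0)) \<le> e * norm (y - k0)"
    by (auto simp: has_field_derivative_def has_derivative_at_alt)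
  \<comment> \<open>makes \<open>N|R j|\<^sup>2\<close> at most half of \<open>\<delta>|j|\<^sup>2\<close>\<close>
  define e where "e = min 1 (\<delta> / (2 * N))"
  have e: "e > 0" "e \<le> 1" "N * e\<^sup>2 \<le> \<delta> / 2"
  proof -
    show e': "e > 0" "e \<le> 1" using \<delta> N by (auto simp: e_def)
    have "e\<^sup>2 \<le> e * 1" unfolding power2_eq_square using e' by (intro mult_left_mono) auto
    also have "\<dots> \<le> \<delta> / (2 * N)" by (simp add: e_def)
    finally show "N * e\<^sup>2 \<le> \<delta> / 2" using N by (simp add: field_simps)
  qed
  obtain d where d: "d > 0" "\<And>y. norm (y - k0) < d \<Longrightarrow> norm (F y - F k0 - F' * (y - k0)) \<le> e * norm (y - k0)"
    using alt e(1) by blast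
  have R: "norm (R j) \<le> e * norm j" if "norm j < d" for j
    using d(2)[of "k0 + j"] that by (simp add: R_def)
  define t where "t = min (d / 2) (min (r - dist c k0) (\<eta> - norm s0))"
  have t: "t > 0" "t < d" "t \<le> r - dist c k0" "t \<le> \<eta> - norm s0"
    using d k0 s0 by (auto simp: t_def)
  have line: "x0 + ?sm j (b, F') = \<gamma> (k0 + j, s0 - R j)" for j
    by (simp add: x0_def \<gamma>_def ks R_def vector_scalar_mult_def vec_eq_iff algebra_simps)
  have inK: "(k0 + j, s0 - R j) \<in> K" if "norm j \<le> t" for j
  proof -
    have "dist c (k0 + j) \<le> dist c k0 + norm j" using dist_triangle[of c "k0 + j" k0] by (simp add: dist_norm)
    moreover have "norm (R j) \<le> 1 * norm j"
      using R[of j] that t e mult_right_mono[OF e(2), of "norm j"] by auto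
    then have "norm (s0 - R j) \<le> norm s0 + norm j" using norm_triangle_ineq4[of s0 "R j"] by linarith
    ultimately show ?thesis using that t by (simp add: K_def)
  qed
  \<comment> \<open>the holomorphic function whose real part dominates \<open>v\<close> on the circle of radius \<open>t\<close>, by maximality at \<open>(k0, s0)\<close>; at the centre it is too small\<close>
  define E where "E j = of_real (v0 - \<delta> * t\<^sup>2 / 2) + (H (k0 + j) - H k0)
     - 2 * of_real \<delta> * cnj (k0 - c) * j - 2 * of_real N * cnj s0 * R j" for j
  have shift: "(\<lambda>j. k0 + j) holomorphic_on UNIV" by (intro holomorphic_intros)
  have "(\<lambda>j. F (k0 + j)) holomorphic_on UNIV" "(\<lambda>j. H (k0 + j)) holomorphic_on UNIV"
    using holomorphic_on_compose_gen[OF shift F(1)] holomorphic_on_compose_gen[OF shift H] by (auto simp: o_def)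
  then have holE: "E holomorphic_on UNIV"
    unfolding E_def R_def by (intro holomorphic_intros)
  have "v (x0 + ?sm 0 (b, F')) \<le> ereal (Re (E 0))"
  proof (rule psh_wrt_le[OF v' x0G t(1)])
    show "x0 + ?sm k (b, F') \<in> ?G" if "k \<in> cball 0 t" for k
      using inK[of k] that KQ unfolding line by (auto simp: Q_def)
    show "continuous_on (cball 0 t) E" "E holomorphic_on ball 0 t"
      by (rule entire_imp_disc[OF holE])+
    fix j :: complex assume "j \<in> sphere 0 t"
    then have nj: "norm j = t" by simp
    define p where "p = (k0 + j, s0 - R j)"
    have "\<psi> p \<le> \<psi> p0" using inK[of j] nj by (intro p0(2)) (simp add: p_def)
    then have "v (\<gamma> p) \<le> ereal (v0 + \<delta> * (norm (k0 - c))\<^sup>2 - Re (H k0) - N * (norm s0)\<^sup>2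
        - \<delta> * (norm (k0 + j - c))\<^sup>2 + Re (H (k0 + j)) + N * (norm (s0 - R j))\<^sup>2)"
      using v0 by (cases "v (\<gamma> p)") (auto simp: \<psi>_def \<phi>_def ks p_def x0_def algebra_simps)
    also have "\<dots> \<le> ereal (Re (E j))"
    proof -
      have n1: "(norm (k0 + j - c))\<^sup>2 = (norm (k0 - c))\<^sup>2 + Re (2 * cnj (k0 - c) * j) + t\<^sup>2"
        unfolding nj[symmetric] by (simp only: cmod_power2) (simp add: power2_eq_square algebra_simps)
      have n2: "(norm (s0 - R j))\<^sup>2 = (norm s0)\<^sup>2 - Re (2 * cnj s0 * R j) + (norm (R j))\<^sup>2"
        by (simp only: cmod_power2) (simp add: power2_eq_square algebra_simps)
      have "norm (R j) \<le> e * t" using R[of j] nj t by simp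
      then have "(norm (R j))\<^sup>2 \<le> (e * t)\<^sup>2" by (intro power_mono) auto
      then have "N * (norm (R j))\<^sup>2 \<le> N * (e * t)\<^sup>2" using N by (intro mult_left_mono) auto
      also have "\<dots> = (N * e\<^sup>2) * t\<^sup>2" by (simp add: power_mult_distrib)
      also have "\<dots> \<le> \<delta> / 2 * t\<^sup>2" using e by (intro mult_right_mono) auto
      finally have n3: "N * (norm (R j))\<^sup>2 \<le> \<delta> / 2 * t\<^sup>2" .
      have "Re (E j) = v0 - \<delta> * t\<^sup>2 / 2 + Re (H (k0 + j)) - Re (H k0)
          - \<delta> * Re (2 * cnj (k0 - c) * j) - N * Re (2 * cnj s0 * R j)"
        unfolding E_def by (simp add: algebra_simps)
      then show ?thesis unfolding n1 n2 using n3 by (simp add: algebra_simps)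
    qed
    finally show "v (x0 + ?sm j (b, F')) \<le> ereal (Re (E j))" unfolding line p_def .
  qed
  moreover have "x0 + ?sm 0 (b, F') = x0" by (simp add: vector_scalar_mult_def vec_eq_iff prod_eq_iff)
  moreover have "Re (E 0) = v0 - \<delta> * t\<^sup>2 / 2" by (simp add: E_def R_def)
  ultimately have "\<delta> * t\<^sup>2 / 2 \<le> 0" using v0 by simp
  moreover have "\<delta> * t\<^sup>2 / 2 > 0" using \<delta>(1) t(1) by simp
  ultimately show False by linarith
qed

section \<open>Kiselman's minimum principle\<close>

text \<open>Michael's selection theorem in its simplest case: a partition of unity averages local constant selections, and the
averages stay admissible by convexity. Compactness of the graph provides room for a perturbation, which is
needed because the selection will be replaced by an approximation.\<close>

lemma robust_convex_selection:
  fixes K :: "'a::euclidean_space set" and V :: "('a \<times> real) set"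
  assumes K: "compact K" and V: "openin (top_of_set (K \<times> UNIV)) V"
    and ne: "\<And>k. k \<in> K \<Longrightarrow> \<exists>t. (k, t) \<in> V"
    and conv: "\<And>k. k \<in> K \<Longrightarrow> convex {t. (k, t) \<in> V}"
  obtains \<tau> e where "continuous_on K \<tau>" "e > 0"
    "\<And>k t. k \<in> K \<Longrightarrow> \<bar>t - \<tau> k\<bar> < e \<Longrightarrow> (k, t) \<in> V"
proof -
  obtain V' where V': "open V'" "V = (K \<times> UNIV) \<inter> V'" using V by (metis openin_open)
  define W where "W t = (\<lambda>k. (k, t)) -` V'" for t :: real
  have W: "open (W t)" for t unfolding W_def by (intro open_vimage V'(1) continuous_intros)
  have Wiff: "k \<in> W t \<longleftrightarrow> (k, t) \<in> V" if "k \<in> K" for k t using that by (simp add: W_def V')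
  have "K \<subseteq> (\<Union>t. W t)" using ne Wiff by blast
  then obtain \<C> where \<C>: "\<C> \<subseteq> range W" "finite \<C>" "K \<subseteq> \<Union>\<C>"
    using compactE[OF K, of "range W"] W by blast
  define tt where "tt U = (SOME t. U = W t)" for U
  have tt: "U = W (tt U)" if "U \<in> \<C>" for U
    unfolding tt_def by (rule someI_ex) (use that \<C>(1) in auto)
  obtain F :: "'a set \<Rightarrow> 'a \<Rightarrow> real" where F:
    "\<And>U. U \<in> \<C> \<Longrightarrow> continuous_on K (F U) \<and> (\<forall>x\<in>K. 0 \<le> F U x)"
    "\<And>x U. U \<in> \<C> \<Longrightarrow> x \<in> K \<Longrightarrow> x \<notin> U \<Longrightarrow> F U x = 0"
    "\<And>x. x \<in> K \<Longrightarrow> supp_sum (\<lambda>W. F W x) \<C> = 1"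
    "\<And>x. x \<in> K \<Longrightarrow> \<exists>V. open V \<and> x \<in> V \<and> finite {U \<in> \<C>. \<exists>x\<in>V. F U x \<noteq> 0}"
  proof (rule subordinate_partition_of_unity[of K \<C>])
    show "\<exists>V. open V \<and> x \<in> V \<and> finite {U \<in> \<C>. U \<inter> V \<noteq> {}}" if "x \<in> K" for x
      using \<C>(2) by (intro exI[of _ UNIV]) auto
  qed (use \<C> W in blast)+
  define \<tau> where "\<tau> k = (\<Sum>U\<in>\<C>. F U k * tt U)" for k
  have c\<tau>: "continuous_on K \<tau>"
    unfolding \<tau>_def by (intro continuous_intros) (use F(1) in auto)
  have mem: "(k, \<tau> k) \<in> V" if k: "k \<in> K" for k
  proof -
    let ?I = "{U \<in> \<C>. F U k \<noteq> 0}"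
    have "(\<Sum>U\<in>?I. F U k *\<^sub>R tt U) \<in> {t. (k, t) \<in> V}"
    proof (rule convex_sum)
      show "(\<Sum>U\<in>?I. F U k) = 1" using F(3)[OF k] by (simp add: supp_sum_def support_on_def)
      show "tt U \<in> {t. (k, t) \<in> V}" if U: "U \<in> ?I" for U
      proof -
        have "k \<in> U" using F(2)[of U k] U k by auto
        then have "k \<in> W (tt U)" using tt U by blast
        then show ?thesis using Wiff[OF k] by simp
      qed
    qed (use \<C>(2) conv k F(1) in auto)
    also have "(\<Sum>U\<in>?I. F U k *\<^sub>R tt U) = \<tau> k"
      unfolding \<tau>_def using \<C>(2) by (intro sum.mono_neutral_cong_left) auto
    finally show ?thesis by simp
  qed
  have "compact ((\<lambda>k. (k, \<tau> k)) ` K)"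
    by (intro compact_continuous_image K continuous_intros c\<tau>)
  moreover have "(\<lambda>k. (k, \<tau> k)) ` K \<subseteq> V'" using mem V'(2) by auto
  ultimately obtain e where e: "e > 0" "(\<Union>x\<in>(\<lambda>k. (k, \<tau> k)) ` K. ball x e) \<subseteq> V'"
    using compact_subset_open_imp_ball_epsilon_subset[OF _ V'(1)] by metis
  have "(k, t) \<in> V" if "k \<in> K" "\<bar>t - \<tau> k\<bar> < e" for k t
  proof -
    have "(k, t) \<in> ball (k, \<tau> k) e" using that by (simp add: dist_Pair_Pair dist_real_def abs_minus_commute)
    then show ?thesis using e(2) that(1) V'(2) by blast
  qed
  then show ?thesis using that c\<tau> e(1) by blast
qed

lemma Re_less_on_cball:
  assumes f: "f holomorphic_on UNIV" and r: "r > 0" and less: "\<And>k. k \<in> sphere c r \<Longrightarrow> Re (f k) < B"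
    and k: "k \<in> cball c r"
  shows "Re (f k) < B"
proof -
  have "continuous_on (sphere c r) (\<lambda>k. Re (f k))"
    by (intro continuous_intros holomorphic_on_imp_continuous_on holomorphic_on_subset[OF f]) auto
  moreover have "sphere c r \<noteq> {}" using r by simp
  ultimately obtain m where m: "m \<in> sphere c r" "\<And>k. k \<in> sphere c r \<Longrightarrow> Re (f k) \<le> Re (f m)"
    using continuous_attains_sup[OF compact_sphere, of c r "\<lambda>k. Re (f k)"] by blast
  have "Re (f k) \<le> Re (f m)"
  proof (rule maximum_real_frontier[of f "cball c r"])
    show "f holomorphic_on interior (cball c r)" "continuous_on (closure (cball c r)) f"
      using f by (auto intro: holomorphic_on_subset holomorphic_on_imp_continuous_on)
  qed (use m k r in \<open>auto simp: frontier_cball\<close>)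
  then show ?thesis using less[OF m(1)] by simp
qed

text \<open>The second component ranges over all of \<open>\<complex>\<close>, so that invariance can be used without regard to domains.\<close>

definition rotation_invariant :: "('a \<times> complex \<Rightarrow> ereal) \<Rightarrow> bool" where
  "rotation_invariant v \<longleftrightarrow> (\<forall>z \<zeta>. v (z, \<zeta>) = v (z, of_real (norm \<zeta>)))"

lemma rotation_invariantD: "rotation_invariant v \<Longrightarrow> norm \<zeta> = norm \<xi> \<Longrightarrow> v (z, \<zeta>) = v (z, \<xi>)"
  unfolding rotation_invariant_def by metis

text \<open>Hadamard's three circles theorem: compare \<open>v(z, \<cdot>)\<close> with \<open>\<alpha> + \<beta> log |\<zeta>|\<close> on the closed
annulus \<open>t1 \<le> log |\<zeta>| \<le> t2\<close>. Convexity is stated through affine majorants since \<open>v\<close> may take the value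
\<open>-\<infinity>\<close>.\<close>

lemma psh_on_prod_radially_convex:
  fixes v :: "(complex ^ 'n) \<times> complex \<Rightarrow> ereal"
  assumes v: "psh_on_prod (\<Omega> \<times> annulus) v" and rot: "rotation_invariant v" and z: "z \<in> \<Omega>"
    and t: "0 < t1" "t1 \<le> t" "t \<le> t2" "t2 < 1"
    and le: "v (z, of_real (exp t1)) \<le> ereal (\<alpha> + \<beta> * t1)" "v (z, of_real (exp t2)) \<le> ereal (\<alpha> + \<beta> * t2)"
  shows "v (z, of_real (exp t)) \<le> ereal (\<alpha> + \<beta> * t)"
proof -
  let ?sm = "\<lambda>c (x, y). (c *s x, c * y)"
  let ?G = "\<Omega> \<times> annulus"
  have v': "psh_wrt ?sm ?G v" using v by (simp add: psh_on_prod_def)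
  define K where "K = {\<zeta>::complex. exp t1 \<le> norm \<zeta> \<and> norm \<zeta> \<le> exp t2}"
  define B where "B = {\<zeta>::complex. norm \<zeta> = exp t1 \<or> norm \<zeta> = exp t2}"
  have K_annulus: "\<zeta> \<in> annulus" if "\<zeta> \<in> K" for \<zeta>
  proof -
    have p: "norm \<zeta> > 0" using that by (auto simp: K_def intro: less_le_trans[OF exp_gt_zero])
    then have "t1 \<le> ln (norm \<zeta>)" "ln (norm \<zeta>) \<le> t2"
      using that ln_le_cancel_iff[of "exp t1" "norm \<zeta>"] ln_le_cancel_iff[of "norm \<zeta>" "exp t2"]
      by (simp_all add: K_def)
    then show ?thesis using t by (simp add: annulus_def)
  qed
  have "v (z, of_real (exp t)) \<le> ereal (\<alpha> + \<beta> * ln (norm (complex_of_real (exp t))))"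
  proof (rule max_principle[where K = K and B = B and f = "\<lambda>\<zeta>. v (z, \<zeta>)" and g = "\<lambda>\<zeta>. \<alpha> + \<beta> * ln (norm \<zeta>)"])
    have "K = cball 0 (exp t2) - ball 0 (exp t1)" by (auto simp: K_def)
    then show "compact K" by (simp add: compact_diff)
    show "usc_on K (\<lambda>\<zeta>. v (z, \<zeta>))"
      by (rule usc_on_compose[of ?G v]) (use v' z K_annulus in \<open>auto simp: psh_wrt_def intro!: continuous_intros\<close>)
    show "v (z, k) < \<infinity>" if "k \<in> K" for k using v' z K_annulus[OF that] by (auto simp: psh_wrt_def)
    show "continuous_on K (\<lambda>\<zeta>. \<alpha> + \<beta> * ln (norm \<zeta>))"
      by (intro continuous_intros) (use K_annulus annulus_nonzero in auto)
    show "v (z, k) \<le> ereal (\<alpha> + \<beta> * ln (norm k))" if "k \<in> B" for k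
      using that le rotation_invariantD[OF rot, of k "of_real (exp t1)" z]
        rotation_invariantD[OF rot, of k "of_real (exp t2)" z] by (auto simp: B_def)
    show "complex_of_real (exp t) \<in> K" using t by (simp add: K_def)
    fix k assume k: "k \<in> K - B"
    then have "k \<in> {\<zeta>. exp t1 < norm \<zeta>} \<inter> {\<zeta>. norm \<zeta> < exp t2}" (is "k \<in> ?U") by (auto simp: K_def B_def)
    moreover have "open ?U" by (intro open_Int open_Collect_less continuous_intros)
    ultimately obtain s where s: "s > 0" "cball k s \<subseteq> ?U" by (meson open_contains_cball)
    then have sK: "cball k s \<subseteq> K" by (auto simp: K_def)
    have "subharmonic_on {j. (z, k) + ?sm j (0, 1) \<in> ?G} (\<lambda>j. v ((z, k) + ?sm j (0, 1)))"
      using v' z K_annulus[of k] k unfolding psh_wrt_def by blast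
    moreover have line: "(z, k) + ?sm j (0, 1) = (z, k + j)" for j by (simp add: vector_scalar_mult_def vec_eq_iff)
    ultimately have "subharmonic_on {j. (z, k + j) \<in> ?G} (\<lambda>j. v (z, k + j))" by simp
    moreover have "cball 0 s \<subseteq> {j. (z, k + j) \<in> ?G}"
    proof
      fix j :: complex assume "j \<in> cball 0 s"
      then have "k + j \<in> K" using sK by (auto simp: dist_norm)
      then show "j \<in> {j. (z, k + j) \<in> ?G}" using z K_annulus by simp
    qed
    moreover from this have "0 \<in> {j. (z, k + j) \<in> ?G}" using s(1) by (metis centre_in_cball less_imp_le subsetD)
    ultimately have "v (z, k + 0) \<le> circle_mean (\<lambda>j. v (z, k + j)) 0 s"
      using s(1) unfolding subharmonic_on_def by blast
    then have "v (z, k) \<le> circle_mean (\<lambda>\<zeta>. v (z, \<zeta>)) k s"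
      using circle_mean_shift[of "\<lambda>\<zeta>. v (z, \<zeta>)" k s] by simp
    moreover have "0 + x * 1 \<noteq> 0" if "x \<in> cball k s" for x
      using annulus_nonzero[OF K_annulus, of x] subsetD[OF sK that] by simp
    then obtain L where L: "continuous_on (cball k s) L" "L holomorphic_on ball k s"
      "\<And>x. x \<in> cball k s \<Longrightarrow> ln (norm (0 + x * 1)) = Re (L x)"
      using Re_log_linear_on_cball[OF s(1), of k 0 1] by blast
    moreover have "continuous_on (cball k s) (\<lambda>x. of_real \<alpha> + of_real \<beta> * L x)"
      "(\<lambda>x. of_real \<alpha> + of_real \<beta> * L x) holomorphic_on ball k s"
      by (intro continuous_intros holomorphic_intros L)+
    ultimately show "\<exists>s>0. cball k s \<subseteq> K \<and> v (z, k) \<le> circle_mean (\<lambda>\<zeta>. v (z, \<zeta>)) k s \<and>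
       (\<exists>L. continuous_on (cball k s) L \<and> L holomorphic_on ball k s \<and>
         (\<forall>x\<in>cball k s. \<alpha> + \<beta> * ln (norm x) = Re (L x)))"
      using s(1) sK by (intro exI[of _ s] exI[of _ "\<lambda>x. of_real \<alpha> + of_real \<beta> * L x"] conjI) auto
  qed
  then show ?thesis by simp
qed

text \<open>Kiselman's minimum principle. Upper semicontinuity is clear for an infimum. For the comparison on a disc, choose over each
point \<open>k\<close> of the circle a parameter \<open>\<tau> k\<close> for which \<open>v_t - Ct < Re H\<close>; these parameters form
an interval, and \<open>\<tau>\<close> can be taken continuous, then of the form \<open>Re f\<close> with \<open>f\<close> entire. Over
the holomorphic curve \<open>k \<mapsto> exp (f k)\<close> one has \<open>log |exp (f k)| = Re (f k)\<close>, which makes the term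
\<open>Ct\<close> a harmonic function. Comparison on the graph gives the bound at the centre.\<close>

lemma psh_on_partial_infimum:
  fixes v :: "(complex ^ 'n) \<times> complex \<Rightarrow> ereal"
  assumes v: "psh_on_prod (\<Omega> \<times> annulus) v" and rot: "rotation_invariant v" and \<Omega>: "open \<Omega>"
  shows "psh_on \<Omega> (\<lambda>z. INF t\<in>{0<..<1}. v (z, of_real (exp t)) - ereal (C * t))" (is "psh_on _ ?p")
  unfolding psh_on_def
proof (rule psh_wrtI[OF _ _ continuous_on_complex_line])
  let ?G = "\<Omega> \<times> annulus"
  have usc: "usc_on ?G v" and fin: "\<And>x. x \<in> ?G \<Longrightarrow> v x < \<infinity>"
    using v by (auto simp: psh_on_prod_def psh_wrt_def)
  have minus: "x - ereal y = x + ereal (- y)" for x y by (simp add: minus_ereal_def)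
  have less_iff: "x + ereal (- C * s) < ereal t \<longleftrightarrow> x < ereal (t + C * s)" for x s t
    by (cases x) auto
  show "usc_on \<Omega> ?p"
    unfolding usc_on_def
  proof
    fix A
    have "usc_on \<Omega> (\<lambda>z. v (z, of_real (exp t)) + ereal (- C * t))" if "t \<in> {0<..<1}" for t
      by (intro usc_on_add_continuous usc_on_compose[OF usc]) (use that in \<open>auto intro!: continuous_intros\<close>)
    then have "openin (top_of_set \<Omega>) (\<Union>t\<in>{0<..<1}. {z \<in> \<Omega>. v (z, of_real (exp t)) + ereal (- C * t) < A})"
      unfolding usc_on_def by (intro openin_Union) auto
    moreover have "(\<Union>t\<in>{0<..<1}. {z \<in> \<Omega>. v (z, of_real (exp t)) + ereal (- C * t) < A}) = {z \<in> \<Omega>. ?p z < A}"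
      by (auto simp: INF_less_iff minus)
    ultimately show "openin (top_of_set \<Omega>) {z \<in> \<Omega>. ?p z < A}" by simp
  qed
  show "?p z < \<infinity>" if "z \<in> \<Omega>" for z
  proof -
    have "(z, of_real (exp (1/2))) \<in> ?G" using that by simp
    then have "v (z, of_real (exp (1/2))) - ereal (C * (1/2)) < \<infinity>"
      using fin by (cases "v (z, of_real (exp (1/2)))") force+
    then show ?thesis unfolding INF_less_iff by (intro bexI[of _ "1/2"]) auto
  qed
  fix a b :: "complex ^ 'n" and c r H
  assume *: "a \<in> \<Omega>" "r > 0" "\<And>k. k \<in> cball c r \<Longrightarrow> a + k *s b \<in> \<Omega>" "H holomorphic_on UNIV"
    and less: "\<And>k. k \<in> sphere c r \<Longrightarrow> ?p (a + k *s b) < ereal (Re (H k))"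
  let ?g = "\<lambda>q. (a + fst q *s b, complex_of_real (exp (snd q)))"
  define V where "V = {q \<in> sphere c r \<times> {0<..<1}. v (?g q) + ereal (- C * snd q - Re (H (fst q))) < 0}"
  let ?v = "\<lambda>k t. v (a + k *s b, complex_of_real (exp t))"
  have Viff: "(k, t) \<in> V \<longleftrightarrow> k \<in> sphere c r \<and> 0 < t \<and> t < 1 \<and> ?v k t < ereal (Re (H k) + C * t)" for k t
    unfolding V_def by (cases "?v k t") auto
  have line: "continuous_on S (\<lambda>k. a + k *s b)" for S
    using continuous_on_complex_line continuous_on_subset by blast
  have cg: "continuous_on S ?g" for S
    by (intro continuous_intros continuous_on_compose2[OF line]) auto
  have cH: "continuous_on S H" for S
    using *(4) by (auto intro: holomorphic_on_imp_continuous_on holomorphic_on_subset)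
  have "usc_on (sphere c r \<times> {0<..<1}) (\<lambda>q. v (?g q) + ereal (- C * snd q - Re (H (fst q))))"
    by (intro usc_on_add_continuous usc_on_compose[OF usc cg] continuous_intros continuous_on_compose2[OF cH])
      (use *(3) in auto)
  then have "openin (top_of_set (sphere c r \<times> {0<..<1})) V" by (simp add: usc_on_def V_def)
  moreover have "openin (top_of_set (sphere c r \<times> UNIV)) (sphere c r \<times> {0<..<1::real})"
    by (intro openin_Times) (auto simp: open_openin[symmetric])
  ultimately have opV: "openin (top_of_set (sphere c r \<times> UNIV)) V" by (rule openin_trans)
  have ne: "\<exists>t. (k, t) \<in> V" if k: "k \<in> sphere c r" for k
  proof -
    obtain t where t: "t \<in> {0<..<1}" "?v k t - ereal (C * t) < ereal (Re (H k))"
      using less[OF k] unfolding INF_less_iff by blast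
    then have "?v k t < ereal (Re (H k) + C * t)"
      by (cases "?v k t") auto
    then show ?thesis using t(1) k by (auto simp: Viff)
  qed
  have conv: "convex {t. (k, t) \<in> V}" if k: "k \<in> sphere c r" for k
  proof -
    have kG: "a + k *s b \<in> \<Omega>" using *(3) k by auto
    have "t \<in> {t. (k, t) \<in> V}" if t: "(k, t1) \<in> V" "(k, t2) \<in> V" "t1 \<le> t" "t \<le> t2" for t1 t2 t
    proof -
      obtain e where e: "e > 0" "?v k t1 \<le> ereal (Re (H k) - e + C * t1)"
        "?v k t2 \<le> ereal (Re (H k) - e + C * t2)"
      proof -
        have "\<exists>e>0. ?v k s \<le> ereal (Re (H k) + C * s - e)" if ks: "(k, s) \<in> V" for s
        proof -
          obtain B where "?v k s < ereal B" "ereal B < ereal (Re (H k) + C * s)"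
            using ks ereal_dense2 unfolding Viff by blast
          then show ?thesis by (intro exI[of _ "Re (H k) + C * s - B"]) auto
        qed
        then obtain e1 e2 where e12: "e1 > 0" "e2 > 0"
          "?v k t1 \<le> ereal (Re (H k) + C * t1 - e1)"
          "?v k t2 \<le> ereal (Re (H k) + C * t2 - e2)"
          using t by blast
        show ?thesis
        proof (rule that[of "min e1 e2"])
          show "?v k t1 \<le> ereal (Re (H k) - min e1 e2 + C * t1)"
            using e12(3) by (rule order_trans) simp
          show "?v k t2 \<le> ereal (Re (H k) - min e1 e2 + C * t2)"
            using e12(4) by (rule order_trans) simp
        qed (use e12 in simp)
      qed
      have "?v k t \<le> ereal (Re (H k) - e + C * t)"
        by (rule psh_on_prod_radially_convex[OF v rot kG _ t(3,4) _ e(2,3)]) (use t in \<open>auto simp: Viff\<close>)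
      also have "\<dots> < ereal (Re (H k) + C * t)" using e(1) by simp
      finally show ?thesis using t k by (auto simp: Viff)
    qed
    then have "is_interval {t. (k, t) \<in> V}" unfolding is_interval_1 by blast
    then show ?thesis by (rule is_interval_convex)
  qed
  obtain \<tau> e where \<tau>: "continuous_on (sphere c r) \<tau>" "e > 0"
    "\<And>k t. k \<in> sphere c r \<Longrightarrow> \<bar>t - \<tau> k\<bar> < e \<Longrightarrow> (k, t) \<in> V"
    using robust_convex_selection[OF compact_sphere opV ne conv] by metis
  obtain f where f: "f holomorphic_on UNIV" "\<And>k. k \<in> sphere c r \<Longrightarrow> \<bar>Re (f k) - \<tau> k\<bar> < e"
    using Re_entire_approx_on_sphere[OF *(2) \<tau>(1,2)] by blast
  have fV: "(k, Re (f k)) \<in> V" if "k \<in> sphere c r" for k using \<tau>(3) f(2) that by blast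
  have f01: "0 < Re (f k)" "Re (f k) < 1" if k: "k \<in> cball c r" for k
  proof -
    show "Re (f k) < 1" by (rule Re_less_on_cball[OF f(1) *(2) _ k]) (use fV Viff in blast)
    have "Re (- f k) < 0"
      by (rule Re_less_on_cball[of "\<lambda>k. - f k", OF _ *(2) _ k]) (use fV Viff f(1) in \<open>auto intro: holomorphic_intros\<close>)
    then show "0 < Re (f k)" by simp
  qed
  have vf: "v (z, exp (f k)) = v (z, of_real (exp (Re (f k))))" for z k
    by (rule rotation_invariantD[OF rot]) simp
  have "v (a + c *s b, exp (f c)) \<le> ereal (Re (H c + of_real C * f c))"
  proof (rule psh_on_prod_le_on_graph[OF v \<Omega> open_annulus *(2,3)])
    show "(\<lambda>k. exp (f k)) holomorphic_on UNIV" "(\<lambda>k. H k + of_real C * f k) holomorphic_on UNIV"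
      by (intro holomorphic_intros f(1) *(4))+
    show "exp (f k) \<in> annulus" if "k \<in> cball c r" for k using f01[OF that] by (simp add: annulus_def)
    show "v (a + k *s b, exp (f k)) < ereal (Re (H k + of_real C * f k))" if "k \<in> sphere c r" for k
      using fV[OF that] by (simp add: Viff vf)
  qed
  then have "v (a + c *s b, of_real (exp (Re (f c)))) - ereal (C * Re (f c)) \<le> ereal (Re (H c))"
    unfolding vf by (cases "v (a + c *s b, of_real (exp (Re (f c))))") auto
  moreover have "Re (f c) \<in> {0<..<1}" using f01[of c] *(2) by simp
  ultimately show "?p (a + c *s b) \<le> ereal (Re (H c))" by (meson INF_lower2)
qed

section \<open>The Legendre duality in the interior\<close>

text \<open>A convex function on an open interval has a supporting line at each point where it is finite. The case distinction is
between functions with finite values and those that are \<open>-\<infinity>\<close> on the whole interval: a value \<open>-\<infinity>\<close>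
at \<open>s\<close> and a finite bound on the other side of \<open>t\<close> force \<open>g t = -\<infinity>\<close>.\<close>

lemma ereal_convex_le_SUP_affine:
  fixes g :: "real \<Rightarrow> ereal"
  assumes t: "t \<in> {0<..<1}" and fin: "\<And>s. s \<in> {0<..<1} \<Longrightarrow> g s < \<infinity>"
    and conv: "\<And>\<alpha> \<beta> r s x. 0 < r \<Longrightarrow> r \<le> s \<Longrightarrow> s \<le> x \<Longrightarrow> x < 1 \<Longrightarrow>
      g r \<le> ereal (\<alpha> + \<beta> * r) \<Longrightarrow> g x \<le> ereal (\<alpha> + \<beta> * x) \<Longrightarrow> g s \<le> ereal (\<alpha> + \<beta> * s)"
  shows "g t \<le> (SUP C. (INF s\<in>{0<..<1}. g s - ereal (C * s)) + ereal (C * t))"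
proof (cases "g t = -\<infinity>")
  case False
  then obtain y where y: "g t = ereal y" using fin[OF t] by (cases "g t") auto
  have conv': "g s \<le> ereal (\<alpha> + \<beta> * s)"
    if "r \<in> {0<..<1}" "x \<in> {0<..<1}" "r \<le> s \<and> s \<le> x \<or> x \<le> s \<and> s \<le> r"
      "g r \<le> ereal (\<alpha> + \<beta> * r)" "g x \<le> ereal (\<alpha> + \<beta> * x)" for r s x \<alpha> \<beta>
    using that(3)
  proof
    assume "r \<le> s \<and> s \<le> x" then show ?thesis using that by (intro conv[of r s x]) auto
  next
    assume "x \<le> s \<and> s \<le> r" then show ?thesis using that by (intro conv[of x s r]) auto
  qed
  have real: "\<exists>a. g s = ereal a" if s: "s \<in> {0<..<1}" for s
  proof (cases "g s")
    case MInf
    \<comment> \<open>a point such that \<open>t\<close> lies between it and \<open>s\<close>\<close>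
    define x where "x = (if s < t then (t + 1) / 2 else t / 2)"
    have x: "x \<in> {0<..<1}" "x \<noteq> t" "s \<le> t \<and> t \<le> x \<or> x \<le> t \<and> t \<le> s"
      using t s by (auto simp: x_def)
    obtain b where b: "g x \<le> ereal b" using fin[OF x(1)] by (cases "g x") auto
    define \<beta> where "\<beta> = (b - (y - 1)) / (x - t)"
    have "g t \<le> ereal ((y - 1 - \<beta> * t) + \<beta> * t)"
    proof (rule conv'[OF s x(1,3)])
      have "(y - 1 - \<beta> * t) + \<beta> * x = (y - 1) + \<beta> * (x - t)" by (simp add: algebra_simps)
      also have "\<dots> = b" using x(2) by (simp add: \<beta>_def)
      finally show "g x \<le> ereal ((y - 1 - \<beta> * t) + \<beta> * x)" using b by simp
    qed (simp add: MInf)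
    then show ?thesis using y by simp
  qed (use fin[OF s] in auto)
  define G where "G s = real_of_ereal (g s)" for s
  have gG: "g s = ereal (G s)" if "s \<in> {0<..<1}" for s using real[OF that] by (auto simp: G_def)
  have "convex_on {0<..<1} G"
  proof (rule convex_on_linorderI)
    fix l r x :: real
    assume *: "0 < l" "l < 1" "r \<in> {0<..<1}" "x \<in> {0<..<1}" "r < x"
    define \<beta> where "\<beta> = (G x - G r) / (x - r)"
    have \<beta>: "\<beta> * (x - r) = G x - G r" using *(5) by (simp add: \<beta>_def)
    define s where "s = (1 - l) *\<^sub>R r + l *\<^sub>R x"
    have s_eq: "s = r + l * (x - r)" by (simp add: s_def algebra_simps)
    have s: "r \<le> s" "s \<le> x"
    proof -
      have "0 \<le> l * (x - r)" "l * (x - r) \<le> 1 * (x - r)"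
        using * by (intro mult_nonneg_nonneg mult_right_mono; simp)+
      then show "r \<le> s" "s \<le> x" by (simp_all add: s_eq)
    qed
    have "g s \<le> ereal ((G r - \<beta> * r) + \<beta> * s)"
      using * s \<beta> by (intro conv[of r s x]) (auto simp: gG algebra_simps)
    then have "G s \<le> G r + \<beta> * (s - r)" using * s by (subst (asm) gG) (auto simp: algebra_simps)
    also have "\<beta> * (s - r) = l * (\<beta> * (x - r))" by (simp add: s_eq)
    also have "\<dots> = l * (G x - G r)" by (simp only: \<beta>)
    finally show "G ((1 - l) *\<^sub>R r + l *\<^sub>R x) \<le> (1 - l) * G r + l * G x"
      by (simp add: s_def algebra_simps)
  qed simp
  then obtain C where C: "\<And>s. s \<in> {0<..<1} \<Longrightarrow> G s \<ge> G t + C * (s - t)"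
    using convex_le_Inf_differential[of "{0<..<1}" G t] t by (metis interior_open open_greaterThanLessThan)
  have "ereal (G t - C * t) \<le> (INF s\<in>{0<..<1}. g s - ereal (C * s))"
  proof (rule INF_greatest)
    fix s :: real assume s: "s \<in> {0<..<1}"
    show "ereal (G t - C * t) \<le> g s - ereal (C * s)" using C[OF s] by (simp add: gG[OF s] algebra_simps)
  qed
  then have "ereal (G t - C * t) + ereal (C * t) \<le> (INF s\<in>{0<..<1}. g s - ereal (C * s)) + ereal (C * t)"
    by (rule add_right_mono)
  then have "g t \<le> (INF s\<in>{0<..<1}. g s - ereal (C * s)) + ereal (C * t)" by (simp add: gG[OF t])
  also have "\<dots> \<le> (SUP C. (INF s\<in>{0<..<1}. g s - ereal (C * s)) + ereal (C * t))"
    by (rule SUP_upper2[of C]) auto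
  finally show ?thesis .
qed simp

text \<open>The properties of \<open>C \<mapsto> P^C(z)\<close> from which the second formula follows. They hold at interior points with
\<open>A = u_0(z)\<close> and \<open>B = u_1(z)\<close>, and they hold for \<open>C \<mapsto> min A (B - C)\<close>, which takes over on the boundary.
The two monotonicity conditions say that the slopes lie between \<open>-1\<close> and \<open>0\<close>.\<close>

definition rooftop_profile :: "real \<Rightarrow> real \<Rightarrow> (real \<Rightarrow> real) \<Rightarrow> bool" where
  "rooftop_profile A B q \<longleftrightarrow> convex_on UNIV (\<lambda>C. - q C) \<and> antimono q \<and> mono (\<lambda>C. q C + C) \<and>
     (\<forall>C. q C \<le> A \<and> q C \<le> B - C)"

text \<open>A supporting line of the concave function \<open>q\<close> at \<open>C\<close> has slope \<open>-m\<close> with \<open>0 \<le> m \<le> 1\<close>,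
and the infimum is attained at \<open>t = m\<close> if \<open>m\<close> is in the open interval. If \<open>m\<close> is \<open>0\<close> or \<open>1\<close>,
the infimum is approached as \<open>t\<close> tends to \<open>m\<close>: the supporting line takes care of bounded \<open>D - C\<close>, and the
bounds \<open>A\<close> and \<open>B - D\<close> of the large ones.\<close>

lemma rooftop_profile_conjugate:
  assumes q: "rooftop_profile A B q"
  shows "ereal (q C) = (INF t\<in>{0<..<1}. (SUP D. ereal (q D + D * t)) - ereal (C * t))"
proof (rule antisym)
  have anti: "q E \<le> q D" and lip: "q D + D \<le> q E + E" if "D \<le> E" for D E
    using q that unfolding rooftop_profile_def by (auto dest: antimonoD monoD)
  have A: "q D \<le> A" and B: "q D \<le> B - D" for D using q unfolding rooftop_profile_def by auto
  show "ereal (q C) \<le> (INF t\<in>{0<..<1}. (SUP D. ereal (q D + D * t)) - ereal (C * t))"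
  proof (rule INF_greatest)
    fix t :: real
    have "ereal (q C + C * t) \<le> (SUP D. ereal (q D + D * t))" by (rule SUP_upper) simp
    then have "ereal (q C + C * t) - ereal (C * t) \<le> (SUP D. ereal (q D + D * t)) - ereal (C * t)"
      by (rule ereal_minus_mono) simp
    then show "ereal (q C) \<le> (SUP D. ereal (q D + D * t)) - ereal (C * t)" by simp
  qed
  obtain m where m: "\<And>D. - q D \<ge> - q C + m * (D - C)"
    using convex_le_Inf_differential[of UNIV "\<lambda>C. - q C" C] q unfolding rooftop_profile_def by auto
  have m01: "0 \<le> m" "m \<le> 1"
    using m[of "C - 1"] anti[of "C - 1" C] m[of "C + 1"] lip[of C "C + 1"] by auto
  show "(INF t\<in>{0<..<1}. (SUP D. ereal (q D + D * t)) - ereal (C * t)) \<le> ereal (q C)"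
  proof (rule ereal_le_epsilon2)
    fix e :: real assume e: "e > 0"
    define b a where "b = max 0 (B - C - q C)" and "a = max 0 (A - q C)"
    have ab: "b \<ge> 0" "b \<ge> B - C - q C" "a \<ge> 0" "a \<ge> A - q C" by (simp_all add: b_def a_def)
    define R where "R = 1 + 2 * b + 2 * a"
    have R: "R \<ge> 1" "R \<ge> 2 * (B - C - q C)" "R \<ge> 2 * (A - q C)"
      unfolding R_def using ab by (simp_all add: algebra_simps)
    define h where "h = min (1/2) (e / R)"
    have h: "h > 0" "h \<le> 1/2" "R * h \<le> e"
    proof -
      show "h > 0" using e R by (simp add: h_def)
      show "h \<le> 1/2" unfolding h_def by (rule min.cobounded1)
      have "R * h \<le> R * (e / R)" using R by (intro mult_left_mono) (auto simp: h_def)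
      then show "R * h \<le> e" using R by simp
    qed
    obtain t where t: "t \<in> {0<..<1}" and le: "\<And>D. q D + (D - C) * t \<le> q C + e"
    proof (cases "m = 0 \<or> m = 1")
      case False
      then show ?thesis
      proof (intro that[of m])
        show "q D + (D - C) * m \<le> q C + e" for D using m[of D] e by (simp add: algebra_simps)
      qed (use m01 in auto)
    next
      case True
      then consider "m = 0" | "m = 1" by blast
      then show ?thesis
      proof cases
        case 1
        show ?thesis
        proof (rule that[of h])
          fix D
          have qD: "q D \<le> q C" using m[of D] 1 by simp
          consider "D \<le> C" | "C \<le> D" "D - C \<le> R" | "R \<le> D - C" by linarith
          then show "q D + (D - C) * h \<le> q C + e"
          proof cases
            case 1
            then have "(D - C) * h \<le> 0" using h by (intro mult_nonpos_nonneg) auto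
            then show ?thesis using qD e by linarith
          next
            case 2
            then have "(D - C) * h \<le> R * h" using h by (intro mult_right_mono) auto
            then show ?thesis using qD h by linarith
          next
            case 3
            then have "(D - C) * h \<le> (D - C) * (1/2)" using h R by (intro mult_left_mono) auto
            moreover have "q D \<le> B - D" by (rule B)
            ultimately show ?thesis using 3 R e by (simp add: field_simps)
          qed
        qed (use h in auto)
      next
        case 2
        show ?thesis
        proof (rule that[of "1 - h"])
          fix D
          have qD: "q D + D \<le> q C + C" using m[of D] 2 by simp
          have eq: "(D - C) * (1 - h) = D - C + (C - D) * h" by (simp add: algebra_simps)
          consider "C \<le> D" | "D \<le> C" "C - D \<le> R" | "R \<le> C - D" by linarith
          then show "q D + (D - C) * (1 - h) \<le> q C + e"
          proof cases
            case 1
            then have "(C - D) * h \<le> 0" using h by (intro mult_nonpos_nonneg) auto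
            then show ?thesis using qD e eq by linarith
          next
            case 2
            then have "(C - D) * h \<le> R * h" using h by (intro mult_right_mono) auto
            then show ?thesis using qD h eq by linarith
          next
            case 3
            then have "(C - D) * h \<le> (C - D) * (1/2)" using h R by (intro mult_left_mono) auto
            moreover have "q D \<le> A" by (rule A)
            ultimately show ?thesis using 3 R e eq by (simp add: field_simps)
          qed
        qed (use h in auto)
      qed
    qed
    have "(SUP D. ereal (q D + D * t)) \<le> ereal (q C + e + C * t)"
    proof (rule SUP_least)
      fix D show "ereal (q D + D * t) \<le> ereal (q C + e + C * t)" using le[of D] by (simp add: algebra_simps)
    qed
    then have "(SUP D. ereal (q D + D * t)) - ereal (C * t) \<le> ereal (q C + e + C * t) - ereal (C * t)"
      by (rule ereal_minus_mono) simp
    then have "(SUP D. ereal (q D + D * t)) - ereal (C * t) \<le> ereal (q C) + ereal e" by simp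
    then show "(INF t\<in>{0<..<1}. (SUP D. ereal (q D + D * t)) - ereal (C * t)) \<le> ereal (q C) + ereal e"
      using t by (meson INF_lower2)
  qed
qed

lemma Limsup_going_to_le_iff:
  fixes f :: "complex \<Rightarrow> ereal"
  shows "Limsup ((\<lambda>\<zeta>. ln (norm \<zeta>)) going_to nhds j within annulus) f \<le> ereal x \<longleftrightarrow>
    (\<forall>e>0. \<exists>d>0. \<forall>\<zeta>\<in>annulus. \<bar>ln (norm \<zeta>) - j\<bar> < d \<longrightarrow> f \<zeta> < ereal (x + e))" (is "?l \<longleftrightarrow> ?r")
proof -
  have ev: "eventually P ((\<lambda>\<zeta>::complex. ln (norm \<zeta>)) going_to nhds j within annulus) \<longleftrightarrow>
    (\<exists>d>0. \<forall>\<zeta>\<in>annulus. \<bar>ln (norm \<zeta>) - j\<bar> < d \<longrightarrow> P \<zeta>)" (is "?a \<longleftrightarrow> ?b") for P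
  proof
    assume ?a
    then obtain Q where Q: "eventually Q (nhds j)" "\<And>\<zeta>. Q (ln (norm \<zeta>)) \<Longrightarrow> \<zeta> \<in> annulus \<Longrightarrow> P \<zeta>"
      by (auto simp: going_to_within_def eventually_inf_principal eventually_filtercomap)
    then show ?b by (auto simp: eventually_nhds_metric dist_real_def)
  next
    assume ?b
    then obtain d where d: "d > 0" "\<And>\<zeta>. \<zeta> \<in> annulus \<Longrightarrow> \<bar>ln (norm \<zeta>) - j\<bar> < d \<Longrightarrow> P \<zeta>" by blast
    have "eventually (\<lambda>y. \<bar>y - j\<bar> < d) (nhds j)"
      unfolding eventually_nhds_metric using d(1) by (auto simp: dist_real_def)
    then show ?a using d(2)
      by (auto simp: going_to_within_def eventually_inf_principal eventually_filtercomap
          intro!: exI[of _ "\<lambda>y. \<bar>y - j\<bar> < d"])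
  qed
  show ?thesis unfolding Limsup_le_iff ev
  proof (intro iffI allI impI)
    fix e :: real
    assume "\<forall>y>ereal x. \<exists>d>0. \<forall>\<zeta>\<in>annulus. \<bar>ln (norm \<zeta>) - j\<bar> < d \<longrightarrow> f \<zeta> < y" "e > 0"
    then show "\<exists>d>0. \<forall>\<zeta>\<in>annulus. \<bar>ln (norm \<zeta>) - j\<bar> < d \<longrightarrow> f \<zeta> < ereal (x + e)" by simp
  next
    fix y assume r: ?r and "y > ereal x"
    then obtain b where b: "ereal x < ereal b" "ereal b < y" using ereal_dense2 by blast
    then obtain d where "d > 0" "\<forall>\<zeta>\<in>annulus. \<bar>ln (norm \<zeta>) - j\<bar> < d \<longrightarrow> f \<zeta> < ereal (x + (b - x))"
      using r[rule_format, of "b - x"] by auto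
    then show "\<exists>d>0. \<forall>\<zeta>\<in>annulus. \<bar>ln (norm \<zeta>) - j\<bar> < d \<longrightarrow> f \<zeta> < y"
      using b(2) by (intro exI[of _ d]) (auto intro: less_trans)
  qed
qed

abbreviation W_real :: "(complex ^ 'n) set \<Rightarrow> (complex ^ 'n \<Rightarrow> real) \<Rightarrow> (complex ^ 'n \<Rightarrow> real) \<Rightarrow>
   ((complex ^ 'n) \<times> complex \<Rightarrow> ereal) set" where
  "W_real \<Omega> u0 u1 \<equiv> W_class \<Omega> (\<lambda>z. ereal (u0 z)) (\<lambda>z. ereal (u1 z))"

abbreviation rooftop_real :: "(complex ^ 'n) set \<Rightarrow> (complex ^ 'n \<Rightarrow> real) \<Rightarrow> (complex ^ 'n \<Rightarrow> real) \<Rightarrow>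
   real \<Rightarrow> complex ^ 'n \<Rightarrow> ereal" where
  "rooftop_real \<Omega> u0 u1 C \<equiv> rooftop \<Omega> (\<lambda>z. ereal (u0 z)) (\<lambda>z. ereal (u1 z - C))"

abbreviation geodesic_real :: "(complex ^ 'n) set \<Rightarrow> (complex ^ 'n \<Rightarrow> real) \<Rightarrow> (complex ^ 'n \<Rightarrow> real) \<Rightarrow>
   real \<Rightarrow> complex ^ 'n \<Rightarrow> ereal" where
  "geodesic_real \<Omega> u0 u1 \<equiv> geodesic \<Omega> (\<lambda>z. ereal (u0 z)) (\<lambda>z. ereal (u1 z))"

lemma mem_W_iff:
  "v \<in> W_real \<Omega> u0 u1 \<longleftrightarrow> psh_on_prod (\<Omega> \<times> annulus) v \<and>
    (\<forall>z\<in>\<Omega>. \<forall>e>0. \<exists>d>0. \<forall>\<zeta>\<in>annulus. \<bar>ln (norm \<zeta>)\<bar> < d \<longrightarrow> v (z, \<zeta>) < ereal (u0 z + e)) \<and>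
    (\<forall>z\<in>\<Omega>. \<forall>e>0. \<exists>d>0. \<forall>\<zeta>\<in>annulus. \<bar>ln (norm \<zeta>) - 1\<bar> < d \<longrightarrow> v (z, \<zeta>) < ereal (u1 z + e))"
  unfolding W_class_def mem_Collect_eq Limsup_going_to_le_iff ball_conj_distrib diff_0_right ..

lemma affine_mem_W:
  assumes w: "psh_on \<Omega> w" and le: "\<And>x. x \<in> \<Omega> \<Longrightarrow> w x \<le> min (ereal (u0 x)) (ereal (u1 x - C))"
  shows "(\<lambda>(z, \<zeta>). w z + ereal (C * ln (norm \<zeta>))) \<in> W_real \<Omega> u0 u1"
  unfolding mem_W_iff
proof (intro conjI ballI allI impI)
  show "psh_on_prod (\<Omega> \<times> annulus) (\<lambda>(z, \<zeta>). w z + ereal (C * ln (norm \<zeta>)))"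
    by (rule psh_on_prod_add_log[OF w])
  fix z and e :: real assume z: "z \<in> \<Omega>" and e: "e > 0"
  define d where "d = e / (\<bar>C\<bar> + 1)"
  have d: "d > 0" using e by (simp add: d_def add_nonneg_pos)
  have small: "C * x < e" if "\<bar>x\<bar> < d" for x
  proof -
    have "C * x \<le> \<bar>C\<bar> * \<bar>x\<bar>" by (metis abs_ge_self abs_mult)
    also have "\<dots> \<le> (\<bar>C\<bar> + 1) * \<bar>x\<bar>" by (intro mult_right_mono) auto
    also have "\<dots> < (\<bar>C\<bar> + 1) * d" using that by (intro mult_strict_left_mono) auto
    also have "\<dots> = e" by (simp add: d_def)
    finally show ?thesis .
  qed
  show "\<exists>d>0. \<forall>\<zeta>\<in>annulus. \<bar>ln (norm \<zeta>)\<bar> < d \<longrightarrow>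
      (case (z, \<zeta>) of (z, \<zeta>) \<Rightarrow> w z + ereal (C * ln (norm \<zeta>))) < ereal (u0 z + e)"
  proof (intro exI[of _ d] conjI d ballI impI)
    fix \<zeta> :: complex assume "\<bar>ln (norm \<zeta>)\<bar> < d"
    then have "C * ln (norm \<zeta>) < e" by (rule small)
    then show "(case (z, \<zeta>) of (z, \<zeta>) \<Rightarrow> w z + ereal (C * ln (norm \<zeta>))) < ereal (u0 z + e)"
      using le[OF z] by (cases "w z") auto
  qed
  show "\<exists>d>0. \<forall>\<zeta>\<in>annulus. \<bar>ln (norm \<zeta>) - 1\<bar> < d \<longrightarrow>
      (case (z, \<zeta>) of (z, \<zeta>) \<Rightarrow> w z + ereal (C * ln (norm \<zeta>))) < ereal (u1 z + e)"
  proof (intro exI[of _ d] conjI d ballI impI)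
    fix \<zeta> :: complex assume "\<bar>ln (norm \<zeta>) - 1\<bar> < d"
    then have "C * (ln (norm \<zeta>) - 1) < e" by (rule small)
    then show "(case (z, \<zeta>) of (z, \<zeta>) \<Rightarrow> w z + ereal (C * ln (norm \<zeta>))) < ereal (u1 z + e)"
      using le[OF z] by (cases "w z") (auto simp: algebra_simps)
  qed
qed

lemma max_mem_W:
  assumes "v \<in> W_real \<Omega> u0 u1" "v' \<in> W_real \<Omega> u0 u1"
  shows "(\<lambda>p. max (v p) (v' p)) \<in> W_real \<Omega> u0 u1"
proof -
  have m: "\<exists>d>0. \<forall>\<zeta>\<in>annulus. \<bar>ln (norm \<zeta>) - j\<bar> < d \<longrightarrow> max (v (z, \<zeta>)) (v' (z, \<zeta>)) < x"
    if *: "\<exists>d>0. \<forall>\<zeta>\<in>annulus. \<bar>ln (norm \<zeta>) - j\<bar> < d \<longrightarrow> v (z, \<zeta>) < x"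
      "\<exists>d>0. \<forall>\<zeta>\<in>annulus. \<bar>ln (norm \<zeta>) - j\<bar> < d \<longrightarrow> v' (z, \<zeta>) < x" for j z x
  proof -
    obtain d d' where "d > 0" "d' > 0" "\<forall>\<zeta>\<in>annulus. \<bar>ln (norm \<zeta>) - j\<bar> < d \<longrightarrow> v (z, \<zeta>) < x"
      "\<forall>\<zeta>\<in>annulus. \<bar>ln (norm \<zeta>) - j\<bar> < d' \<longrightarrow> v' (z, \<zeta>) < x" using * by blast
    then show ?thesis by (intro exI[of _ "min d d'"]) auto
  qed
  have "psh_on_prod (\<Omega> \<times> annulus) (\<lambda>p. max (v p) (v' p))"
    using assms unfolding mem_W_iff psh_on_prod_def
    by (intro psh_wrt_max continuous_on_complex_line_prod) auto
  then show ?thesis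
    using assms m[of 0] m[of 1] unfolding mem_W_iff by simp
qed

lemma rotation_sup_mem_W:
  assumes v: "v \<in> W_real \<Omega> u0 u1"
  shows "(\<lambda>(z, \<zeta>). SUP c\<in>sphere 0 1. v (z, c * \<zeta>)) \<in> W_real \<Omega> u0 u1"
proof -
  have m: "\<exists>d>0. \<forall>\<zeta>\<in>annulus. \<bar>ln (norm \<zeta>) - j\<bar> < d \<longrightarrow> (SUP c\<in>sphere 0 1. v (z, c * \<zeta>)) < ereal (x + e)"
    if e: "e > 0" and *: "\<forall>e>0. \<exists>d>0. \<forall>\<zeta>\<in>annulus. \<bar>ln (norm \<zeta>) - j\<bar> < d \<longrightarrow> v (z, \<zeta>) < ereal (x + e)" for j z x e
  proof -
    obtain d where d: "d > 0" "\<And>\<zeta>. \<zeta> \<in> annulus \<Longrightarrow> \<bar>ln (norm \<zeta>) - j\<bar> < d \<Longrightarrow> v (z, \<zeta>) < ereal (x + e/2)"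
      using *[rule_format, of "e/2"] e by auto
    have "(SUP c\<in>sphere 0 1. v (z, c * \<zeta>)) < ereal (x + e)" if \<zeta>: "\<zeta> \<in> annulus" "\<bar>ln (norm \<zeta>) - j\<bar> < d" for \<zeta>
    proof -
      have "(SUP c\<in>sphere 0 1. v (z, c * \<zeta>)) \<le> ereal (x + e/2)"
      proof (rule SUP_least)
        fix c :: complex assume "c \<in> sphere 0 1"
        then have "norm (c * \<zeta>) = norm \<zeta>" by (simp add: norm_mult)
        then show "v (z, c * \<zeta>) \<le> ereal (x + e/2)" using \<zeta> by (intro less_imp_le d(2)) (auto simp: annulus_def)
      qed
      also have "\<dots> < ereal (x + e)" using e by simp
      finally show ?thesis .
    qed
    then show ?thesis using d(1) by blast
  qed
  have "psh_on_prod (\<Omega> \<times> annulus) (\<lambda>(z, \<zeta>). SUP c\<in>sphere 0 1. v (z, c * \<zeta>))"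
    using v unfolding mem_W_iff by (intro psh_on_prod_rotation_sup) simp
  then show ?thesis
    using v m[of _ 0] m[of _ 1] unfolding mem_W_iff by simp
qed

lemma rotation_invariant_rotation_sup:
  "rotation_invariant (\<lambda>(z, \<zeta>). SUP c\<in>sphere 0 1. v (z, c * \<zeta>))"
proof -
  have "(\<lambda>c. v (z, c * \<zeta>)) ` sphere 0 1 = (\<lambda>c. v (z, c * of_real (norm \<zeta>))) ` sphere 0 1" for z \<zeta>
  proof (cases "\<zeta> = 0")
    case False
    define s where "s = \<zeta> / of_real (norm \<zeta>)"
    have s: "norm s = 1" "\<zeta> = s * of_real (norm \<zeta>)" using False by (auto simp: s_def norm_divide)
    have s0: "s \<noteq> 0" using s(1) by auto
    have "(\<lambda>c. v (z, c * \<zeta>)) ` sphere 0 1 = (\<lambda>c. v (z, c * of_real (norm \<zeta>))) ` ((\<lambda>c. c * s) ` sphere 0 1)"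
      by (subst s(2)) (simp add: image_image mult.assoc)
    also have "(\<lambda>c. c * s) ` sphere 0 1 = sphere 0 1"
    proof (intro set_eqI iffI)
      fix c assume "c \<in> sphere (0::complex) 1"
      then show "c \<in> (\<lambda>c. c * s) ` sphere 0 1"
        using s s0 by (intro image_eqI[of _ _ "c / s"]) (auto simp: norm_divide)
    qed (use s in \<open>auto simp: norm_mult\<close>)
    finally show ?thesis .
  qed simp
  then show ?thesis unfolding rotation_invariant_def by simp
qed

text \<open>The partial infimum is psh by the minimum principle. It is below \<open>u_0\<close> and \<open>u_1 - C\<close>, as one sees by letting
\<open>t\<close> tend to the end points of the interval.\<close>

lemma partial_infimum_le_rooftop:
  assumes v: "v \<in> W_real \<Omega> u0 u1" and rot: "rotation_invariant v" and \<Omega>: "open \<Omega>" and z: "z \<in> \<Omega>"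
  shows "(INF t\<in>{0<..<1}. v (z, of_real (exp t)) - ereal (C * t)) \<le> rooftop_real \<Omega> u0 u1 C z"
proof -
  let ?p = "\<lambda>z. INF t\<in>{0<..<1}. v (z, of_real (exp t)) - ereal (C * t)"
  have psh: "psh_on_prod (\<Omega> \<times> annulus) v" using v by (simp add: mem_W_iff)
  have le: "?p x \<le> ereal y" if s: "\<And>e. e > 0 \<Longrightarrow> \<exists>t\<in>{0<..<1}. v (x, of_real (exp t)) \<le> ereal (y + C * t + e)" for x y
  proof (rule ereal_le_epsilon2)
    fix e :: real assume "e > 0"
    then obtain t where t: "t \<in> {0<..<1}" "v (x, of_real (exp t)) \<le> ereal (y + C * t + e)" using s by blast
    have "v (x, of_real (exp t)) - ereal (C * t) \<le> ereal (y + C * t + e) - ereal (C * t)"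
      by (rule ereal_minus_mono[OF t(2)]) simp
    also have "\<dots> = ereal y + ereal e" by simp
    finally show "?p x \<le> ereal y + ereal e" using t(1) by (meson INF_lower2)
  qed
  have small: "\<bar>C * x\<bar> \<le> e / 2" if "\<bar>x\<bar> \<le> e / (2 * (\<bar>C\<bar> + 1))" "e > 0" for x e :: real
  proof -
    have "\<bar>C\<bar> * \<bar>x\<bar> \<le> (\<bar>C\<bar> + 1) * (e / (2 * (\<bar>C\<bar> + 1)))" using that by (intro mult_mono) auto
    also have "\<dots> = e / 2" by (simp add: field_simps) 
    finally show ?thesis by (simp add: abs_mult)
  qed
  have "?p x \<le> min (ereal (u0 x)) (ereal (u1 x - C))" if x: "x \<in> \<Omega>" for x
  proof (rule min.boundedI)
    show "?p x \<le> ereal (u0 x)"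
    proof (rule le)
      fix e :: real assume e: "e > 0"
      obtain d where d: "d > 0" "\<And>\<zeta>. \<zeta> \<in> annulus \<Longrightarrow> \<bar>ln (norm \<zeta>)\<bar> < d \<Longrightarrow> v (x, \<zeta>) < ereal (u0 x + e/2)"
        using v x e unfolding mem_W_iff by (metis half_gt_zero)
      define k where "k = e / (2 * (\<bar>C\<bar> + 1))"
      have k: "k > 0" using e by (simp add: k_def add_nonneg_pos)
      define t where "t = min (1/2) (min (d/2) k)"
      have t: "0 < t" "t < 1" "t < d" "t \<le> e / (2 * (\<bar>C\<bar> + 1))"
        unfolding k_def[symmetric] t_def using d(1) k by (simp_all add: min_def)
      have "v (x, of_real (exp t)) < ereal (u0 x + e/2)" using t by (intro d(2)) auto
      also have "\<dots> \<le> ereal (u0 x + C * t + e)" using small[of t e] t e by simp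
      finally show "\<exists>t\<in>{0<..<1}. v (x, of_real (exp t)) \<le> ereal (u0 x + C * t + e)"
        using t by (intro bexI[of _ t]) auto
    qed
    show "?p x \<le> ereal (u1 x - C)"
    proof (rule le)
      fix e :: real assume e: "e > 0"
      obtain d where d: "d > 0" "\<And>\<zeta>. \<zeta> \<in> annulus \<Longrightarrow> \<bar>ln (norm \<zeta>) - 1\<bar> < d \<Longrightarrow> v (x, \<zeta>) < ereal (u1 x + e/2)"
        using v x e unfolding mem_W_iff by (metis half_gt_zero)
      define k where "k = e / (2 * (\<bar>C\<bar> + 1))"
      have k: "k > 0" using e by (simp add: k_def add_nonneg_pos)
      define t where "t = 1 - min (1/2) (min (d/2) k)"
      have t: "0 < t" "t < 1" "1 - t < d" "1 - t \<le> e / (2 * (\<bar>C\<bar> + 1))"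
        unfolding k_def[symmetric] t_def using d(1) k by (simp_all add: min_def)
      have "v (x, of_real (exp t)) < ereal (u1 x + e/2)" using t by (intro d(2)) auto
      also have "\<dots> \<le> ereal (u1 x - C + C * t + e)"
      proof -
        have "\<bar>C * (1 - t)\<bar> \<le> e / 2" using t e by (intro small) auto
        then have "C * (1 - t) \<le> e / 2" by linarith
        then have "C - C * t \<le> e / 2" by (simp add: algebra_simps)
        then have "u1 x + e / 2 \<le> u1 x - C + C * t + e" by linarith
        then show ?thesis by simp
      qed
      finally show "\<exists>t\<in>{0<..<1}. v (x, of_real (exp t)) \<le> ereal (u1 x - C + C * t + e)"
        using t by (intro bexI[of _ t]) auto
    qed
  qed
  then have "?p \<in> {w. psh_on \<Omega> w \<and> (\<forall>x\<in>\<Omega>. w x \<le> min (ereal (u0 x)) (ereal (u1 x - C)))}"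
    using psh_on_partial_infimum[OF psh rot \<Omega>] by auto
  then show ?thesis unfolding rooftop_def by (rule SUP_upper)
qed

lemma rooftop_upper:
  assumes "psh_on \<Omega> w" "\<And>x. x \<in> \<Omega> \<Longrightarrow> w x \<le> min (u x) (v x)"
  shows "w z \<le> rooftop \<Omega> u v z"
  unfolding rooftop_def using assms by (intro SUP_upper) auto

lemma rooftop_least:
  assumes "\<And>w. psh_on \<Omega> w \<Longrightarrow> (\<And>x. x \<in> \<Omega> \<Longrightarrow> w x \<le> min (u x) (v x)) \<Longrightarrow> w z \<le> c"
  shows "rooftop \<Omega> u v z \<le> c"
  unfolding rooftop_def using assms by (intro SUP_least) auto

lemma geodesic_eq_SUP_rooftop:
  assumes \<Omega>: "open \<Omega>" and z: "z \<in> \<Omega>" and t: "t \<in> {0<..<1}"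
  shows "geodesic_real \<Omega> u0 u1 t z
    = (SUP C. rooftop_real \<Omega> u0 u1 C z + ereal (C * t))"
proof (rule antisym)
  show "(SUP C. rooftop_real \<Omega> u0 u1 C z + ereal (C * t)) \<le> geodesic_real \<Omega> u0 u1 t z"
  proof (rule SUP_least)
    fix C
    have "rooftop_real \<Omega> u0 u1 C z \<le> geodesic_real \<Omega> u0 u1 t z - ereal (C * t)"
    proof (rule rooftop_least)
      fix w assume "psh_on \<Omega> w" "\<And>x. x \<in> \<Omega> \<Longrightarrow> w x \<le> min (ereal (u0 x)) (ereal (u1 x - C))"
      from affine_mem_W[OF this]
      have "(case (z, complex_of_real (exp t)) of (z, \<zeta>) \<Rightarrow> w z + ereal (C * ln (norm \<zeta>)))
          \<le> geodesic_real \<Omega> u0 u1 t z"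
        unfolding geodesic_def envelope_def by (rule SUP_upper)
      then show "w z \<le> geodesic_real \<Omega> u0 u1 t z - ereal (C * t)"
        by (simp add: ereal_le_minus)
    qed
    then show "rooftop_real \<Omega> u0 u1 C z + ereal (C * t) \<le> geodesic_real \<Omega> u0 u1 t z"
      by (simp add: ereal_le_minus)
  qed
  show "geodesic_real \<Omega> u0 u1 t z \<le> (SUP C. rooftop_real \<Omega> u0 u1 C z + ereal (C * t))"
    unfolding geodesic_def envelope_def
  proof (rule SUP_least)
    fix v assume v: "v \<in> W_real \<Omega> u0 u1"
    define V where "V = (\<lambda>(z, \<zeta>). SUP c\<in>sphere 0 1. v (z, c * \<zeta>))"
    have V: "V \<in> W_real \<Omega> u0 u1" "rotation_invariant V"
      unfolding V_def by (rule rotation_sup_mem_W[OF v], rule rotation_invariant_rotation_sup)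
    then have psh: "psh_on_prod (\<Omega> \<times> annulus) V" by (simp add: mem_W_iff)
    have "v (z, 1 * of_real (exp t)) \<le> V (z, of_real (exp t))"
      unfolding V_def prod.case by (rule SUP_upper) simp
    also have "\<dots> \<le> (SUP C. (INF s\<in>{0<..<1}. V (z, of_real (exp s)) - ereal (C * s)) + ereal (C * t))"
    proof (rule ereal_convex_le_SUP_affine[OF t])
      show "V (z, of_real (exp s)) < \<infinity>" if "s \<in> {0<..<1}" for s
        using psh z that by (auto simp: psh_on_prod_def psh_wrt_def)
    qed (rule psh_on_prod_radially_convex[OF psh V(2) z])
    also have "\<dots> \<le> (SUP C. rooftop_real \<Omega> u0 u1 C z + ereal (C * t))"
      by (intro SUP_mono) (auto intro!: exI add_right_mono partial_infimum_le_rooftop[OF V \<Omega> z])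
    finally show "v (z, complex_of_real (exp t)) \<le> (SUP C. rooftop_real \<Omega> u0 u1 C z + ereal (C * t))" by simp
  qed
qed

lemma rooftop_antimono:
  assumes "C \<le> D"
  shows "rooftop_real \<Omega> u0 u1 D z \<le> rooftop_real \<Omega> u0 u1 C z"
proof (rule rooftop_least)
  fix w assume w: "psh_on \<Omega> w" "\<And>x. x \<in> \<Omega> \<Longrightarrow> w x \<le> min (ereal (u0 x)) (ereal (u1 x - D))"
  show "w z \<le> rooftop_real \<Omega> u0 u1 C z"
  proof (rule rooftop_upper[OF w(1)])
    fix x assume "x \<in> \<Omega>"
    from w(2)[OF this] show "w x \<le> min (ereal (u0 x)) (ereal (u1 x - C))"
      by (rule order_trans) (use assms in \<open>auto simp: min_def\<close>)
  qed
qed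

text \<open>If \<open>w\<close> competes for the parameter \<open>C\<close>, then \<open>w - (D - C)\<close> competes for \<open>D\<close>.\<close>

lemma rooftop_shift:
  assumes "C \<le> D"
  shows "rooftop_real \<Omega> u0 u1 C z \<le> rooftop_real \<Omega> u0 u1 D z + ereal (D - C)"
proof (rule rooftop_least)
  fix w assume w: "psh_on \<Omega> w" "\<And>x. x \<in> \<Omega> \<Longrightarrow> w x \<le> min (ereal (u0 x)) (ereal (u1 x - C))"
  have "ereal 1 * w z + ereal (C - D) \<le> rooftop_real \<Omega> u0 u1 D z"
  proof (rule rooftop_upper)
    show "psh_on \<Omega> (\<lambda>z. ereal 1 * w z + ereal (C - D))"
      using w(1) unfolding psh_on_def by (intro psh_wrt_affine continuous_on_complex_line) auto
    fix x assume "x \<in> \<Omega>"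
    from w(2)[OF this] show "ereal 1 * w x + ereal (C - D) \<le> min (ereal (u0 x)) (ereal (u1 x - D))"
      using assms by (cases "w x") auto
  qed
  then show "w z \<le> rooftop_real \<Omega> u0 u1 D z + ereal (D - C)"
    by (cases "w z"; cases "rooftop_real \<Omega> u0 u1 D z") auto
qed

lemma rooftop_le:
  assumes "z \<in> \<Omega>"
  shows "rooftop \<Omega> u v z \<le> min (u z) (v z)"
  using assms by (intro rooftop_least) auto

lemma rooftop_finite:
  assumes "bounded (u0 ` \<Omega>)" "bounded (u1 ` \<Omega>)" and z: "z \<in> \<Omega>"
  shows "\<bar>rooftop_real \<Omega> u0 u1 C z\<bar> \<noteq> \<infinity>"
proof -
  obtain M0 M1 where M: "\<And>x. x \<in> \<Omega> \<Longrightarrow> \<bar>u0 x\<bar> \<le> M0" "\<And>x. x \<in> \<Omega> \<Longrightarrow> \<bar>u1 x\<bar> \<le> M1"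
    using assms(1,2) unfolding bounded_iff by auto
  have "ereal (- \<bar>M0\<bar> - \<bar>M1\<bar> - \<bar>C\<bar>) \<le> rooftop_real \<Omega> u0 u1 C z"
  proof (rule rooftop_upper)
    show "psh_on \<Omega> (\<lambda>_. ereal (- \<bar>M0\<bar> - \<bar>M1\<bar> - \<bar>C\<bar>))"
      unfolding psh_on_def by (intro psh_wrt_const continuous_on_complex_line)
    show "ereal (- \<bar>M0\<bar> - \<bar>M1\<bar> - \<bar>C\<bar>) \<le> min (ereal (u0 x)) (ereal (u1 x - C))" if "x \<in> \<Omega>" for x
      using M[OF that] by auto
  qed
  moreover have "rooftop_real \<Omega> u0 u1 C z \<le> ereal (u0 z)"
    using rooftop_le[OF z, of "\<lambda>z. ereal (u0 z)" "\<lambda>z. ereal (u1 z - C)"] by simp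
  ultimately show ?thesis by (cases "rooftop_real \<Omega> u0 u1 C z") auto
qed

text \<open>For competitors \<open>w\<close> and \<open>w'\<close> for \<open>D\<close> and \<open>E\<close> the maximum of \<open>w + Dt\<close> and
\<open>w' + Et\<close> lies in the class \<open>W\<close>. After subtraction of \<open>Ct\<close>, the weighted mean of the two affine functions does
not depend on \<open>t\<close>, since \<open>C\<close> is the weighted mean of \<open>D\<close> and \<open>E\<close>. So it bounds from below the infimum
over \<open>t\<close>, which is at most \<open>P^C\<close>.\<close>

lemma rooftop_concave:
  fixes \<Omega> :: "(complex ^ 'n) set"
  assumes \<Omega>: "open \<Omega>" and z: "z \<in> \<Omega>" and l: "0 \<le> l" "l \<le> 1"
    and P: "rooftop_real \<Omega> u0 u1 D z = ereal p" "rooftop_real \<Omega> u0 u1 E z = ereal q"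
  shows "ereal ((1 - l) * p + l * q) \<le> rooftop_real \<Omega> u0 u1 ((1 - l) * D + l * E) z"
proof (rule ereal_le_epsilon2)
  fix e :: real assume e: "e > 0"
  define C where "C = (1 - l) * D + l * E"
  obtain w where w: "psh_on \<Omega> w" "\<forall>x\<in>\<Omega>. w x \<le> min (ereal (u0 x)) (ereal (u1 x - D))" "ereal (p - e) < w z"
  proof -
    have "ereal (p - e) < rooftop_real \<Omega> u0 u1 D z" using P(1) e by simp
    then show ?thesis using that unfolding rooftop_def less_SUP_iff by blast
  qed
  obtain w' where w': "psh_on \<Omega> w'" "\<forall>x\<in>\<Omega>. w' x \<le> min (ereal (u0 x)) (ereal (u1 x - E))" "ereal (q - e) < w' z"
  proof -
    have "ereal (q - e) < rooftop_real \<Omega> u0 u1 E z" using P(2) e by simp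
    then show ?thesis using that unfolding rooftop_def less_SUP_iff by blast
  qed
  define v :: "(complex ^ 'n) \<times> complex \<Rightarrow> ereal" where "v = (\<lambda>p. max ((\<lambda>(z, \<zeta>). w z + ereal (D * ln (norm \<zeta>))) p) ((\<lambda>(z, \<zeta>). w' z + ereal (E * ln (norm \<zeta>))) p))"
  have vW: "v \<in> W_real \<Omega> u0 u1"
    unfolding v_def using w w' by (intro max_mem_W affine_mem_W) auto
  have rot: "rotation_invariant v" by (simp add: rotation_invariant_def v_def)
  have "ereal ((1 - l) * p + l * q - e) \<le> (INF t\<in>{0<..<1}. v (z, of_real (exp t)) - ereal (C * t))"
  proof (rule INF_greatest)
    fix t :: real
    define m where "m = max (p - e + D * t) (q - e + E * t)"
    have "ereal (p - e + D * t) \<le> w z + ereal (D * t)" "ereal (q - e + E * t) \<le> w' z + ereal (E * t)"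
      using w(3) w'(3) by (cases "w z"; cases "w' z"; auto)+
    then have "ereal m \<le> v (z, of_real (exp t))" by (auto simp: v_def m_def le_max_iff_disj max_def)
    have "(1 - l) * (p - e + D * t) + l * (q - e + E * t) \<le> (1 - l) * m + l * m"
      using l by (intro add_mono mult_left_mono) (auto simp: m_def)
    then have "(1 - l) * p + l * q - e \<le> m - C * t" by (simp add: C_def algebra_simps)
    then have "ereal ((1 - l) * p + l * q - e) \<le> ereal m - ereal (C * t)" by simp
    also have "\<dots> \<le> v (z, of_real (exp t)) - ereal (C * t)"
      by (rule ereal_minus_mono[OF \<open>ereal m \<le> v (z, of_real (exp t))\<close>]) simp
    finally show "ereal ((1 - l) * p + l * q - e) \<le> v (z, of_real (exp t)) - ereal (C * t)" .
  qed
  also have "\<dots> \<le> rooftop_real \<Omega> u0 u1 C z" by (rule partial_infimum_le_rooftop[OF vW rot \<Omega> z])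
  finally show "ereal ((1 - l) * p + l * q) \<le> rooftop_real \<Omega> u0 u1 ((1 - l) * D + l * E) z + ereal e"
    unfolding C_def by (cases "rooftop_real \<Omega> u0 u1 ((1 - l) * D + l * E) z") auto
qed

lemma rooftop_profile_rooftop:
  assumes \<Omega>: "open \<Omega>" and z: "z \<in> \<Omega>" and bdd: "bounded (u0 ` \<Omega>)" "bounded (u1 ` \<Omega>)"
  shows "rooftop_profile (u0 z) (u1 z) (\<lambda>C. real_of_ereal (rooftop_real \<Omega> u0 u1 C z))"
proof -
  define q where "q C = real_of_ereal (rooftop_real \<Omega> u0 u1 C z)" for C
  have q: "rooftop_real \<Omega> u0 u1 C z = ereal (q C)" for C
    using rooftop_finite[OF bdd z, of C] by (simp add: q_def ereal_real')
  have "rooftop_profile (u0 z) (u1 z) q"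
    unfolding rooftop_profile_def
  proof (intro conjI allI)
    show "convex_on UNIV (\<lambda>C. - q C)"
    proof (rule convex_onI)
      fix l D E :: real assume l: "0 < l" "l < 1"
      show "- q ((1 - l) *\<^sub>R D + l *\<^sub>R E) \<le> (1 - l) * - q D + l * - q E"
        using rooftop_concave[OF \<Omega> z _ _ q q, of l D E] l by (simp add: q)
    qed simp
    show "antimono q"
    proof (rule antimonoI)
      show "q E \<le> q D" if "D \<le> E" for D E
        using rooftop_antimono[OF that, of \<Omega> u0 u1 z] by (simp add: q)
    qed
    show "mono (\<lambda>C. q C + C)"
    proof (rule monoI)
      show "q D + D \<le> q E + E" if "D \<le> E" for D E
        using rooftop_shift[OF that, of \<Omega> u0 u1 z] by (simp add: q)
    qed
    have "ereal (q D) \<le> min (ereal (u0 z)) (ereal (u1 z - D))" for D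
      unfolding q[symmetric] by (rule rooftop_le[OF z])
    then show "q D \<le> u0 z" "q D \<le> u1 z - D" for D by auto
  qed
  then show ?thesis by (simp add: q_def[abs_def])
qed

lemma rooftop_eq_INF_geodesic:
  assumes \<Omega>: "open \<Omega>" and z: "z \<in> \<Omega>" and bdd: "bounded (u0 ` \<Omega>)" "bounded (u1 ` \<Omega>)"
  shows "rooftop_real \<Omega> u0 u1 C z = (INF t\<in>{0<..<1}. geodesic_real \<Omega> u0 u1 t z - ereal (C * t))"
proof -
  define q where "q C = real_of_ereal (rooftop_real \<Omega> u0 u1 C z)" for C
  have q: "rooftop_real \<Omega> u0 u1 C z = ereal (q C)" for C
    using rooftop_finite[OF bdd z, of C] by (simp add: q_def ereal_real')
  have "rooftop_profile (u0 z) (u1 z) q"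
    using rooftop_profile_rooftop[OF assms] by (simp add: q_def[abs_def])
  from rooftop_profile_conjugate[OF this, of C] show ?thesis
    unfolding q by (auto simp: geodesic_eq_SUP_rooftop[OF \<Omega> z] q intro!: INF_cong)
qed

section \<open>Continuity up to the boundary\<close>

lemma psh_on_translate:
  assumes u: "psh_on G u" and G': "\<And>x. x \<in> G' \<Longrightarrow> x + h \<in> G" and eq: "\<And>x. x \<in> G' \<Longrightarrow> u' x = u (x + h)"
  shows "psh_on G' u'"
  unfolding psh_on_def
proof (rule psh_wrtI[OF _ _ continuous_on_complex_line])
  have u': "psh_wrt (*s) G u" using u by (simp add: psh_on_def)
  have "usc_on G' (\<lambda>x. u (x + h))"
    by (rule usc_on_compose[of G]) (use u' G' in \<open>auto simp: psh_wrt_def intro: continuous_intros\<close>)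
  then show "usc_on G' u'" using usc_on_cong[of G' u' "\<lambda>x. u (x + h)"] eq by simp
  show "u' x < \<infinity>" if "x \<in> G'" for x using u' G' that eq by (auto simp: psh_wrt_def)
  fix a b :: "complex ^ 'a" and c r H
  assume *: "a \<in> G'" "r > 0" "\<And>k. k \<in> cball c r \<Longrightarrow> a + k *s b \<in> G'" "H holomorphic_on UNIV"
    and less: "\<And>k. k \<in> sphere c r \<Longrightarrow> u' (a + k *s b) < ereal (Re (H k))"
  have line: "u' (a + k *s b) = u (a + h + k *s b)" "a + h + k *s b \<in> G" if "k \<in> cball c r" for k
    using eq[OF *(3)[OF that]] G'[OF *(3)[OF that]] by (simp_all add: ac_simps)
  have "u (a + h + c *s b) \<le> ereal (Re (H c))"
    by (rule psh_wrt_le[OF u' G'[OF *(1)] *(2) line(2) entire_imp_disc[OF *(4)]])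
      (use less line(1) in \<open>auto simp: less_imp_le\<close>)
  then show "u' (a + c *s b) \<le> ereal (Re (H c))" using line(1)[of c] *(2) by simp
qed

lemma psh_on_subset_cong:
  assumes "psh_on G u" "G' \<subseteq> G" "\<And>x. x \<in> G' \<Longrightarrow> u' x = u x"
  shows "psh_on G' u'"
  by (rule psh_on_translate[OF assms(1), where h = 0]) (use assms in auto)

text \<open>Near each point of \<open>G - U\<close> the glued function is \<open>w0\<close>, near each point of \<open>U\<close> it is a maximum of two psh functions.\<close>

lemma psh_on_glue:
  fixes w0 w :: "complex ^ 'n \<Rightarrow> ereal"
  assumes G: "open G" and U: "open U" and w0: "psh_on G w0" and w: "psh_on (G \<inter> U) w"
    and edge: "\<And>x. x \<in> G - U \<Longrightarrow> \<exists>N. open N \<and> x \<in> N \<and> (\<forall>y\<in>N \<inter> G \<inter> U. w y \<le> w0 y)"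
  shows "psh_on G (\<lambda>x. if x \<in> U then max (w0 x) (w x) else w0 x)" (is "psh_on G ?W")
  unfolding psh_on_def
proof (rule psh_wrt_local[OF continuous_on_complex_line _ _ G])
  show "(j + k) *s b = j *s b + k *s b" for j k and b :: "complex ^ 'n" by (rule vector_sadd_rdistrib)
  fix x assume x: "x \<in> G"
  show "\<exists>N. open N \<and> x \<in> N \<and> psh_wrt (*s) (G \<inter> N) ?W"
  proof (cases "x \<in> U")
    case True
    have "psh_on (G \<inter> U) w0" by (rule psh_on_subset_cong[OF w0]) auto
    then have "psh_on (G \<inter> U) (\<lambda>x. max (w0 x) (w x))"
      using w unfolding psh_on_def by (rule psh_wrt_max[OF _ _ continuous_on_complex_line])
    then have "psh_on (G \<inter> U) ?W" by (rule psh_on_subset_cong) auto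
    then show ?thesis using U True by (auto simp: psh_on_def)
  next
    case False
    then obtain N where N: "open N" "x \<in> N" "\<And>y. y \<in> N \<Longrightarrow> y \<in> G \<Longrightarrow> y \<in> U \<Longrightarrow> w y \<le> w0 y"
      using edge[of x] x by blast
    have "psh_on (G \<inter> N) ?W"
      by (rule psh_on_subset_cong[OF w0]) (use N(3) in \<open>auto simp: max_def intro: antisym\<close>)
    then show ?thesis using N by (auto simp: psh_on_def)
  qed
qed

text \<open>The constant \<open>c\<close> serves as the competitor when \<open>A\<close> is empty.\<close>

lemma psh_on_finite_max:
  assumes A: "finite A" and w: "\<And>p. p \<in> A \<Longrightarrow> psh_on \<Omega> (w p)"
    and le: "\<And>p x. p \<in> A \<Longrightarrow> x \<in> \<Omega> \<Longrightarrow> w p x \<le> ereal (g x)"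
    and c: "\<And>x. x \<in> \<Omega> \<Longrightarrow> ereal c \<le> ereal (g x)"
  obtains w0 where "psh_on \<Omega> w0" "\<And>x. x \<in> \<Omega> \<Longrightarrow> w0 x \<le> ereal (g x)" "\<And>p x. p \<in> A \<Longrightarrow> w p x \<le> w0 x"
proof -
  have "\<exists>w0. psh_on \<Omega> w0 \<and> (\<forall>x\<in>\<Omega>. w0 x \<le> ereal (g x)) \<and> (\<forall>p\<in>A. \<forall>x. w p x \<le> w0 x)"
    using A w le
  proof (induction A)
    case empty
    have "psh_on \<Omega> (\<lambda>_. ereal c)" unfolding psh_on_def by (intro psh_wrt_const continuous_on_complex_line)
    then show ?case using c by (intro exI[of _ "\<lambda>_. ereal c"]) auto
  next
    case (insert p A)
    then obtain w0 where w0: "psh_on \<Omega> w0" "\<forall>x\<in>\<Omega>. w0 x \<le> ereal (g x)" "\<forall>p\<in>A. \<forall>x. w p x \<le> w0 x" by auto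
    have "psh_on \<Omega> (\<lambda>x. max (w0 x) (w p x))"
      using w0(1) insert.prems(1)[of p] unfolding psh_on_def by (intro psh_wrt_max continuous_on_complex_line) auto
    then show ?case using w0 insert.prems(2)[of p]
      by (intro exI[of _ "\<lambda>x. max (w0 x) (w p x)"]) (auto simp: le_max_iff_disj)
  qed
  then show ?thesis using that by blast
qed

text \<open>The barrier in quantitative form. It is nonnegative, hence zero, at \<open>p\<close>: a negative value there, with the
negative suprema away from \<open>p\<close>, would make the supremum over \<open>\<Omega>\<close> negative.\<close>

lemma B_regular_barrier:
  assumes "B_regular \<Omega>" and p: "p \<in> frontier \<Omega>"
  obtains \<rho> where "psh_on \<Omega> (\<lambda>z. ereal (\<rho> z))" "\<And>z. z \<in> \<Omega> \<Longrightarrow> \<rho> z \<le> 0"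
    "\<And>e. e > 0 \<Longrightarrow> \<exists>d>0. \<forall>z\<in>\<Omega>. dist z p < d \<longrightarrow> - e < \<rho> z"
    "\<And>d. d > 0 \<Longrightarrow> \<exists>m>0. \<forall>z\<in>\<Omega>. d \<le> dist z p \<longrightarrow> \<rho> z \<le> - m"
proof -
  obtain \<rho> where \<rho>: "psh_on \<Omega> (\<lambda>z. ereal (\<rho> z))" "continuous_on (closure \<Omega>) \<rho>"
    "(SUP z\<in>\<Omega>. ereal (\<rho> z)) = 0"
    "\<And>U. open U \<Longrightarrow> p \<in> U \<Longrightarrow> (SUP z\<in>\<Omega> - U. ereal (\<rho> z)) < 0"
    using assms unfolding B_regular_def by blast
  have p': "p \<in> closure \<Omega>" using p by (simp add: frontier_def)
  have far: "\<exists>m>0. \<forall>z\<in>\<Omega>. d \<le> dist z p \<longrightarrow> \<rho> z \<le> - m" if d: "d > 0" for d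
  proof -
    have "(SUP z\<in>\<Omega> - ball p d. ereal (\<rho> z)) < 0" using d by (intro \<rho>(4)) auto
    then obtain b where b: "(SUP z\<in>\<Omega> - ball p d. ereal (\<rho> z)) < ereal b" "ereal b < 0" using ereal_dense2 by blast
    have "\<rho> z \<le> b" if "z \<in> \<Omega>" "d \<le> dist z p" for z
    proof -
      have "ereal (\<rho> z) \<le> (SUP z\<in>\<Omega> - ball p d. ereal (\<rho> z))"
        using that by (intro SUP_upper) (auto simp: dist_commute)
      then have "ereal (\<rho> z) < ereal b" using b(1) by (rule le_less_trans)
      then show ?thesis by simp
    qed
    then show ?thesis using b(2) by (intro exI[of _ "- b"]) auto
  qed
  have cont: "\<exists>d>0. \<forall>z\<in>\<Omega>. dist z p < d \<longrightarrow> \<bar>\<rho> z - \<rho> p\<bar> < e" if "e > 0" for e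
    using \<rho>(2) p' that closure_subset[of \<Omega>] unfolding continuous_on_iff dist_real_def by (meson subsetD)
  have "\<rho> p \<ge> 0"
  proof (rule ccontr)
    assume neg: "\<not> \<rho> p \<ge> 0"
    then obtain d where d: "d > 0" "\<And>z. z \<in> \<Omega> \<Longrightarrow> dist z p < d \<Longrightarrow> \<bar>\<rho> z - \<rho> p\<bar> < - \<rho> p / 2"
      using cont[of "- \<rho> p / 2"] by auto
    obtain m where m: "m > 0" "\<And>z. z \<in> \<Omega> \<Longrightarrow> d \<le> dist z p \<Longrightarrow> \<rho> z \<le> - m" using far[OF d(1)] by blast
    have "(SUP z\<in>\<Omega>. ereal (\<rho> z)) \<le> ereal (max (\<rho> p / 2) (- m))"
    proof (rule SUP_least)
      fix z assume z: "z \<in> \<Omega>"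
      show "ereal (\<rho> z) \<le> ereal (max (\<rho> p / 2) (- m))"
      proof (cases "dist z p < d")
        case True
        then have "\<rho> z \<le> \<rho> p / 2" using d(2)[OF z True] by linarith
        then show ?thesis by (simp add: le_max_iff_disj)
      next
        case False
        then show ?thesis using m(2)[OF z] by (simp add: le_max_iff_disj)
      qed
    qed
    then show False using \<rho>(3) m(1) neg by (simp add: zero_ereal_def le_max_iff_disj)
  qed
  show ?thesis
  proof (rule that[OF \<rho>(1) _ _ far])
    show "\<rho> z \<le> 0" if "z \<in> \<Omega>" for z
    proof -
      have "ereal (\<rho> z) \<le> (SUP z\<in>\<Omega>. ereal (\<rho> z))" using that by (rule SUP_upper)
      then show ?thesis using \<rho>(3) by simp
    qed
    show "\<exists>d>0. \<forall>z\<in>\<Omega>. dist z p < d \<longrightarrow> - e < \<rho> z" if e: "e > 0" for e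
    proof -
      obtain d where "d > 0" "\<forall>z\<in>\<Omega>. dist z p < d \<longrightarrow> \<bar>\<rho> z - \<rho> p\<bar> < e" using cont[OF e] by blast
      then show ?thesis using \<open>\<rho> p \<ge> 0\<close> by (intro exI[of _ d]) (force simp: abs_less_iff)
    qed
  qed
qed

text \<open>Write \<open>g_C\<close> for \<open>min(u_0, u_1 - C)\<close>. At a boundary point \<open>p\<close> the competitor is \<open>g_C(p) - \<epsilon> + N \<rho>_p\<close>. Close to \<open>p\<close> it is below
\<open>g_C\<close> by continuity, elsewhere because \<open>N\<close> is large. How close and how large depends only on the modulus of continuity and
the oscillation of \<open>g_C\<close>, which are those of \<open>u_0\<close> and \<open>u_1\<close> for every \<open>C\<close>. Finitely many boundary
points are enough, by compactness.\<close>

lemma near_boundary_minorants: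
  fixes \<Omega> :: "(complex ^ 'n) set" and u0 u1 :: "complex ^ 'n \<Rightarrow> real"
  defines "g \<equiv> \<lambda>C z. min (u0 z) (u1 z - C)"
  assumes bdd: "bounded \<Omega>" and reg: "B_regular \<Omega>"
    and cont: "continuous_on (closure \<Omega>) u0" "continuous_on (closure \<Omega>) u1" and e: "e > 0"
  obtains \<delta> where "\<delta> > 0"
    "\<And>C x y. x \<in> closure \<Omega> \<Longrightarrow> y \<in> closure \<Omega> \<Longrightarrow> dist x y < \<delta> \<Longrightarrow> g C x \<le> g C y + e"
    "\<And>C. \<exists>w. psh_on \<Omega> w \<and> (\<forall>x\<in>\<Omega>. w x \<le> ereal (g C x)) \<and>
       (\<forall>x\<in>\<Omega>. \<forall>p\<in>frontier \<Omega>. dist x p < \<delta> \<longrightarrow> ereal (g C x - 3 * e) \<le> w x)"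
proof -
  have comp: "compact (closure \<Omega>)" using bdd by (simp add: compact_closure)
  have unif: "uniformly_continuous_on (closure \<Omega>) u0" "uniformly_continuous_on (closure \<Omega>) u1"
    using cont comp by (auto intro: compact_uniformly_continuous)
  obtain d0 where d0: "d0 > 0" "\<And>x y. x \<in> closure \<Omega> \<Longrightarrow> y \<in> closure \<Omega> \<Longrightarrow> dist x y < d0 \<Longrightarrow> \<bar>u0 x - u0 y\<bar> < e"
    using unif(1) e unfolding uniformly_continuous_on_def dist_real_def by meson
  obtain d1 where d1: "d1 > 0" "\<And>x y. x \<in> closure \<Omega> \<Longrightarrow> y \<in> closure \<Omega> \<Longrightarrow> dist x y < d1 \<Longrightarrow> \<bar>u1 x - u1 y\<bar> < e"
    using unif(2) e unfolding uniformly_continuous_on_def dist_real_def by meson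
  define d where "d = min d0 d1"
  have d: "d > 0" using d0 d1 by (simp add: d_def)
  have geq: "g C x \<le> g C y + e" if "x \<in> closure \<Omega>" "y \<in> closure \<Omega>" "dist x y < d" for C x y
    using d0(2)[of x y] d1(2)[of x y] that by (auto simp: g_def d_def)
  have "bounded (u0 ` closure \<Omega>)" "bounded (u1 ` closure \<Omega>)"
    by (rule compact_imp_bounded[OF compact_continuous_image[OF cont(1) comp]],
        rule compact_imp_bounded[OF compact_continuous_image[OF cont(2) comp]])
  then obtain M0 M1 where M': "\<forall>x\<in>closure \<Omega>. \<bar>u0 x\<bar> \<le> M0" "\<forall>x\<in>closure \<Omega>. \<bar>u1 x\<bar> \<le> M1"
    unfolding bounded_iff by auto
  define M where "M = \<bar>M0\<bar> + \<bar>M1\<bar>"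
  have M: "\<bar>u0 x\<bar> \<le> M" "\<bar>u1 x\<bar> \<le> M" if "x \<in> closure \<Omega>" for x using M' that by (auto simp: M_def)
  have gM: "g C x \<le> g C y + 2 * M" if "x \<in> closure \<Omega>" "y \<in> closure \<Omega>" for C x y
    using M[OF that(1)] M[OF that(2)] by (auto simp: g_def abs_le_iff)
  have \<Omega>cl: "x \<in> closure \<Omega>" if "x \<in> \<Omega>" for x using that closure_subset by blast
  have "\<exists>\<eta>>0. \<forall>C. \<exists>w. psh_on \<Omega> w \<and> (\<forall>x\<in>\<Omega>. w x \<le> ereal (g C x)) \<and>
      (\<forall>x\<in>\<Omega>. dist x p < \<eta> \<longrightarrow> ereal (g C x - 3 * e) \<le> w x)" if p: "p \<in> frontier \<Omega>" for p
  proof -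
    have pcl: "p \<in> closure \<Omega>" using p by (simp add: frontier_def)
    obtain \<rho> where \<rho>: "psh_on \<Omega> (\<lambda>z. ereal (\<rho> z))" "\<And>z. z \<in> \<Omega> \<Longrightarrow> \<rho> z \<le> 0"
      "\<And>e. e > 0 \<Longrightarrow> \<exists>d>0. \<forall>z\<in>\<Omega>. dist z p < d \<longrightarrow> - e < \<rho> z"
      "\<And>d. d > 0 \<Longrightarrow> \<exists>m>0. \<forall>z\<in>\<Omega>. d \<le> dist z p \<longrightarrow> \<rho> z \<le> - m"
      using B_regular_barrier[OF reg p] by metis
    obtain m where m: "m > 0" "\<And>z. z \<in> \<Omega> \<Longrightarrow> d \<le> dist z p \<Longrightarrow> \<rho> z \<le> - m" using \<rho>(4)[OF d] by blast
    define N where "N = (2 * \<bar>M\<bar> + 1) / m"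
    have N: "N > 0" "N * m \<ge> 2 * M" using m(1) by (auto simp: N_def)
    obtain \<eta>' where \<eta>': "\<eta>' > 0" "\<And>z. z \<in> \<Omega> \<Longrightarrow> dist z p < \<eta>' \<Longrightarrow> - (e / N) < \<rho> z"
      using \<rho>(3)[of "e / N"] e N by auto
    show ?thesis
    proof (intro exI[of _ "min d \<eta>'"] conjI allI)
      show "min d \<eta>' > 0" using d \<eta>' by simp
      fix C
      define w where "w x = ereal N * ereal (\<rho> x) + ereal (g C p - e)" for x
      show "\<exists>w. psh_on \<Omega> w \<and> (\<forall>x\<in>\<Omega>. w x \<le> ereal (g C x)) \<and>
         (\<forall>x\<in>\<Omega>. dist x p < min d \<eta>' \<longrightarrow> ereal (g C x - 3 * e) \<le> w x)"
      proof (intro exI[of _ w] conjI ballI impI)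
        show "psh_on \<Omega> w"
          using \<rho>(1) N(1) unfolding psh_on_def w_def by (intro psh_wrt_affine continuous_on_complex_line)
        fix x assume x: "x \<in> \<Omega>"
        show "w x \<le> ereal (g C x)"
        proof (cases "dist x p < d")
          case True
          have "N * \<rho> x \<le> 0" using N(1) \<rho>(2)[OF x] by (simp add: mult_nonneg_nonpos)
          moreover have "g C p \<le> g C x + e" using True by (intro geq pcl \<Omega>cl x) (simp add: dist_commute)
          ultimately show ?thesis by (simp add: w_def)
        next
          case False
          then have "N * \<rho> x \<le> N * (- m)" using N(1) m(2)[OF x] by (intro mult_left_mono) auto
          moreover have "g C p \<le> g C x + 2 * M" by (intro gM pcl \<Omega>cl x)
          ultimately show ?thesis using N(2) e by (simp add: w_def)
        qed
      next
        fix x assume x: "x \<in> \<Omega>" "dist x p < min d \<eta>'"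
        have "- e \<le> N * \<rho> x" using \<eta>'(2)[OF x(1)] x(2) N(1) by (simp add: field_simps)
        moreover have "g C x \<le> g C p + e" using x by (intro geq pcl \<Omega>cl) auto
        ultimately show "ereal (g C x - 3 * e) \<le> w x" by (simp add: w_def)
      qed
    qed
  qed
  then obtain \<eta> where \<eta>: "\<And>p. p \<in> frontier \<Omega> \<Longrightarrow> \<eta> p > 0"
    "\<And>p C. p \<in> frontier \<Omega> \<Longrightarrow> \<exists>w. psh_on \<Omega> w \<and> (\<forall>x\<in>\<Omega>. w x \<le> ereal (g C x)) \<and>
      (\<forall>x\<in>\<Omega>. dist x p < \<eta> p \<longrightarrow> ereal (g C x - 3 * e) \<le> w x)" by metis
  have cF: "compact (frontier \<Omega>)" using bdd by (rule compact_frontier_bounded)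
  obtain A where A: "A \<subseteq> frontier \<Omega>" "finite A" "frontier \<Omega> \<subseteq> (\<Union>p\<in>A. ball p (\<eta> p))"
  proof (rule compactE_image[OF cF, of "frontier \<Omega>" "\<lambda>p. ball p (\<eta> p)"])
    show "frontier \<Omega> \<subseteq> (\<Union>p\<in>frontier \<Omega>. ball p (\<eta> p))" using \<eta>(1) by force
  qed (auto intro: that)
  have "open (\<Union>p\<in>A. ball p (\<eta> p))" by blast
  then obtain \<delta>' where \<delta>': "\<delta>' > 0" "(\<Union>x\<in>frontier \<Omega>. ball x \<delta>') \<subseteq> (\<Union>p\<in>A. ball p (\<eta> p))"
    using compact_subset_open_imp_ball_epsilon_subset[OF cF _ A(3)] by metis
  show ?thesis
  proof (rule that[of "min d \<delta>'"])
    show "min d \<delta>' > 0" using d \<delta>' by simp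
    show "g C x \<le> g C y + e" if "x \<in> closure \<Omega>" "y \<in> closure \<Omega>" "dist x y < min d \<delta>'" for C x y
      using that by (intro geq) auto
    fix C
    obtain w where w: "\<And>p. p \<in> A \<Longrightarrow> psh_on \<Omega> (w p) \<and> (\<forall>x\<in>\<Omega>. w p x \<le> ereal (g C x)) \<and>
      (\<forall>x\<in>\<Omega>. dist x p < \<eta> p \<longrightarrow> ereal (g C x - 3 * e) \<le> w p x)"
      using \<eta>(2)[of _ C] A(1) by (metis subsetD)
    have low: "ereal (- M - \<bar>C\<bar>) \<le> ereal (g C x)" if "x \<in> \<Omega>" for x
      using M[OF \<Omega>cl[OF that]] by (auto simp: g_def)
    obtain w0 where w0: "psh_on \<Omega> w0" "\<And>x. x \<in> \<Omega> \<Longrightarrow> w0 x \<le> ereal (g C x)" "\<And>p x. p \<in> A \<Longrightarrow> w p x \<le> w0 x"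
      using psh_on_finite_max[OF A(2), of \<Omega> w "g C" "- M - \<bar>C\<bar>"] w low by metis
    have "ereal (g C x - 3 * e) \<le> w0 x" if x: "x \<in> \<Omega>" "q \<in> frontier \<Omega>" "dist x q < min d \<delta>'" for x q
    proof -
      have "x \<in> ball q \<delta>'" using x(3) by (simp add: dist_commute)
      then obtain p where p: "p \<in> A" "x \<in> ball p (\<eta> p)" using \<delta>'(2) x(2) by blast
      then have "ereal (g C x - 3 * e) \<le> w p x" using w[OF p(1)] x(1) by (simp add: dist_commute)
      also have "\<dots> \<le> w0 x" by (rule w0(3)[OF p(1)])
      finally show ?thesis .
    qed
    then show "\<exists>w. psh_on \<Omega> w \<and> (\<forall>x\<in>\<Omega>. w x \<le> ereal (g C x)) \<and>
       (\<forall>x\<in>\<Omega>. \<forall>p\<in>frontier \<Omega>. dist x p < min d \<delta>' \<longrightarrow> ereal (g C x - 3 * e) \<le> w x)"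
      using w0(1,2) by blast
  qed
qed

text \<open>Walsh's argument. Let \<open>g_C = min(u_0, u_1 - C)\<close> and \<open>h = y - x\<close>, and let \<open>w\<close> compete for \<open>P^C\<close>. The translate \<open>w(\<cdot> + h) - \<epsilon>\<close> is
below \<open>g_C\<close> by continuity of \<open>g_C\<close>, but it is defined only where \<open>z + h\<close> is in \<open>\<Omega>\<close>. The points of
\<open>\<Omega>\<close> at which this domain ends have a boundary point of \<open>\<Omega>\<close> at distance less than \<open>\<delta>\<close>; near them the translate is below the minorant \<open>w0\<close>,
so that the two can be glued to a competitor, whose value at \<open>x\<close> is at least \<open>w y - \<epsilon>\<close>.\<close>

lemma rooftop_equicontinuous:
  fixes \<Omega> :: "(complex ^ 'n) set" and u0 u1 :: "complex ^ 'n \<Rightarrow> real"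
  assumes op: "open \<Omega>" and bdd: "bounded \<Omega>" and reg: "B_regular \<Omega>"
    and cont: "continuous_on (closure \<Omega>) u0" "continuous_on (closure \<Omega>) u1" and e: "e > 0"
  obtains \<delta> where "\<delta> > 0"
    "\<And>C x y. x \<in> \<Omega> \<Longrightarrow> y \<in> \<Omega> \<Longrightarrow> dist x y < \<delta> \<Longrightarrow>
       rooftop_real \<Omega> u0 u1 C y \<le> rooftop_real \<Omega> u0 u1 C x + ereal e"
    "\<And>C x p. x \<in> \<Omega> \<Longrightarrow> p \<in> frontier \<Omega> \<Longrightarrow> dist x p < \<delta> \<Longrightarrow>
       ereal (min (u0 p) (u1 p - C)) \<le> rooftop_real \<Omega> u0 u1 C x + ereal e"
    "\<And>C x y. x \<in> closure \<Omega> \<Longrightarrow> y \<in> closure \<Omega> \<Longrightarrow> dist x y < \<delta> \<Longrightarrow>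
       min (u0 x) (u1 x - C) \<le> min (u0 y) (u1 y - C) + e"
proof -
  define g where "g C z = min (u0 z) (u1 z - C)" for C z
  define e' where "e' = e / 4"
  have e': "e' > 0" "e = 4 * e'" using e by (auto simp: e'_def)
  obtain \<delta> where \<delta>: "\<delta> > 0"
    "\<And>C x y. x \<in> closure \<Omega> \<Longrightarrow> y \<in> closure \<Omega> \<Longrightarrow> dist x y < \<delta> \<Longrightarrow> g C x \<le> g C y + e'"
    "\<And>C. \<exists>w. psh_on \<Omega> w \<and> (\<forall>x\<in>\<Omega>. w x \<le> ereal (g C x)) \<and>
       (\<forall>x\<in>\<Omega>. \<forall>p\<in>frontier \<Omega>. dist x p < \<delta> \<longrightarrow> ereal (g C x - 3 * e') \<le> w x)"
    using near_boundary_minorants[OF bdd reg cont e'(1)] unfolding g_def by metis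
  have \<Omega>cl: "x \<in> closure \<Omega>" if "x \<in> \<Omega>" for x using that closure_subset by blast
  have upper: "w x \<le> rooftop_real \<Omega> u0 u1 C x" if "psh_on \<Omega> w" "\<And>x. x \<in> \<Omega> \<Longrightarrow> w x \<le> ereal (g C x)" for w C x
    by (rule rooftop_upper[OF that(1)]) (use that(2) in \<open>auto simp: g_def\<close>)
  show ?thesis
  proof (rule that[of \<delta>])
    show "\<delta> > 0" by (rule \<delta>(1))
    show "min (u0 x) (u1 x - C) \<le> min (u0 y) (u1 y - C) + e"
      if "x \<in> closure \<Omega>" "y \<in> closure \<Omega>" "dist x y < \<delta>" for C x y
      using \<delta>(2)[OF that, of C] e' by (simp add: g_def)
    show "ereal (min (u0 p) (u1 p - C)) \<le> rooftop_real \<Omega> u0 u1 C x + ereal e"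
      if x: "x \<in> \<Omega>" "p \<in> frontier \<Omega>" "dist x p < \<delta>" for C x p
    proof -
      obtain w where w: "psh_on \<Omega> w" "\<forall>x\<in>\<Omega>. w x \<le> ereal (g C x)"
        "\<forall>x\<in>\<Omega>. \<forall>p\<in>frontier \<Omega>. dist x p < \<delta> \<longrightarrow> ereal (g C x - 3 * e') \<le> w x" using \<delta>(3) by blast
      have "p \<in> closure \<Omega>" "dist p x < \<delta>" using x by (auto simp: frontier_def dist_commute)
      then have "g C p \<le> g C x + e'" using \<delta>(2) \<Omega>cl[OF x(1)] by blast
      then have "ereal (g C p) \<le> ereal (g C x - 3 * e') + ereal e" using e' by simp
      also have "\<dots> \<le> w x + ereal e" using w(3) x by (intro add_right_mono) blast
      also have "\<dots> \<le> rooftop_real \<Omega> u0 u1 C x + ereal e" using upper w by (intro add_right_mono) blast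
      finally show ?thesis by (simp add: g_def)
    qed
    show "rooftop_real \<Omega> u0 u1 C y \<le> rooftop_real \<Omega> u0 u1 C x + ereal e"
      if x: "x \<in> \<Omega>" and y: "y \<in> \<Omega>" and xy: "dist x y < \<delta>" for C x y
    proof (rule rooftop_least)
      fix w assume w: "psh_on \<Omega> w" "\<And>x. x \<in> \<Omega> \<Longrightarrow> w x \<le> min (ereal (u0 x)) (ereal (u1 x - C))"
      have wg: "w z \<le> ereal (g C z)" if "z \<in> \<Omega>" for z using w(2)[OF that] by (simp add: g_def)
      obtain w0 where w0: "psh_on \<Omega> w0" "\<And>x. x \<in> \<Omega> \<Longrightarrow> w0 x \<le> ereal (g C x)"
        "\<And>x p. x \<in> \<Omega> \<Longrightarrow> p \<in> frontier \<Omega> \<Longrightarrow> dist x p < \<delta> \<Longrightarrow> ereal (g C x - 3 * e') \<le> w0 x" using \<delta>(3) by blast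
      define h where "h = y - x"
      have nh: "norm h < \<delta>" using xy by (simp add: h_def dist_norm norm_minus_commute)
      define U where "U = {z. z + h \<in> \<Omega>}"
      define s where "s z = ereal 1 * w (z + h) + ereal (- 4 * e')" for z
      have opU: "open U"
        unfolding U_def using open_vimage[OF op, of "\<lambda>z. z + h"] by (simp add: vimage_def continuous_intros)
      have "psh_on U s"
        unfolding psh_on_def s_def
        by (intro psh_wrt_affine continuous_on_complex_line psh_on_translate[OF w(1), unfolded psh_on_def])
          (auto simp: U_def)
      then have psh_s: "psh_on (\<Omega> \<inter> U) s" by (rule psh_on_subset_cong) auto
      have s_le: "s z \<le> ereal (g C z - 3 * e')" if z: "z \<in> \<Omega>" "z \<in> U" for z
      proof -
        have "g C (z + h) \<le> g C z + e'"
          using z nh by (intro \<delta>(2) \<Omega>cl) (auto simp: U_def dist_norm)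
        then show ?thesis using wg[of "z + h"] z by (cases "w (z + h)") (auto simp: s_def U_def)
      qed
      define W where "W z = (if z \<in> U then max (w0 z) (s z) else w0 z)" for z
      have "psh_on \<Omega> W"
        unfolding W_def
      proof (rule psh_on_glue[OF op opU w0(1) psh_s])
        fix z assume z: "z \<in> \<Omega> - U"
        have "closed_segment z (z + h) \<inter> frontier \<Omega> \<noteq> {}"
        proof (rule connected_Int_frontier)
          show "closed_segment z (z + h) \<inter> \<Omega> \<noteq> {}" using z by auto
          show "closed_segment z (z + h) - \<Omega> \<noteq> {}" using z by (auto simp: U_def)
        qed auto
        then obtain p where p: "p \<in> closed_segment z (z + h)" "p \<in> frontier \<Omega>" by blast
        have "dist z p < \<delta>" using segment_bound(1)[OF p(1)] nh by (simp add: dist_norm norm_minus_commute)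
        moreover have "s y \<le> w0 y" if "y \<in> ball p \<delta> \<inter> \<Omega> \<inter> U" for y
        proof -
          have "s y \<le> ereal (g C y - 3 * e')" using that by (intro s_le) auto
          also have "\<dots> \<le> w0 y" using that p by (intro w0(3)) (auto simp: dist_commute)
          finally show ?thesis .
        qed
        ultimately show "\<exists>N. open N \<and> z \<in> N \<and> (\<forall>y\<in>N \<inter> \<Omega> \<inter> U. s y \<le> w0 y)"
          by (intro exI[of _ "ball p \<delta>"]) (auto simp: dist_commute)
      qed
      moreover have "W z \<le> ereal (g C z)" if z: "z \<in> \<Omega>" for z
      proof -
        have "s z \<le> ereal (g C z)" if "z \<in> U"
          using s_le[OF z that] by (rule order_trans) (use e' in simp)
        then show ?thesis using w0(2)[OF z] by (simp add: W_def)
      qed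
      ultimately have "W x \<le> rooftop_real \<Omega> u0 u1 C x" by (rule upper)
      moreover have "s x \<le> W x" using y by (simp add: W_def U_def h_def)
      ultimately have "s x \<le> rooftop_real \<Omega> u0 u1 C x" by (rule order_trans[rotated])
      moreover have "s x = w y + ereal (- e)" using e'(2) by (simp add: s_def h_def flip: one_ereal_def)
      ultimately show "w y \<le> rooftop_real \<Omega> u0 u1 C x + ereal e"
        by (cases "w y"; cases "rooftop_real \<Omega> u0 u1 C x") auto
    qed
  qed
qed

lemma rooftop_profile_min: "rooftop_profile A B (\<lambda>C. min A (B - C))"
  unfolding rooftop_profile_def
proof (intro conjI allI)
  show "convex_on UNIV (\<lambda>C. - min A (B - C))"
  proof (rule convex_onI)
    fix l D E :: real assume l: "0 < l" "l < 1"
    have "(1 - l) * min A (B - D) + l * min A (B - E) \<le> (1 - l) * A + l * A"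
      using l by (intro add_mono mult_left_mono) auto
    moreover have "(1 - l) * min A (B - D) + l * min A (B - E) \<le> (1 - l) * (B - D) + l * (B - E)"
      using l by (intro add_mono mult_left_mono) auto
    ultimately have "(1 - l) * min A (B - D) + l * min A (B - E) \<le> min A (B - ((1 - l) * D + l * E))"
      by (simp add: algebra_simps)
    then show "- min A (B - ((1 - l) *\<^sub>R D + l *\<^sub>R E)) \<le> (1 - l) * - min A (B - D) + l * - min A (B - E)"
      by (simp only: real_scaleR_def mult_minus_right)
  qed simp
qed (auto intro!: antimonoI monoI)

text \<open>Weighting the two upper bounds of \<open>q\<close> with \<open>1 - t\<close> and \<open>t\<close> cancels \<open>C\<close>, so the supremum is finite.\<close>

lemma rooftop_profile_SUP:
  assumes q: "rooftop_profile A B q" and t: "t \<in> {0<..<1}"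
  shows "bdd_above (range (\<lambda>C. q C + C * t))" "ereal (SUP C. q C + C * t) = (SUP C. ereal (q C + C * t))"
proof -
  have le: "q C + C * t \<le> (1 - t) * A + t * B" for C
  proof -
    have "(1 - t) * q C + t * q C \<le> (1 - t) * A + t * (B - C)"
      using q t unfolding rooftop_profile_def by (intro add_mono mult_left_mono) auto
    then show ?thesis by (simp add: algebra_simps)
  qed
  then show "bdd_above (range (\<lambda>C. q C + C * t))" by (intro bdd_aboveI2)
  have "(SUP C. ereal (q C + C * t)) \<le> ereal ((1 - t) * A + t * B)" using le by (intro SUP_least) simp
  moreover have "ereal (q 0 + 0 * t) \<le> (SUP C. ereal (q C + C * t))" by (rule SUP_upper) simp
  ultimately have "\<bar>SUP C. ereal (q C + C * t)\<bar> \<noteq> \<infinity>" by (cases "SUP C. ereal (q C + C * t)") auto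
  then show "ereal (SUP C. q C + C * t) = (SUP C. ereal (q C + C * t))" by (rule ereal_SUP)
qed

text \<open>At every point of the closure, \<open>C \<mapsto> Pb C z\<close> has the properties of \<open>rooftop_profile\<close>: inside it is the rooftop
envelope, on the boundary \<open>min (u0 z) (u1 z - C)\<close>. Defining \<open>ub\<close> by the first formula therefore yields the second
one at all points, and a modulus of continuity common to all \<open>C\<close> passes to the supremum.\<close>

lemma boundary_extension:
  fixes \<Omega> :: "(complex ^ 'n) set" and u0 u1 :: "complex ^ 'n \<Rightarrow> real"
  assumes op: "open \<Omega>" and bdd: "bounded \<Omega>" and reg: "B_regular \<Omega>"
    and cont: "continuous_on (closure \<Omega>) u0" "continuous_on (closure \<Omega>) u1"
  shows "\<exists>(ub :: real \<Rightarrow> complex ^ 'n \<Rightarrow> real) (Pb :: real \<Rightarrow> complex ^ 'n \<Rightarrow> real).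
     (\<forall>t\<in>{0<..<1}. continuous_on (closure \<Omega>) (ub t) \<and> (\<forall>z\<in>\<Omega>. ereal (ub t z) = geodesic_real \<Omega> u0 u1 t z)) \<and>
     (\<forall>C. continuous_on (closure \<Omega>) (Pb C) \<and> (\<forall>z\<in>\<Omega>. ereal (Pb C z) = rooftop_real \<Omega> u0 u1 C z)) \<and>
     (\<forall>t\<in>{0<..<1}. \<forall>z\<in>frontier \<Omega>. ereal (ub t z) = (SUP C. ereal (Pb C z) + ereal (C * t))) \<and>
     (\<forall>C. \<forall>z\<in>frontier \<Omega>. ereal (Pb C z) = (INF t\<in>{0<..<1}. ereal (ub t z) - ereal (C * t)))"
proof -
  have comp: "compact (closure \<Omega>)" using bdd by (simp add: compact_closure)
  have "bounded (u0 ` closure \<Omega>)" "bounded (u1 ` closure \<Omega>)"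
    by (rule compact_imp_bounded[OF compact_continuous_image[OF cont(1) comp]],
        rule compact_imp_bounded[OF compact_continuous_image[OF cont(2) comp]])
  then have b01: "bounded (u0 ` \<Omega>)" "bounded (u1 ` \<Omega>)"
    using bounded_subset[OF _ image_mono[OF closure_subset]] by blast+
  define Pb where "Pb C z = (if z \<in> \<Omega> then real_of_ereal (rooftop_real \<Omega> u0 u1 C z) else min (u0 z) (u1 z - C))" for C z
  define ub where "ub t z = (SUP C. Pb C z + C * t)" for t z
  have Pb: "ereal (Pb C z) = rooftop_real \<Omega> u0 u1 C z" if "z \<in> \<Omega>" for C z
    using rooftop_finite[OF b01 that, of C] that by (simp add: Pb_def ereal_real')
  have profile: "rooftop_profile (u0 z) (u1 z) (\<lambda>C. Pb C z)" for z
    using rooftop_profile_rooftop[OF op _ b01, of z] rooftop_profile_min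
    by (cases "z \<in> \<Omega>") (simp_all add: Pb_def)
  have cl: "closure \<Omega> = \<Omega> \<union> frontier \<Omega>" by (rule closure_Un_frontier)
  have fr: "z \<notin> \<Omega>" if "z \<in> frontier \<Omega>" for z using that op by (simp add: frontier_def interior_open)
  have modulus: "\<exists>\<delta>>0. \<forall>C. \<forall>x\<in>closure \<Omega>. \<forall>y\<in>closure \<Omega>. dist x y < \<delta> \<longrightarrow> Pb C y \<le> Pb C x + e" if e: "e > 0" for e
  proof -
    obtain \<delta> where \<delta>: "\<delta> > 0"
      "\<And>C x y. x \<in> \<Omega> \<Longrightarrow> y \<in> \<Omega> \<Longrightarrow> dist x y < \<delta> \<Longrightarrow>
         rooftop_real \<Omega> u0 u1 C y \<le> rooftop_real \<Omega> u0 u1 C x + ereal e"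
      "\<And>C x p. x \<in> \<Omega> \<Longrightarrow> p \<in> frontier \<Omega> \<Longrightarrow> dist x p < \<delta> \<Longrightarrow>
         ereal (min (u0 p) (u1 p - C)) \<le> rooftop_real \<Omega> u0 u1 C x + ereal e"
      "\<And>C x y. x \<in> closure \<Omega> \<Longrightarrow> y \<in> closure \<Omega> \<Longrightarrow> dist x y < \<delta> \<Longrightarrow>
         min (u0 x) (u1 x - C) \<le> min (u0 y) (u1 y - C) + e"
      by (rule rooftop_equicontinuous[OF op bdd reg cont e]) (rule that)
    have "Pb C y \<le> Pb C x + e" if x: "x \<in> closure \<Omega>" and y: "y \<in> closure \<Omega>" and xy: "dist x y < \<delta>" for C x y
    proof (cases "x \<in> \<Omega>")
      case xO: True
      show ?thesis
      proof (cases "y \<in> \<Omega>")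
        case True
        then have "ereal (Pb C y) \<le> ereal (Pb C x) + ereal e" unfolding Pb[OF xO] Pb[OF True] by (intro \<delta>(2) xO xy)
        then show ?thesis by simp
      next
        case False
        then have "y \<in> frontier \<Omega>" and Py: "Pb C y = min (u0 y) (u1 y - C)"
          using y cl by (blast, simp add: Pb_def)
        then have "ereal (Pb C y) \<le> ereal (Pb C x) + ereal e"
          unfolding Pb[OF xO] Py by (intro \<delta>(3) xO xy)
        then show ?thesis by simp
      qed
    next
      case False
      have "Pb C y \<le> min (u0 y) (u1 y - C)" using profile[of y] unfolding rooftop_profile_def by simp
      also have "\<dots> \<le> min (u0 x) (u1 x - C) + e" using xy by (intro \<delta>(4) x y) (simp add: dist_commute)
      finally show ?thesis using False by (simp add: Pb_def)
    qed
    then show ?thesis using \<delta>(1) by blast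
  qed
  have contI: "continuous_on (closure \<Omega>) f"
    if *: "\<And>e. e > 0 \<Longrightarrow> \<exists>\<delta>>0. \<forall>x\<in>closure \<Omega>. \<forall>y\<in>closure \<Omega>. dist x y < \<delta> \<longrightarrow> f y \<le> f x + e" for f :: "complex ^ 'n \<Rightarrow> real"
    unfolding continuous_on_iff
  proof (intro ballI allI impI)
    fix x and e :: real assume x: "x \<in> closure \<Omega>" and e: "e > 0"
    obtain \<delta> where \<delta>: "\<delta> > 0" "\<forall>x\<in>closure \<Omega>. \<forall>y\<in>closure \<Omega>. dist x y < \<delta> \<longrightarrow> f y \<le> f x + e / 2"
      using *[of "e/2"] e by auto
    show "\<exists>d>0. \<forall>x'\<in>closure \<Omega>. dist x' x < d \<longrightarrow> dist (f x') (f x) < e"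
    proof (intro exI[of _ \<delta>] conjI \<delta>(1) ballI impI)
      fix x' assume x': "x' \<in> closure \<Omega>" "dist x' x < \<delta>"
      have "f x' \<le> f x + e / 2" "f x \<le> f x' + e / 2"
        using \<delta>(2) x x' by (auto simp: dist_commute)
      then show "dist (f x') (f x) < e" using e unfolding dist_real_def by linarith
    qed
  qed
  have ub: "ereal (ub t z) = (SUP C. ereal (Pb C z) + ereal (C * t))" if "t \<in> {0<..<1}" for t z
    using rooftop_profile_SUP(2)[OF profile that, of z] by (simp add: ub_def)
  show ?thesis
  proof (rule exI[of _ ub], rule exI[of _ Pb], intro conjI ballI allI)
    fix t :: real assume t: "t \<in> {0<..<1}"
    show "continuous_on (closure \<Omega>) (ub t)"
    proof (rule contI)
      fix e :: real assume "e > 0"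
      then obtain \<delta> where \<delta>: "\<delta> > 0" "\<And>C x y. x \<in> closure \<Omega> \<Longrightarrow> y \<in> closure \<Omega> \<Longrightarrow> dist x y < \<delta> \<Longrightarrow> Pb C y \<le> Pb C x + e"
        using modulus by meson
      have "ub t y \<le> ub t x + e" if "x \<in> closure \<Omega>" "y \<in> closure \<Omega>" "dist x y < \<delta>" for x y
        unfolding ub_def
      proof (rule cSUP_least)
        fix C
        have "Pb C y + C * t \<le> (Pb C x + C * t) + e" using \<delta>(2)[OF that, of C] by simp
        also have "Pb C x + C * t \<le> (SUP C. Pb C x + C * t)"
          by (rule cSUP_upper[OF _ rooftop_profile_SUP(1)[OF profile t]]) simp
        finally show "Pb C y + C * t \<le> (SUP C. Pb C x + C * t) + e" by simp
      qed simp
      then show "\<exists>\<delta>>0. \<forall>x\<in>closure \<Omega>. \<forall>y\<in>closure \<Omega>. dist x y < \<delta> \<longrightarrow> ub t y \<le> ub t x + e"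
        using \<delta>(1) by blast
    qed
    show "ereal (ub t z) = (SUP C. ereal (Pb C z) + ereal (C * t))" for z by (rule ub[OF t])
    show "ereal (ub t z) = geodesic_real \<Omega> u0 u1 t z" if "z \<in> \<Omega>" for z
      unfolding ub[OF t] geodesic_eq_SUP_rooftop[OF op that t] Pb[OF that] ..
  next
    fix C
    show "continuous_on (closure \<Omega>) (Pb C)" using modulus by (intro contI) meson
    show "ereal (Pb C z) = rooftop_real \<Omega> u0 u1 C z" if "z \<in> \<Omega>" for z by (rule Pb[OF that])
    show "ereal (Pb C z) = (INF t\<in>{0<..<1}. ereal (ub t z) - ereal (C * t))" for z
      using rooftop_profile_conjugate[OF profile, of C z] by (simp add: ub)
  qed
qed

theorem theoremD:
  fixes \<Omega> :: "(complex ^ 'n) set"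
    and u0 u1 :: "complex ^ 'n \<Rightarrow> real"
    and u :: "real \<Rightarrow> complex ^ 'n \<Rightarrow> ereal"
    and P :: "real \<Rightarrow> complex ^ 'n \<Rightarrow> ereal"
  assumes "open \<Omega>" "connected \<Omega>" "\<Omega> \<noteq> {}" "bounded \<Omega>"
    and "psh_on \<Omega> (\<lambda>z. ereal (u0 z))" "bounded (u0 ` \<Omega>)"
    and "psh_on \<Omega> (\<lambda>z. ereal (u1 z))" "bounded (u1 ` \<Omega>)"
  defines "u \<equiv> geodesic \<Omega> (\<lambda>z. ereal (u0 z)) (\<lambda>z. ereal (u1 z))"
    and "P \<equiv> (\<lambda>C. rooftop \<Omega> (\<lambda>z. ereal (u0 z)) (\<lambda>z. ereal (u1 z - C)))"
  shows
    "(\<forall>t\<in>{0<..<1}. \<forall>z\<in>\<Omega>. u t z = (SUP C. P C z + ereal (C * t))) \<and>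
     (\<forall>C. \<forall>z\<in>\<Omega>. P C z = (INF t\<in>{0<..<1}. u t z - ereal (C * t))) \<and>
     (\<forall>z\<in>\<Omega>. rooftop \<Omega> (\<lambda>z. ereal (u0 z)) (\<lambda>z. ereal (u1 z)) z = (INF t\<in>{0<..<1}. u t z)) \<and>
     (B_regular \<Omega> \<and> continuous_on (closure \<Omega>) u0 \<and> continuous_on (closure \<Omega>) u1 \<longrightarrow>
       (\<exists>(ub :: real \<Rightarrow> complex ^ 'n \<Rightarrow> real) (Pb :: real \<Rightarrow> complex ^ 'n \<Rightarrow> real).
          (\<forall>t\<in>{0<..<1}. continuous_on (closure \<Omega>) (ub t) \<and> (\<forall>z\<in>\<Omega>. ereal (ub t z) = u t z)) \<and>
          (\<forall>C. continuous_on (closure \<Omega>) (Pb C) \<and> (\<forall>z\<in>\<Omega>. ereal (Pb C z) = P C z)) \<and>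
          (\<forall>t\<in>{0<..<1}. \<forall>z\<in>frontier \<Omega>.
             ereal (ub t z) = (SUP C. ereal (Pb C z) + ereal (C * t))) \<and>
          (\<forall>C. \<forall>z\<in>frontier \<Omega>.
             ereal (Pb C z) = (INF t\<in>{0<..<1}. ereal (ub t z) - ereal (C * t)))))"
proof (intro conjI impI ballI allI)
  show "u t z = (SUP C. P C z + ereal (C * t))" if "t \<in> {0<..<1}" "z \<in> \<Omega>" for t z
    unfolding u_def P_def by (rule geodesic_eq_SUP_rooftop[OF assms(1) that(2,1)])
  show INF: "P C z = (INF t\<in>{0<..<1}. u t z - ereal (C * t))" if "z \<in> \<Omega>" for C z
    unfolding u_def P_def by (rule rooftop_eq_INF_geodesic[OF assms(1) that assms(6,8)])
  show "rooftop \<Omega> (\<lambda>z. ereal (u0 z)) (\<lambda>z. ereal (u1 z)) z = (INF t\<in>{0<..<1}. u t z)" if "z \<in> \<Omega>" for z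
    using INF[OF that, of 0] by (simp add: P_def flip: zero_ereal_def)
qed (unfold u_def P_def, elim conjE, rule boundary_extension[OF assms(1,4)])

end
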